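(* Consider either of the following generalized Hamiltonian systems $J\dot z=\nabla H(z)$, $z=(q,p,\lambda)\in\mathbb{R}^n\times\mathbb{R}^n\times\mathbb{R}^k$, with $$J=\begin{pmatrix}0&-I_n&0\\ I_n&0&0\\ 0&0&0_{k\times k}\end{pmatrix},$$ which are the Hamiltonian formulations of the Lagrange and sub-Riemannian problems. (A) $M$ is a symmetric nonsingular $n\times n$ matrix, $V\colon\mathbb{R}^n\to\mathbb{R}$ is smooth, $g_1,\dots,g_k\colon\mathbb{R}^n\to\mathbb{R}^n$ are smooth with values linearly independent for all arguments, and $$H(q,p,\lambda)=\tfrac12\Big(p+\sum_{i=1}^k\lambda_ig_i(q)\Big)^TM^{-1}\Big(p+\sum_{i=1}^k\lambda_ig_i(q)\Big)+V(q).$$ (This corresponds to the action $\int_{t_0}^{t_1}\big(\frac12\dot q^TM\dot q-V(q)\big)dt$ with constraints $g_i(q)\cdot\dot q=0$, $i=1,\dots,k$, and Legendre transform $p=M\dot q-\sum_i\lambda_ig_i(q)$.) (B) $L(t,q,\dot q)$ is a Lagrangian and $g_1(q,\dot q),\dots,g_k(q,\dot q)$ are real-valued constraint functions; with $F(q,\dot q,\lambda)=L(t,q,\dot q)-\sum_{i=1}^k\lambda_ig_i(q,\dot q)$, the Legendre transform $(\dot q,q,\lambda)\mapsto(p,q,\lambda)$, $p=\nabla_{\dot q}F(q,\dot q,\lambda)$, is invertible; the $k\times n$ matrix with entries $\partial g_i(q,\dot q)/\partial\dot q_j$ has full rank $k$ for all $q,\dot q$; and $H(z)=\dot q\cdot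 p-F(q,\dot q,\lambda)$, where $\dot q$ is expressed through $(q,p,\lambda)$ by inverting the Legendre transform. (This corresponds to the action $\int_{t_0}^{t_1}L(t,q,\dot q)\,dt$ with constraints $g_i(q,\dot q)=0$, $i=1,\dots,k$. Any dependence of $F$ and $H$ on $t$ is suppressed in the notation.) Then, in either case, symplectic Runge--Kutta methods applied to $J\dot z=\nabla H(z)$ yield convergent, constraint-preserving, symplectic integrators. When velocities are calculated using the Legendre transform, the constraints $g_i(q)\cdot\dot q=0$ in case (A), respectively $g_i(q,\dot q)=0$ in case (B), are satisfied exactly at the stages; and if the endpoint Lagrange multipliers are defined by $H_\lambda(q_n,p_n,\lambda_n)=0$, then the constraints are satisfied exactly at the endpoints.
   Context: A Runge--Kutta method with coefficients $a_{ij},b_i$ ($1\le i,j\le s$) is symplectic if $b_ib_j-b_ja_{ji}-b_ia_{ij}=0$ for all $i,j$. Applied to $J\dot z=\nabla H(z)$ with time step $\Delta t$, it relates $z_0$ to $z_1$ by $$JZ_i=Jz_0+\Delta t\sum_{j=1}^s a_{ij}JF_j,\qquad Jz_1=Jz_0+\Delta t\sum_{j=1}^s b_jJF_j,\qquad JF_j=\nabla H(Z_j),$$ with stages $Z_i=(Q_i,P_i,\Lambda_i)$ (here the vectors $F_j$ are unrelated to the function $F$ of case (B)), and is iterated to give $z_n=(q_n,p_n,\lambda_n)$. These equations do not involve the endpoint multipliers $\lambda_0,\lambda_1$; these are defined by the extra equations $H_\lambda(q_n,p_n,\lambda_n)=0$, where $H_\lambda=\nabla_\lambda H$. "Velocities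 calculated using the Legendre transform": at a point $(q,p,\lambda)$ (a stage $(Q_i,P_i,\Lambda_i)$ or an endpoint $(q_n,p_n,\lambda_n)$), the velocity $\dot q$ is obtained from $(q,p,\lambda)$ by solving $p=M\dot q-\sum_i\lambda_ig_i(q)$ in case (A), or $p=\nabla_{\dot q}F(q,\dot q,\lambda)$ in case (B). The constraint submanifold is $C=\{(q,p,\lambda):H_\lambda(q,p,\lambda)=0\}$, with symplectic form the restriction of $\frac12dz\wedge J\,dz=dq\wedge dp=\sum_i dq_i\wedge dp_i$. "Convergent" means that, for $\Delta t$ sufficiently small, the method is well defined and converges to solutions on $C$ as $\Delta t\to0$, with the same order as the Runge--Kutta method. "Constraint-preserving" and "symplectic" mean that the map $z_0\mapsto z_1$ maps $C$ to $C$ and preserves the symplectic form on $C$.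
   Formalization: For the convergent, constraint-preserving, symplectic claims it is also assumed that M (in (B): the velocity Hessian of F, where g=0) is nondegenerate on velocity variations tangent to the constraints; false otherwise, e.g. M=diag(1,-1), g=(1,1), V=q_1. Order ≥1; Legendre inverse smooth. *)

theory Defs
  imports "HOL-Analysis.Analysis"
begin

section \<open>Smoothness and gradients\<close>

primrec Ck_on :: "nat \<Rightarrow> 'a::real_normed_vector set \<Rightarrow> ('a \<Rightarrow> 'b::real_normed_vector) \<Rightarrow> bool" where
  "Ck_on 0 S f \<longleftrightarrow> continuous_on S f"
| "Ck_on (Suc n) S f \<longleftrightarrow> (\<forall>x\<in>S. f differentiable (at x)) \<and>
     (\<forall>v. Ck_on n S (\<lambda>x. frechet_derivative f (at x) v))"

text \<open>For finite-dimensional domains and open \<open>S\<close> this is the usual \<open>C\<close>-infinity.\<close>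

definition smooth_on :: "'a::real_normed_vector set \<Rightarrow> ('a \<Rightarrow> 'b::real_normed_vector) \<Rightarrow> bool" where
  "smooth_on S f \<longleftrightarrow> (\<forall>n. Ck_on n S f)"

definition grad :: "('a::real_inner \<Rightarrow> real) \<Rightarrow> 'a \<Rightarrow> 'a" where
  "grad f x = (THE d. GDERIV f x :> d)"


section \<open>Generalized Hamiltonian systems\<close>

text \<open>Points and tangent vectors are triples \<open>z = (q, p, \<lambda>)\<close>. Hamiltonians may depend on time.\<close>

type_synonym ('n, 'k) phase = "(real^'n) \<times> (real^'n) \<times> (real^'k)"

fun Jmap :: "('n::finite, 'k::finite) phase \<Rightarrow> ('n, 'k) phase" where
  "Jmap (q, p, l) = (- p, q, 0)"

fun grad_lambda :: "(('n::finite, 'k::finite) phase \<Rightarrow> real) \<Rightarrow> ('n, 'k) phase \<Rightarrow> real^'k" where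
  "grad_lambda H (q, p, l) = grad (\<lambda>l'. H (q, p, l')) l"

definition constraint_set ::
  "(real \<Rightarrow> ('n::finite, 'k::finite) phase \<Rightarrow> real) \<Rightarrow> real \<Rightarrow> ('n, 'k) phase set" where
  "constraint_set H t = {z. grad_lambda (H t) z = 0}"

text \<open>The two-form \<open>dq \<and> dp\<close>.\<close>

fun omega :: "('n::finite, 'k::finite) phase \<Rightarrow> ('n, 'k) phase \<Rightarrow> real" where
  "omega (q, p, l) (q', p', l') = q \<bullet> p' - q' \<bullet> p"

definition tangent_vectors :: "'a::real_normed_vector set \<Rightarrow> 'a \<Rightarrow> 'a set" where
  "tangent_vectors S x =
     {u. \<exists>\<gamma>. (\<forall>s::real. \<gamma> s \<in> S) \<and> \<gamma> 0 = x \<and> (\<gamma> has_vector_derivative u) (at 0)}"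

definition solution_on ::
  "(real \<Rightarrow> ('n::finite, 'k::finite) phase \<Rightarrow> real) \<Rightarrow> real \<Rightarrow> real \<Rightarrow> (real \<Rightarrow> ('n, 'k) phase) \<Rightarrow> bool" where
  "solution_on H t0 T z \<longleftrightarrow>
     (\<forall>t\<in>{t0..T}. z t \<in> constraint_set H t \<and>
        (\<exists>z'. (z has_vector_derivative z') (at t within {t0..T}) \<and> Jmap z' = grad (H t) (z t)))"


section \<open>Runge--Kutta methods\<close>

text \<open>Coefficients are indexed by a finite type. For time-dependent problems the abscissae are the
  row sums of \<open>a\<close>, i.e. time is treated as a further dependent variable.\<close>

definition abscissa :: "('s::finite \<Rightarrow> 's \<Rightarrow> real) \<Rightarrow> 's \<Rightarrow> real" where
  "abscissa a i = (\<Sum>j\<in>UNIV. a i j)"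

definition symplectic_rk :: "('s::finite \<Rightarrow> 's \<Rightarrow> real) \<Rightarrow> ('s \<Rightarrow> real) \<Rightarrow> bool" where
  "symplectic_rk a b \<longleftrightarrow> (\<forall>i j. b i * b j - b j * a j i - b i * a i j = 0)"

definition ode_rk_step ::
  "(real \<times> 'a \<Rightarrow> 'a::euclidean_space) \<Rightarrow> ('s::finite \<Rightarrow> 's \<Rightarrow> real) \<Rightarrow> ('s \<Rightarrow> real) \<Rightarrow>
   real \<Rightarrow> real \<Rightarrow> 'a \<Rightarrow> ('s \<Rightarrow> 'a) \<Rightarrow> 'a \<Rightarrow> bool" where
  "ode_rk_step f a b t h y0 Y y1 \<longleftrightarrow>
     (\<forall>i. Y i = y0 + h *\<^sub>R (\<Sum>j\<in>UNIV. a i j *\<^sub>R f (t + abscissa a j * h, Y j))) \<and>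
     y1 = y0 + h *\<^sub>R (\<Sum>j\<in>UNIV. b j *\<^sub>R f (t + abscissa a j * h, Y j))"

text \<open>Order \<open>p\<close>: for every smooth ordinary differential equation \<open>y' = f(t, y)\<close> the local error
  is \<open>O(h^(p+1))\<close>, locally uniformly in the initial data; the stages are those close to the
  initial value. The state space is a parameter because a definition cannot quantify over types;
  a method that has order \<open>p\<close> for equations of every dimension satisfies this for each \<open>'a\<close>.\<close>

definition rk_order ::
  "'a::euclidean_space itself \<Rightarrow> ('s::finite \<Rightarrow> 's \<Rightarrow> real) \<Rightarrow> ('s \<Rightarrow> real) \<Rightarrow> nat \<Rightarrow> bool" where
  "rk_order _ a b p \<longleftrightarrow>
     (\<forall>U (f :: real \<times> 'a \<Rightarrow> 'a). open U \<and> smooth_on U f \<longrightarrow>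
       (\<forall>K. compact K \<and> K \<subseteq> U \<longrightarrow>
         (\<exists>\<epsilon>>0. \<exists>h0>0. \<exists>C. \<forall>(t, y0)\<in>K. \<forall>h\<in>{0<..<h0}. \<forall>Y y1 y.
            ode_rk_step f a b t h y0 Y y1 \<and>
            (\<forall>i. (t + abscissa a i * h, Y i) \<in> U \<and> dist (Y i) y0 < \<epsilon>) \<and>
            y t = y0 \<and>
            (\<forall>s\<in>{t..t + h}. (s, y s) \<in> U \<and>
               (y has_vector_derivative f (s, y s)) (at s within {t..t + h})) \<longrightarrow>
            norm (y1 - y (t + h)) \<le> C * h ^ (p + 1))))"

definition rk_step ::
  "(real \<Rightarrow> ('n::finite, 'k::finite) phase \<Rightarrow> real) \<Rightarrow> ('s::finite \<Rightarrow> 's \<Rightarrow> real) \<Rightarrow> ('s \<Rightarrow> real) \<Rightarrow>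
   real \<Rightarrow> real \<Rightarrow> ('n, 'k) phase \<Rightarrow> ('s \<Rightarrow> ('n, 'k) phase) \<Rightarrow> ('n, 'k) phase \<Rightarrow> bool" where
  "rk_step H a b t h z0 Z z1 \<longleftrightarrow>
     (\<exists>F. (\<forall>i. Jmap (Z i) = Jmap z0 + h *\<^sub>R (\<Sum>j\<in>UNIV. a i j *\<^sub>R Jmap (F j))) \<and>
          Jmap z1 = Jmap z0 + h *\<^sub>R (\<Sum>j\<in>UNIV. b j *\<^sub>R Jmap (F j)) \<and>
          (\<forall>j. Jmap (F j) = grad (H (t + abscissa a j * h)) (Z j)))"


section \<open>Integrators on the constraint set\<close>

text \<open>Statements about \<open>z \<in> constraint_set H t\<close> that hold for sufficiently small time steps,
  locally uniformly in \<open>(t, z)\<close>.\<close>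

definition for_small_steps ::
  "(real \<Rightarrow> ('n::finite, 'k::finite) phase \<Rightarrow> real) \<Rightarrow> (real \<Rightarrow> real \<Rightarrow> ('n, 'k) phase \<Rightarrow> bool) \<Rightarrow> bool" where
  "for_small_steps H P \<longleftrightarrow>
     (\<forall>K. compact K \<and> K \<subseteq> {(t, z). z \<in> constraint_set H t} \<longrightarrow>
        (\<exists>h0>0. \<forall>(t, z)\<in>K. \<forall>h\<in>{0<..<h0}. P t h z))"

text \<open>\<open>\<Phi> t h\<close> is the map \<open>z\<^sub>0 \<mapsto> z\<^sub>1\<close> of the method: for small \<open>h\<close>, near \<open>z\<^sub>0\<close> the
  Runge--Kutta equations, with the endpoint multiplier fixed by \<open>H\<^sub>\<lambda> = 0\<close>, have exactly one solution.
  Nearness is needed as the equations can have further, spurious solutions.\<close>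

definition rk_integrator ::
  "(real \<Rightarrow> ('n::finite, 'k::finite) phase \<Rightarrow> real) \<Rightarrow> ('s::finite \<Rightarrow> 's \<Rightarrow> real) \<Rightarrow> ('s \<Rightarrow> real) \<Rightarrow>
   (real \<Rightarrow> real \<Rightarrow> ('n, 'k) phase \<Rightarrow> ('n, 'k) phase) \<Rightarrow> bool" where
  "rk_integrator H a b \<Phi> \<longleftrightarrow>
     (\<forall>K. compact K \<and> K \<subseteq> {(t, z). z \<in> constraint_set H t} \<longrightarrow>
        (\<exists>\<epsilon>>0. \<exists>h0>0. \<forall>(t, z)\<in>K. \<forall>h\<in>{0<..<h0}. \<exists>Z.
           {(Z', z1). rk_step H a b t h z Z' z1 \<and> z1 \<in> constraint_set H (t + h) \<and>
                      (\<forall>i. dist (Z' i) z < \<epsilon>) \<and> dist z1 z < \<epsilon>} = {(Z, \<Phi> t h z)}))"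

primrec iterates :: "(real \<Rightarrow> real \<Rightarrow> 'a \<Rightarrow> 'a) \<Rightarrow> real \<Rightarrow> real \<Rightarrow> 'a \<Rightarrow> nat \<Rightarrow> 'a" where
  "iterates \<Phi> t0 h z0 0 = z0"
| "iterates \<Phi> t0 h z0 (Suc n) = \<Phi> (t0 + real n * h) h (iterates \<Phi> t0 h z0 n)"

definition convergent_of_order ::
  "(real \<Rightarrow> ('n::finite, 'k::finite) phase \<Rightarrow> real) \<Rightarrow> ('s::finite \<Rightarrow> 's \<Rightarrow> real) \<Rightarrow> ('s \<Rightarrow> real) \<Rightarrow>
   (real \<Rightarrow> real \<Rightarrow> ('n, 'k) phase \<Rightarrow> ('n, 'k) phase) \<Rightarrow> nat \<Rightarrow> bool" where
  "convergent_of_order H a b \<Phi> p \<longleftrightarrow>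
     (\<forall>t0 T z. t0 < T \<and> solution_on H t0 T z \<longrightarrow>
       (\<exists>h0>0. \<exists>C. \<forall>h\<in>{0<..<h0}. \<forall>n.
          (t0 + real n * h \<le> T \<longrightarrow>
             norm (iterates \<Phi> t0 h (z t0) n - z (t0 + real n * h)) \<le> C * h ^ p) \<and>
          (t0 + real (Suc n) * h \<le> T \<longrightarrow>
             (\<exists>Z. rk_step H a b (t0 + real n * h) h (iterates \<Phi> t0 h (z t0) n) Z
                    (iterates \<Phi> t0 h (z t0) (Suc n))))))"

definition constraint_preserving ::
  "(real \<Rightarrow> ('n::finite, 'k::finite) phase \<Rightarrow> real) \<Rightarrow>
   (real \<Rightarrow> real \<Rightarrow> ('n, 'k) phase \<Rightarrow> ('n, 'k) phase) \<Rightarrow> bool" where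
  "constraint_preserving H \<Phi> \<longleftrightarrow>
     for_small_steps H (\<lambda>t h z. \<Phi> t h z \<in> constraint_set H (t + h))"

definition symplectic_integrator ::
  "(real \<Rightarrow> ('n::finite, 'k::finite) phase \<Rightarrow> real) \<Rightarrow>
   (real \<Rightarrow> real \<Rightarrow> ('n, 'k) phase \<Rightarrow> ('n, 'k) phase) \<Rightarrow> bool" where
  "symplectic_integrator H \<Phi> \<longleftrightarrow>
     for_small_steps H (\<lambda>t h z.
       \<Phi> t h differentiable (at z within constraint_set H t) \<and>
       (\<forall>D. (\<Phi> t h has_derivative D) (at z within constraint_set H t) \<longrightarrow>
          (\<forall>u\<in>tangent_vectors (constraint_set H t) z.
           \<forall>w\<in>tangent_vectors (constraint_set H t) z. omega (D u) (D w) = omega u w)))"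

text \<open>Order at least one (consistency) is required for convergence.\<close>

definition yields_convergent_preserving_symplectic ::
  "(real \<Rightarrow> ('n::finite, 'k::finite) phase \<Rightarrow> real) \<Rightarrow> ('s::finite \<Rightarrow> 's \<Rightarrow> real) \<Rightarrow> ('s \<Rightarrow> real) \<Rightarrow> bool" where
  "yields_convergent_preserving_symplectic H a b \<longleftrightarrow>
     (\<exists>\<Phi>. rk_integrator H a b \<Phi>) \<and>
     (\<forall>\<Phi>. rk_integrator H a b \<Phi> \<longrightarrow>
        (\<forall>p\<ge>1. rk_order TYPE((real^'n) \<times> (real^'n)) a b p \<longrightarrow> convergent_of_order H a b \<Phi> p) \<and>
        constraint_preserving H \<Phi> \<and>
        symplectic_integrator H \<Phi>)"

text \<open>In the following, \<open>leg t z v\<close> says that \<open>v\<close> solves the Legendre relation at \<open>z\<close>, and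
  \<open>con i q v = 0\<close> are the constraints on the velocity.\<close>

definition velocity_satisfies ::
  "(real \<Rightarrow> ('n::finite, 'k::finite) phase \<Rightarrow> real^'n \<Rightarrow> bool) \<Rightarrow> ('k \<Rightarrow> real^'n \<Rightarrow> real^'n \<Rightarrow> real) \<Rightarrow>
   real \<Rightarrow> ('n, 'k) phase \<Rightarrow> bool" where
  "velocity_satisfies leg con t z \<longleftrightarrow>
     (\<exists>!v. leg t z v) \<and> (\<forall>v. leg t z v \<longrightarrow> (\<forall>i. con i (fst z) v = 0))"

definition exact_at_stages ::
  "(real \<Rightarrow> ('n::finite, 'k::finite) phase \<Rightarrow> real) \<Rightarrow> ('s::finite \<Rightarrow> 's \<Rightarrow> real) \<Rightarrow> ('s \<Rightarrow> real) \<Rightarrow>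
   (real \<Rightarrow> ('n, 'k) phase \<Rightarrow> real^'n \<Rightarrow> bool) \<Rightarrow> ('k \<Rightarrow> real^'n \<Rightarrow> real^'n \<Rightarrow> real) \<Rightarrow> bool" where
  "exact_at_stages H a b leg con \<longleftrightarrow>
     (\<forall>t h z0 Z z1. rk_step H a b t h z0 Z z1 \<longrightarrow>
        (\<forall>i. velocity_satisfies leg con (t + abscissa a i * h) (Z i)))"

definition exact_at_endpoints ::
  "(real \<Rightarrow> ('n::finite, 'k::finite) phase \<Rightarrow> real) \<Rightarrow> ('s::finite \<Rightarrow> 's \<Rightarrow> real) \<Rightarrow> ('s \<Rightarrow> real) \<Rightarrow>
   (real \<Rightarrow> ('n, 'k) phase \<Rightarrow> real^'n \<Rightarrow> bool) \<Rightarrow> ('k \<Rightarrow> real^'n \<Rightarrow> real^'n \<Rightarrow> real) \<Rightarrow> bool" where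
  "exact_at_endpoints H a b leg con \<longleftrightarrow>
     (\<forall>t h z0 Z z1. rk_step H a b t h z0 Z z1 \<longrightarrow>
        (grad_lambda (H t) z0 = 0 \<longrightarrow> velocity_satisfies leg con t z0) \<and>
        (grad_lambda (H (t + h)) z1 = 0 \<longrightarrow> velocity_satisfies leg con (t + h) z1))"


section \<open>The two problem classes\<close>

text \<open>The bilinear form \<open>(u, w) \<mapsto> w \<bullet> T u\<close> is nondegenerate on the subspace \<open>W\<close>.\<close>

definition nondegenerate_on :: "'a::real_inner set \<Rightarrow> ('a \<Rightarrow> 'a) \<Rightarrow> bool" where
  "nondegenerate_on W T \<longleftrightarrow> (\<forall>u\<in>W. (\<forall>w\<in>W. w \<bullet> T u = 0) \<longrightarrow> u = 0)"

lemma positive_definite_imp_nondegenerate_on: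
  assumes "\<And>u. u \<noteq> 0 \<Longrightarrow> u \<bullet> T u > 0"
  shows "nondegenerate_on W T"
  using assms unfolding nondegenerate_on_def by (metis less_irrefl)

fun hamiltonian_A ::
  "real^'n^'n \<Rightarrow> (real^'n \<Rightarrow> real) \<Rightarrow> ('k \<Rightarrow> real^'n \<Rightarrow> real^'n) \<Rightarrow> ('n::finite, 'k::finite) phase \<Rightarrow> real" where
  "hamiltonian_A M V g (q, p, l) =
     (let w = p + (\<Sum>i\<in>UNIV. (l $ i) *\<^sub>R g i q) in w \<bullet> (matrix_inv M *v w) / 2 + V q)"

fun legendre_A ::
  "real^'n^'n \<Rightarrow> ('k \<Rightarrow> real^'n \<Rightarrow> real^'n) \<Rightarrow> ('n::finite, 'k::finite) phase \<Rightarrow> real^'n \<Rightarrow> bool" where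
  "legendre_A M g (q, p, l) v \<longleftrightarrow> p = M *v v - (\<Sum>i\<in>UNIV. (l $ i) *\<^sub>R g i q)"

definition problem_A ::
  "real^'n^'n \<Rightarrow> (real^'n \<Rightarrow> real) \<Rightarrow> ('k::finite \<Rightarrow> real^'n \<Rightarrow> real^'n::finite) \<Rightarrow> bool" where
  "problem_A M V g \<longleftrightarrow>
     transpose M = M \<and> invertible M \<and> smooth_on UNIV V \<and> (\<forall>i. smooth_on UNIV (g i)) \<and>
     (\<forall>q. inj (\<lambda>i. g i q) \<and> independent (range (\<lambda>i. g i q)))"

definition regular_A :: "real^'n^'n \<Rightarrow> ('k::finite \<Rightarrow> real^'n \<Rightarrow> real^'n::finite) \<Rightarrow> bool" where
  "regular_A M g \<longleftrightarrow> (\<forall>q. nondegenerate_on {v. \<forall>i. g i q \<bullet> v = 0} ((*v) M))"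

definition augmented_lagrangian ::
  "(real \<Rightarrow> real^'n \<Rightarrow> real^'n \<Rightarrow> real) \<Rightarrow> ('k::finite \<Rightarrow> real^'n \<Rightarrow> real^'n \<Rightarrow> real) \<Rightarrow>
   real \<Rightarrow> real^'n \<Rightarrow> real^'n::finite \<Rightarrow> real^'k \<Rightarrow> real" where
  "augmented_lagrangian L g t q v l = L t q v - (\<Sum>i\<in>UNIV. l $ i * g i q v)"

fun legendre_B ::
  "(real \<Rightarrow> real^'n \<Rightarrow> real^'n \<Rightarrow> real) \<Rightarrow> ('k::finite \<Rightarrow> real^'n \<Rightarrow> real^'n \<Rightarrow> real) \<Rightarrow>
   real \<Rightarrow> ('n::finite, 'k) phase \<Rightarrow> real^'n \<Rightarrow> bool" where
  "legendre_B L g t (q, p, l) v \<longleftrightarrow> p = grad (\<lambda>v'. augmented_lagrangian L g t q v' l) v"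

fun legendre_transform ::
  "(real \<Rightarrow> real^'n \<Rightarrow> real^'n \<Rightarrow> real) \<Rightarrow> ('k::finite \<Rightarrow> real^'n \<Rightarrow> real^'n \<Rightarrow> real) \<Rightarrow>
   real \<Rightarrow> ('n::finite, 'k) phase \<Rightarrow> ('n, 'k) phase" where
  "legendre_transform L g t (v, q, l) = (grad (\<lambda>v'. augmented_lagrangian L g t q v' l) v, q, l)"

fun hamiltonian_B ::
  "(real \<Rightarrow> real^'n \<Rightarrow> real^'n \<Rightarrow> real) \<Rightarrow> ('k::finite \<Rightarrow> real^'n \<Rightarrow> real^'n \<Rightarrow> real) \<Rightarrow>
   real \<Rightarrow> ('n::finite, 'k) phase \<Rightarrow> real" where
  "hamiltonian_B L g t (q, p, l) =
     (let v = fst (inv (legendre_transform L g t) (p, q, l))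
      in v \<bullet> p - augmented_lagrangian L g t q v l)"

text \<open>Invertibility of the Legendre transform is meant in the smooth category: a smooth bijection
  with singular derivative, such as \<open>v \<mapsto> v^3\<close>, would give a Hamiltonian that is not smooth.\<close>

definition problem_B ::
  "(real \<Rightarrow> real^'n \<Rightarrow> real^'n \<Rightarrow> real) \<Rightarrow> ('k::finite \<Rightarrow> real^'n \<Rightarrow> real^'n::finite \<Rightarrow> real) \<Rightarrow> bool" where
  "problem_B L g \<longleftrightarrow>
     smooth_on UNIV (\<lambda>(t, q, v). L t q v) \<and> (\<forall>i. smooth_on UNIV (\<lambda>(q, v). g i q v)) \<and>
     (\<forall>t. bij (legendre_transform L g t)) \<and>
     smooth_on UNIV (\<lambda>(t, y). inv (legendre_transform L g t) y) \<and>
     (\<forall>q v. rank (\<chi> i. grad (g i q) v) = CARD('k))"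

definition regular_B ::
  "(real \<Rightarrow> real^'n \<Rightarrow> real^'n \<Rightarrow> real) \<Rightarrow> ('k::finite \<Rightarrow> real^'n \<Rightarrow> real^'n::finite \<Rightarrow> real) \<Rightarrow> bool" where
  "regular_B L g \<longleftrightarrow>
     (\<forall>t q v l. (\<forall>i. g i q v = 0) \<longrightarrow>
        nondegenerate_on {u. \<forall>i. grad (g i q) v \<bullet> u = 0}
          (frechet_derivative (grad (\<lambda>v'. augmented_lagrangian L g t q v' l)) (at v)))"

text \<open>Nonsingularity of \<open>M\<close>, respectively of the Hessian of the augmented Lagrangian in the velocity,
  does not imply that \<open>H\<^sub>\<lambda>\<^sub>\<lambda>\<close> is nonsingular: for \<open>M = diag(1, -1)\<close>, \<open>k = 1\<close>, \<open>g = (1, 1)\<close>,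
  \<open>V(q) = q\<^sub>1\<close> the Hamiltonian is affine in \<open>\<lambda>\<close> and the system has no solutions at all. The conditions
  \<open>regular_A\<close> and \<open>regular_B\<close> require the velocity Hessian to be nondegenerate on velocity
  variations compatible with the constraints; given the other hypotheses this is exactly what is
  missing, and it always holds if the Hessian is positive definite.\<close>

end

theory Submission
  imports Defs
begin

text \<open>
  The multipliers can be eliminated. Under the regularity assumption, on the constraint set \<open>H\<^sub>\<lambda> = 0\<close> the matrix \<open>H\<^sub>\<lambda>\<^sub>\<lambda>\<close> is
  nonsingular, so near each of its points the constraint set is the graph of a smooth function
  \<open>\<lambda> = \<Lambda>(t, q, p)\<close>, and the generalized Hamiltonian system is there an ordinary differential equation
  \<open>y' = f(t, y)\<close> for \<open>y = (q, p)\<close>. The third row of \<open>J F\<^sub>j = \<nabla>H(Z\<^sub>j)\<close> reads \<open>0 = H\<^sub>\<lambda>(Z\<^sub>j)\<close>: every stage lies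
  on the constraint set. Hence a Runge--Kutta step of the constrained system is, near a point, exactly
  an ordinary Runge--Kutta step for \<open>f\<close>, with the multipliers of stages and endpoint read off from
  \<open>\<Lambda>\<close> (\<open>local_step_family_exists\<close>). Local solvability and uniqueness, differentiable dependence on the initial
  value and the order of the method all carry over from ordinary differential equations. Everything
  local becomes uniform on compact sets through \<open>compact_uniformly_small\<close>; convergence is then the
  classical argument that combines the local error with the Lipschitz constant \<open>1 + O(h)\<close> of a step
  (\<open>rk_integrator_convergent\<close>).

  Symplecticity is the usual variational computation. The derivatives of the stages satisfy the linearized
  Runge--Kutta equations; in the difference of \<open>dq \<and> dp\<close> before and after the step the quadratic terms
  carry the coefficients \<open>b\<^sub>i b\<^sub>j - b\<^sub>j a\<^sub>j\<^sub>i - b\<^sub>i a\<^sub>i\<^sub>j\<close>, which vanish, and the remaining terms cancel because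
  the Hessian of \<open>H\<close> is symmetric (\<open>symplectic_rk_preserves_bilinear\<close>, \<open>step_maps_symplectic\<close>). The degenerate
  directions of \<open>J\<close> do no harm because the \<open>\<lambda>\<close>-component of the linearized \<open>\<nabla>H\<close> vanishes along the stages.

  For Hamiltonians that come from a Legendre transform, \<open>H\<^sub>\<lambda>\<close> evaluates to the vector of constraint functions
  at the velocity belonging to \<open>(q, p, \<lambda>)\<close> (\<open>grad_lambda_hamiltonian_B\<close>). So being on the constraint set
  means exactly that this velocity satisfies the constraints, which gives the statements on stages and
  endpoints; and nonsingularity of \<open>H\<^sub>\<lambda>\<^sub>\<lambda>\<close> becomes nondegeneracy of the velocity Hessian on the admissible
  velocity variations (\<open>regular_B_imp_regular_hamiltonian\<close>). The quadratic problem (A) is the instance of (B) with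
  Lagrangian \<open>v \<bullet> M v / 2 - V(q)\<close> and constraints linear in \<open>v\<close>.
\<close>

section \<open>Calculus of continuously differentiable functions\<close>

lemma Ck_on_has_derivative:
  "Ck_on (Suc n) S f \<Longrightarrow> x \<in> S \<Longrightarrow> (f has_derivative frechet_derivative f (at x)) (at x)"
  by (simp add: frechet_derivative_works)

lemma Ck_on_continuous_on: "Ck_on n S f \<Longrightarrow> continuous_on S f"
  by (cases n) (auto intro!: continuous_at_imp_continuous_on differentiable_imp_continuous_within)

lemma Ck_on_Suc_D: "Ck_on (Suc n) S f \<Longrightarrow> Ck_on n S f"
proof (induction n arbitrary: f)
  case 0
  then show ?case using Ck_on_continuous_on[OF "0"] by simp
next
  case (Suc n)
  have "Ck_on n S (\<lambda>x. frechet_derivative f (at x) v)" for v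
    using Suc.prems by (intro Suc.IH) simp
  then show ?case using Suc.prems by simp
qed

lemma Ck_on_subset: "Ck_on n S f \<Longrightarrow> T \<subseteq> S \<Longrightarrow> Ck_on n T f"
  by (induction n arbitrary: f) (auto intro: continuous_on_subset)

lemma Ck_on_cong:
  assumes "open S" "Ck_on n S f" "\<And>x. x \<in> S \<Longrightarrow> f x = g x"
  shows "Ck_on n S g"
  using assms(2,3)
proof (induction n arbitrary: f g)
  case 0
  then show ?case using continuous_on_eq[of S f g] by simp
next
  case (Suc n)
  have *: "(g has_derivative frechet_derivative f (at x)) (at x)" if "x \<in> S" for x
    using has_derivative_transform_within_open[OF Ck_on_has_derivative[OF Suc.prems(1) that] assms(1) that]
      Suc.prems(2) by blast
  have "Ck_on n S (\<lambda>x. frechet_derivative g (at x) v)" for v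
    by (rule Suc.IH[of "\<lambda>x. frechet_derivative f (at x) v"])
      (use Suc.prems frechet_derivative_at[OF *] in auto)
  then show ?case using * by (auto simp: differentiable_def)
qed

lemma Ck_on_SucI:
  assumes "open S" "\<And>x. x \<in> S \<Longrightarrow> (f has_derivative f' x) (at x)" "\<And>v. Ck_on n S (\<lambda>x. f' x v)"
  shows "Ck_on (Suc n) S f"
proof -
  have "Ck_on n S (\<lambda>x. frechet_derivative f (at x) v)" for v
    by (rule Ck_on_cong[OF assms(1) assms(3)[of v]]) (metis assms(2) frechet_derivative_at)
  then show ?thesis using assms(2) by (auto simp: differentiable_def)
qed

lemma Ck_on_const: "open S \<Longrightarrow> Ck_on n S (\<lambda>x. c)"
  by (induction n arbitrary: c) auto

lemma Ck_on_bounded_linear_compose: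
  assumes L: "bounded_linear L" and "open S" "Ck_on n S f"
  shows "Ck_on n S (\<lambda>x. L (f x))"
  using assms(3)
proof (induction n arbitrary: f)
  case 0
  then show ?case using bounded_linear.continuous_on[OF L] by simp
next
  case (Suc n)
  show ?case
  proof (rule Ck_on_SucI[OF assms(2)])
    show "((\<lambda>x. L (f x)) has_derivative (\<lambda>v. L (frechet_derivative f (at x) v))) (at x)" if "x \<in> S" for x
      by (rule bounded_linear.has_derivative[OF L Ck_on_has_derivative[OF Suc.prems that]])
    show "Ck_on n S (\<lambda>x. L (frechet_derivative f (at x) v))" for v
      using Suc by auto
  qed
qed

lemma Ck_on_ident: "open S \<Longrightarrow> Ck_on n S (\<lambda>x. x)"
  by (cases n) (auto intro: Ck_on_const)

lemma Ck_on_bounded_linear: "bounded_linear L \<Longrightarrow> open S \<Longrightarrow> Ck_on n S L"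
  using Ck_on_bounded_linear_compose[OF _ _ Ck_on_ident] by blast

lemma Ck_on_add:
  assumes "open S" "Ck_on n S f" "Ck_on n S g"
  shows "Ck_on n S (\<lambda>x. f x + g x)"
  using assms(2,3)
proof (induction n arbitrary: f g)
  case 0
  then show ?case by (auto intro: continuous_intros)
next
  case (Suc n)
  show ?case
  proof (rule Ck_on_SucI[OF assms(1)])
    show "((\<lambda>x. f x + g x) has_derivative
        (\<lambda>v. frechet_derivative f (at x) v + frechet_derivative g (at x) v)) (at x)" if "x \<in> S" for x
      using that Suc.prems by (intro has_derivative_add Ck_on_has_derivative) auto
    show "Ck_on n S (\<lambda>x. frechet_derivative f (at x) v + frechet_derivative g (at x) v)" for v
      using Suc by auto
  qed
qed

lemma Ck_on_minus: "open S \<Longrightarrow> Ck_on n S f \<Longrightarrow> Ck_on n S (\<lambda>x. - f x)"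
  using Ck_on_bounded_linear_compose[OF bounded_linear_minus[OF bounded_linear_ident]] by blast

lemma Ck_on_diff:
  "open S \<Longrightarrow> Ck_on n S f \<Longrightarrow> Ck_on n S g \<Longrightarrow> Ck_on n S (\<lambda>x. f x - g x)"
  using Ck_on_add[OF _ _ Ck_on_minus, of S n f g] by simp

lemma Ck_on_sum:
  assumes "open S" "\<And>i. i \<in> I \<Longrightarrow> Ck_on n S (f i)"
  shows "Ck_on n S (\<lambda>x. \<Sum>i\<in>I. f i x)"
  using assms(2)
  by (induction I rule: infinite_finite_induct) (auto intro: Ck_on_const Ck_on_add assms(1))

lemma Ck_on_bilinear:
  assumes B: "bounded_bilinear B" and "open S" "Ck_on n S f" "Ck_on n S g"
  shows "Ck_on n S (\<lambda>x. B (f x) (g x))"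
  using assms(3,4)
proof (induction n arbitrary: f g)
  case 0
  then show ?case using bounded_bilinear.continuous_on[OF B] by simp
next
  case (Suc n)
  show ?case
  proof (rule Ck_on_SucI[OF assms(2)])
    show "((\<lambda>x. B (f x) (g x)) has_derivative
        (\<lambda>v. B (f x) (frechet_derivative g (at x) v) + B (frechet_derivative f (at x) v) (g x))) (at x)"
      if "x \<in> S" for x
      using that Suc.prems by (intro bounded_bilinear.FDERIV[OF B] Ck_on_has_derivative) auto
    show "Ck_on n S (\<lambda>x. B (f x) (frechet_derivative g (at x) v) + B (frechet_derivative f (at x) v) (g x))" for v
      using Suc.prems Suc.prems[THEN Ck_on_Suc_D] by (intro Ck_on_add[OF assms(2)] Suc.IH) simp_all
  qed
qed

lemmas Ck_on_mult = Ck_on_bilinear[OF bounded_bilinear_mult]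
lemmas Ck_on_scaleR = Ck_on_bilinear[OF bounded_bilinear_scaleR]
lemmas Ck_on_inner = Ck_on_bilinear[OF bounded_bilinear_inner]

lemma Ck_on_prod:
  fixes f :: "'i \<Rightarrow> 'a::real_normed_vector \<Rightarrow> real"
  assumes "open S" "\<And>i. i \<in> I \<Longrightarrow> Ck_on n S (f i)"
  shows "Ck_on n S (\<lambda>x. \<Prod>i\<in>I. f i x)"
  using assms(2)
  by (induction I rule: infinite_finite_induct) (auto intro: Ck_on_const Ck_on_mult assms(1))

lemma Ck_on_inverse:
  fixes f :: "'a::real_normed_vector \<Rightarrow> real"
  assumes "open S" "Ck_on n S f" "\<And>x. x \<in> S \<Longrightarrow> f x \<noteq> 0"
  shows "Ck_on n S (\<lambda>x. inverse (f x))"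
  using assms(2)
proof (induction n)
  case 0
  then show ?case using assms(3) by (auto intro: continuous_intros)
next
  case (Suc n)
  show ?case
  proof (rule Ck_on_SucI[OF assms(1)])
    show "((\<lambda>x. inverse (f x)) has_derivative
        (\<lambda>v. - (inverse (f x) * frechet_derivative f (at x) v * inverse (f x)))) (at x)" if "x \<in> S" for x
      using that Suc.prems assms(3) by (intro Deriv.has_derivative_inverse Ck_on_has_derivative) auto
    have "Ck_on n S (\<lambda>x. inverse (f x))" using Suc Ck_on_Suc_D by blast
    then show "Ck_on n S (\<lambda>x. - (inverse (f x) * frechet_derivative f (at x) v * inverse (f x)))" for v
      using Suc.prems by (intro Ck_on_minus Ck_on_mult assms(1)) auto
  qed
qed

lemma Ck_on_Pair:
  assumes "open S" "Ck_on n S f" "Ck_on n S g"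
  shows "Ck_on n S (\<lambda>x. (f x, g x))"
proof -
  have "bounded_linear (\<lambda>u. (u, 0))" "bounded_linear (\<lambda>u. (0, u))"
    by (auto intro!: bounded_linear_Pair bounded_linear_ident bounded_linear_zero)
  from Ck_on_add[OF assms(1) Ck_on_bounded_linear_compose[OF this(1) assms(1,2)]
      Ck_on_bounded_linear_compose[OF this(2) assms(1,3)]]
  show ?thesis by simp
qed

lemma linear_eq_sum_Basis:
  fixes L :: "'a::euclidean_space \<Rightarrow> 'b::real_vector"
  assumes "linear L"
  shows "L v = (\<Sum>b\<in>Basis. (v \<bullet> b) *\<^sub>R L b)"
proof -
  have "L v = L (\<Sum>b\<in>Basis. (v \<bullet> b) *\<^sub>R b)" by (simp add: euclidean_representation)
  then show ?thesis using assms by (simp add: linear_sum linear_scale)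
qed

text \<open>By the chain rule the derivative of a composition is a finite sum of products of components of
  \<open>f'\<close> with directional derivatives of \<open>g\<close> along fixed basis vectors, composed with \<open>f\<close>. Only with fixed
  directions does the induction hypothesis apply to the second factor.\<close>
lemma Ck_on_compose:
  fixes f :: "'a::real_normed_vector \<Rightarrow> 'b::euclidean_space"
  assumes "open S" "open T" "Ck_on n S f" "Ck_on n T g" "\<And>x. x \<in> S \<Longrightarrow> f x \<in> T"
  shows "Ck_on n S (\<lambda>x. g (f x))"
  using assms(3,4)
proof (induction n arbitrary: g)
  case 0
  then show ?case using assms(5) by (auto intro: continuous_on_compose2)
next
  case (Suc n)
  let ?f' = "\<lambda>x. frechet_derivative f (at x)" and ?g' = "\<lambda>y. frechet_derivative g (at y)"
  show ?case
  proof (rule Ck_on_SucI[OF assms(1)])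
    show "((\<lambda>x. g (f x)) has_derivative
        (\<lambda>v. \<Sum>b\<in>Basis. (?f' x v \<bullet> b) *\<^sub>R ?g' (f x) b)) (at x)" if "x \<in> S" for x
    proof -
      have "(g has_derivative ?g' (f x)) (at (f x))"
        using that assms(5) Suc.prems(2) by (intro Ck_on_has_derivative) auto
      then have "linear (?g' (f x))" by (rule has_derivative_linear)
      have "((\<lambda>x. g (f x)) has_derivative (\<lambda>v. ?g' (f x) (?f' x v))) (at x)"
        using has_derivative_compose[OF Ck_on_has_derivative[OF Suc.prems(1) that]]
          \<open>(g has_derivative ?g' (f x)) (at (f x))\<close> by blast
      then show ?thesis by (subst (asm) linear_eq_sum_Basis[OF \<open>linear (?g' (f x))\<close>])
    qed
    have "Ck_on n S f" by (rule Ck_on_Suc_D[OF Suc.prems(1)])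
    moreover have "Ck_on n T (\<lambda>y. ?g' y b)" for b
      using Suc.prems(2) by simp
    ultimately have "Ck_on n S (\<lambda>x. ?g' (f x) b)" for b by (rule Suc.IH)
    then show "Ck_on n S (\<lambda>x. \<Sum>b\<in>Basis. (?f' x v \<bullet> b) *\<^sub>R ?g' (f x) b)" for v
      using Suc.prems(1)
      by (intro Ck_on_sum Ck_on_scaleR Ck_on_inner Ck_on_const assms(1)) auto
  qed
qed

lemma Ck_on_euclidean_components:
  fixes f :: "'a::real_normed_vector \<Rightarrow> 'b::euclidean_space"
  assumes "open S" "\<And>b. b \<in> Basis \<Longrightarrow> Ck_on n S (\<lambda>x. f x \<bullet> b)"
  shows "Ck_on n S f"
proof (rule Ck_on_cong[OF assms(1)])
  show "Ck_on n S (\<lambda>x. \<Sum>b\<in>Basis. (f x \<bullet> b) *\<^sub>R b)"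
    using assms by (intro Ck_on_sum Ck_on_scaleR Ck_on_const)
qed (simp add: euclidean_representation)

lemma Ck_on_vec_nth: "open S \<Longrightarrow> Ck_on n S f \<Longrightarrow> Ck_on n S (\<lambda>x. f x $ i)"
  by (rule Ck_on_bounded_linear_compose[OF bounded_linear_vec_nth])

lemma Ck_on_vec_lambda:
  fixes f :: "'a::real_normed_vector \<Rightarrow> real^'k"
  assumes "open S" "\<And>i. Ck_on n S (\<lambda>x. f x $ i)"
  shows "Ck_on n S f"
proof (rule Ck_on_euclidean_components[OF assms(1)])
  show "Ck_on n S (\<lambda>x. f x \<bullet> b)" if "b \<in> Basis" for b
    using that assms(2) by (auto simp: Basis_vec_def inner_axis)
qed

lemma Ck_on_det:
  fixes A :: "'a::real_normed_vector \<Rightarrow> real^'k^'k"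
  assumes "open S" "\<And>i j. Ck_on n S (\<lambda>x. A x $ i $ j)"
  shows "Ck_on n S (\<lambda>x. det (A x))"
  unfolding det_def using assms by (intro Ck_on_sum Ck_on_mult Ck_on_const Ck_on_prod)

lemma smooth_on_has_derivative:
  "smooth_on S f \<Longrightarrow> x \<in> S \<Longrightarrow> (f has_derivative frechet_derivative f (at x)) (at x)"
  unfolding smooth_on_def using Ck_on_has_derivative by blast

lemma smooth_on_frechet_derivative:
  assumes "smooth_on S f"
  shows "smooth_on S (\<lambda>x. frechet_derivative f (at x) v)"
  unfolding smooth_on_def
proof
  fix n
  have "Ck_on (Suc n) S f" using assms unfolding smooth_on_def by blast
  then show "Ck_on n S (\<lambda>x. frechet_derivative f (at x) v)" by simp
qed

lemma smooth_on_continuous_on: "smooth_on S f \<Longrightarrow> continuous_on S f"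
  unfolding smooth_on_def by (meson Ck_on_continuous_on)

lemma smooth_on_subset: "smooth_on S f \<Longrightarrow> T \<subseteq> S \<Longrightarrow> smooth_on T f"
  unfolding smooth_on_def by (meson Ck_on_subset)

lemma smooth_on_cong:
  "open S \<Longrightarrow> smooth_on S f \<Longrightarrow> (\<And>x. x \<in> S \<Longrightarrow> f x = g x) \<Longrightarrow> smooth_on S g"
  unfolding smooth_on_def by (meson Ck_on_cong)

lemma smooth_on_compose:
  fixes f :: "'a::real_normed_vector \<Rightarrow> 'b::euclidean_space"
  shows "open S \<Longrightarrow> open T \<Longrightarrow> smooth_on S f \<Longrightarrow> smooth_on T g \<Longrightarrow> (\<And>x. x \<in> S \<Longrightarrow> f x \<in> T)
    \<Longrightarrow> smooth_on S (\<lambda>x. g (f x))"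
  unfolding smooth_on_def using Ck_on_compose[of S T _ f g] by blast

lemma smooth_on_const: "open S \<Longrightarrow> smooth_on S (\<lambda>x. c)"
  and smooth_on_bounded_linear: "bounded_linear L \<Longrightarrow> open S \<Longrightarrow> smooth_on S L"
  unfolding smooth_on_def by (simp_all add: Ck_on_const Ck_on_bounded_linear)

lemma smooth_on_bounded_linear_compose:
  "bounded_linear L \<Longrightarrow> open S \<Longrightarrow> smooth_on S f \<Longrightarrow> smooth_on S (\<lambda>x. L (f x))"
  unfolding smooth_on_def by (simp add: Ck_on_bounded_linear_compose)

lemmas smooth_on_fst = smooth_on_bounded_linear_compose[OF bounded_linear_fst]
lemmas smooth_on_snd = smooth_on_bounded_linear_compose[OF bounded_linear_snd]

lemma smooth_on_add: "open S \<Longrightarrow> smooth_on S f \<Longrightarrow> smooth_on S g \<Longrightarrow> smooth_on S (\<lambda>x. f x + g x)"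
  and smooth_on_diff: "open S \<Longrightarrow> smooth_on S f \<Longrightarrow> smooth_on S g \<Longrightarrow> smooth_on S (\<lambda>x. f x - g x)"
  and smooth_on_minus: "open S \<Longrightarrow> smooth_on S f \<Longrightarrow> smooth_on S (\<lambda>x. - f x)"
  and smooth_on_Pair: "open S \<Longrightarrow> smooth_on S f \<Longrightarrow> smooth_on S g' \<Longrightarrow> smooth_on S (\<lambda>x. (f x, g' x))"
  unfolding smooth_on_def by (simp_all add: Ck_on_add Ck_on_diff Ck_on_minus Ck_on_Pair)

lemma smooth_on_sum:
  "open S \<Longrightarrow> (\<And>i. i \<in> I \<Longrightarrow> smooth_on S (f i)) \<Longrightarrow> smooth_on S (\<lambda>x. \<Sum>i\<in>I. f i x)"
  unfolding smooth_on_def by (simp add: Ck_on_sum)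

lemma smooth_on_bilinear:
  "bounded_bilinear B \<Longrightarrow> open S \<Longrightarrow> smooth_on S f \<Longrightarrow> smooth_on S g \<Longrightarrow> smooth_on S (\<lambda>x. B (f x) (g x))"
  unfolding smooth_on_def by (simp add: Ck_on_bilinear)

lemmas smooth_on_mult = smooth_on_bilinear[OF bounded_bilinear_mult]
lemmas smooth_on_scaleR = smooth_on_bilinear[OF bounded_bilinear_scaleR]
lemmas smooth_on_inner = smooth_on_bilinear[OF bounded_bilinear_inner]

section \<open>Symmetry of second derivatives\<close>

text \<open>Two applications of the mean value theorem, first along \<open>u\<close> and then along \<open>v\<close>, turn the second difference
  quotient into a value of the iterated derivative at a point that tends to \<open>x\<close>. The quotient is symmetric in
  \<open>u\<close> and \<open>v\<close>, which yields the symmetry of second derivatives.\<close>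
lemma second_derivative_limit:
  fixes f :: "'a::real_normed_vector \<Rightarrow> real"
  assumes "Ck_on 2 UNIV f"
  shows "((\<lambda>s. (f (x + s *\<^sub>R u + s *\<^sub>R v) - f (x + s *\<^sub>R u) - f (x + s *\<^sub>R v) + f x) / s\<^sup>2)
    \<longlongrightarrow> frechet_derivative (\<lambda>y. frechet_derivative f (at y) u) (at x) v) (at_right 0)"
proof -
  let ?D = "\<lambda>y. frechet_derivative f (at y) u"
  let ?DD = "\<lambda>y. frechet_derivative ?D (at y) v"
  have f: "(f has_derivative frechet_derivative f (at y)) (at y)" for y
    using assms by (intro Ck_on_has_derivative[of 1 UNIV]) (auto simp: numeral_2_eq_2)
  have D: "(?D has_derivative frechet_derivative ?D (at y)) (at y)" for y
    using assms by (intro Ck_on_has_derivative[of 0 UNIV]) (auto simp: numeral_2_eq_2)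
  have cont: "continuous_on UNIV ?DD"
    using assms by (auto simp: numeral_2_eq_2)
  have fl: "((\<lambda>r. f (y + r *\<^sub>R u)) has_real_derivative ?D (y + r *\<^sub>R u)) (at r)" for y r
  proof -
    have "((\<lambda>r. f (y + r *\<^sub>R u)) has_derivative (\<lambda>h. frechet_derivative f (at (y + r *\<^sub>R u)) (h *\<^sub>R u))) (at r)"
      by (rule has_derivative_compose[OF _ f]) (auto intro!: derivative_eq_intros)
    moreover have "frechet_derivative f (at (y + r *\<^sub>R u)) (h *\<^sub>R u) = ?D (y + r *\<^sub>R u) * h" for h
      using has_derivative_linear[OF f] by (simp add: linear_cmul)
    ultimately show ?thesis by (simp add: has_field_derivative_def)
  qed
  have Dl: "((\<lambda>r. ?D (y + r *\<^sub>R v)) has_real_derivative ?DD (y + r *\<^sub>R v)) (at r)" for y r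
  proof -
    have "((\<lambda>r. ?D (y + r *\<^sub>R v)) has_derivative (\<lambda>h. frechet_derivative ?D (at (y + r *\<^sub>R v)) (h *\<^sub>R v))) (at r)"
      by (rule has_derivative_compose[OF _ D]) (auto intro!: derivative_eq_intros)
    moreover have "frechet_derivative ?D (at (y + r *\<^sub>R v)) (h *\<^sub>R v) = ?DD (y + r *\<^sub>R v) * h" for h
      using has_derivative_linear[OF D] by (simp add: linear_cmul)
    ultimately show ?thesis by (simp add: has_field_derivative_def)
  qed
  let ?Q = "\<lambda>s. (f (x + s *\<^sub>R u + s *\<^sub>R v) - f (x + s *\<^sub>R u) - f (x + s *\<^sub>R v) + f x) / s\<^sup>2"
  have mvt: "\<exists>r q. 0 < r \<and> r < s \<and> 0 < q \<and> q < s \<and> ?Q s = ?DD (x + r *\<^sub>R u + q *\<^sub>R v)" if "0 < s" for s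
  proof -
    have "\<exists>r. 0 < r \<and> r < s \<and> (f (x + s *\<^sub>R v + s *\<^sub>R u) - f (x + s *\<^sub>R u)) - (f (x + s *\<^sub>R v + 0 *\<^sub>R u) - f (x + 0 *\<^sub>R u))
        = (s - 0) * (?D (x + s *\<^sub>R v + r *\<^sub>R u) - ?D (x + r *\<^sub>R u))"
      using that fl by (intro MVT2) (auto intro!: DERIV_diff)
    then obtain r where r: "0 < r" "r < s" and
      1: "f (x + s *\<^sub>R v + s *\<^sub>R u) - f (x + s *\<^sub>R u) - (f (x + s *\<^sub>R v) - f x)
        = s * (?D (x + s *\<^sub>R v + r *\<^sub>R u) - ?D (x + r *\<^sub>R u))" by auto
    have "\<exists>q. 0 < q \<and> q < s \<and> ?D (x + r *\<^sub>R u + s *\<^sub>R v) - ?D (x + r *\<^sub>R u + 0 *\<^sub>R v)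
        = (s - 0) * ?DD (x + r *\<^sub>R u + q *\<^sub>R v)"
      using that Dl by (intro MVT2) auto
    then obtain q where "0 < q" "q < s" "?D (x + r *\<^sub>R u + s *\<^sub>R v) - ?D (x + r *\<^sub>R u)
        = s * ?DD (x + r *\<^sub>R u + q *\<^sub>R v)" by auto
    with 1 r that show ?thesis
      by (intro exI[of _ r] exI[of _ q]) (simp add: field_simps power2_eq_square add.commute add.left_commute)
  qed
  show ?thesis
  proof (rule tendstoI)
    fix e :: real assume "e > 0"
    obtain d where d: "d > 0" "\<And>y. dist y x < d \<Longrightarrow> dist (?DD y) (?DD x) < e"
      using cont \<open>e > 0\<close> unfolding continuous_on_iff by (metis UNIV_I)
    define N where "N = norm u + norm v + 1"
    have N: "N > 0" unfolding N_def by (simp add: add_nonneg_pos)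
    have "dist (?Q s) (?DD x) < e" if s: "0 < s" "s < d / N" for s
    proof -
      obtain r q where r: "0 < r" "r < s" "0 < q" "q < s" "?Q s = ?DD (x + r *\<^sub>R u + q *\<^sub>R v)"
        using mvt s by blast
      have "dist (x + r *\<^sub>R u + q *\<^sub>R v) x \<le> r * norm u + q * norm v"
        using norm_triangle_ineq[of "r *\<^sub>R u" "q *\<^sub>R v"] r by (simp add: dist_norm algebra_simps)
      also have "\<dots> \<le> s * norm u + s * norm v"
        using r by (intro add_mono mult_right_mono) auto
      also have "\<dots> < s * N" using s by (simp add: N_def algebra_simps)
      also have "\<dots> < d" using s N by (simp add: field_simps)
      finally show ?thesis using d r by metis
    qed
    moreover have "0 < d / N" using d N by simp
    ultimately show "\<forall>\<^sub>F s in at_right 0. dist (?Q s) (?DD x) < e"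
      unfolding eventually_at_right_field by blast
  qed
qed

lemma symmetric_second_derivative:
  fixes f :: "'a::real_normed_vector \<Rightarrow> real"
  assumes "Ck_on 2 UNIV f"
  shows "frechet_derivative (\<lambda>y. frechet_derivative f (at y) u) (at x) v =
    frechet_derivative (\<lambda>y. frechet_derivative f (at y) v) (at x) u"
proof -
  have eq: "(f (x + s *\<^sub>R u + s *\<^sub>R v) - f (x + s *\<^sub>R u) - f (x + s *\<^sub>R v) + f x) / s\<^sup>2 =
     (f (x + s *\<^sub>R v + s *\<^sub>R u) - f (x + s *\<^sub>R v) - f (x + s *\<^sub>R u) + f x) / s\<^sup>2" for s
    by (simp add: add.assoc add.commute[of "s *\<^sub>R u"])
  show ?thesis
    using second_derivative_limit[OF assms, of x u v] second_derivative_limit[OF assms, of x v u]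
    unfolding eq by (rule tendsto_unique[rotated]) simp
qed

section \<open>A smooth implicit function theorem\<close>

text \<open>By Cramer's rule the solution is a quotient of determinants, hence as smooth as the coefficients and the
  right-hand side.\<close>
lemma Ck_on_linear_solution:
  fixes A :: "'x::real_normed_vector \<Rightarrow> real^'k \<Rightarrow> real^'k" and w c :: "'x \<Rightarrow> real^'k"
  assumes "open S"
    and lin: "\<And>x. x \<in> S \<Longrightarrow> linear (A x)" and inj: "\<And>x. x \<in> S \<Longrightarrow> inj (A x)"
    and eq: "\<And>x. x \<in> S \<Longrightarrow> A x (w x) = c x"
    and A: "\<And>u. Ck_on n S (\<lambda>x. A x u)" and c: "Ck_on n S c"
  shows "Ck_on n S w"
proof (rule Ck_on_vec_lambda[OF assms(1)])
  fix k
  let ?N = "\<lambda>x. (\<chi> i j. if j = k then c x $ i else A x (axis j 1) $ i)"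
  have entry: "matrix (A x) $ i $ j = A x (axis j 1) $ i" for x i j
    by (simp add: matrix_def)
  have det0: "det (matrix (A x)) \<noteq> 0" if "x \<in> S" for x
    using that lin inj by (simp add: det_nz_iff_inj)
  have "Ck_on n S (\<lambda>x. det (?N x) * inverse (det (matrix (A x))))"
  proof (intro Ck_on_mult Ck_on_det Ck_on_inverse assms(1) det0)
    show "Ck_on n S (\<lambda>x. matrix (A x) $ i $ j)" for i j
      unfolding entry by (intro Ck_on_vec_nth assms(1) A)
    show "Ck_on n S (\<lambda>x. ?N x $ i $ j)" for i j
      by (cases "j = k") (auto intro: Ck_on_vec_nth assms(1) A c)
  qed
  moreover have "det (?N x) * inverse (det (matrix (A x))) = w x $ k" if "x \<in> S" for x
  proof -
    have "matrix (A x) *v w x = c x"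
      using eq[OF that] lin[OF that] by (simp add: matrix_works linear_matrix_vector_mul_eq)
    from this[unfolded cramer[OF det0[OF that]]] show ?thesis
      unfolding entry by (simp add: divide_inverse)
  qed
  ultimately show "Ck_on n S (\<lambda>x. w x $ k)"
    by (rule Ck_on_cong[OF assms(1)])
qed

text \<open>The inverse function theorem for \<open>(x, l) \<mapsto> (x, G(x, l))\<close>, whose derivative is injective because
  \<open>G\<close> has an injective partial derivative in \<open>l\<close>.\<close>
lemma implicit_function_has_derivative:
  fixes G :: "'x::euclidean_space \<times> (real^'k) \<Rightarrow> real^'k"
  assumes "smooth_on UNIV G" "G (x0, l0) = 0"
    and nondeg: "\<And>w. frechet_derivative G (at (x0, l0)) (0, w) = 0 \<Longrightarrow> w = 0"
  obtains U W \<Lambda> \<Lambda>' where "open U" "x0 \<in> U" "open W" "l0 \<in> W"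
    "\<And>x l. x \<in> U \<Longrightarrow> l \<in> W \<Longrightarrow> G (x, l) = 0 \<longleftrightarrow> l = \<Lambda> x" "\<And>x. x \<in> U \<Longrightarrow> \<Lambda> x \<in> W"
    "\<And>x. x \<in> U \<Longrightarrow> (\<Lambda> has_derivative \<Lambda>' x) (at x)"
    "\<And>x. x \<in> U \<Longrightarrow> inj (\<lambda>w. frechet_derivative G (at (x, \<Lambda> x)) (0, w))"
proof -
  let ?G' = "\<lambda>z. frechet_derivative G (at z)"
  have G': "(G has_derivative ?G' z) (at z)" for z
    using assms(1) by (rule smooth_on_has_derivative) simp
  define F where "F z = (fst z, G z)" for z
  define F' where "F' z = Blinfun (\<lambda>v. (fst v, ?G' z v))" for z
  have F'_apply: "blinfun_apply (F' z) = (\<lambda>v. (fst v, ?G' z v))" for z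
    unfolding F'_def
    by (intro bounded_linear_Blinfun_apply bounded_linear_Pair bounded_linear_fst
        has_derivative_bounded_linear[OF G'])
  have F': "(F has_derivative blinfun_apply (F' z)) (at z)" for z
    unfolding F'_apply F_def
    by (intro has_derivative_Pair has_derivative_fst has_derivative_ident G')
  have cont: "continuous_on UNIV F'"
    by (intro continuous_on_blinfun_componentwise, unfold F'_apply)
      (intro continuous_on_Pair continuous_on_const
        smooth_on_continuous_on[OF smooth_on_frechet_derivative[OF assms(1)]])
  have "inj (blinfun_apply (F' (x0, l0)))"
  proof (rule linear_injective_0[THEN iffD2, rule_format])
    show "linear (blinfun_apply (F' (x0, l0)))"
      by (rule has_derivative_linear[OF F'])
    show "v = 0" if "blinfun_apply (F' (x0, l0)) v = 0" for v
      using that nondeg[of "snd v"] by (cases v) (auto simp: F'_apply zero_prod_def)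
  qed
  then obtain g0 where g0: "linear g0" "\<forall>x. g0 (blinfun_apply (F' (x0, l0)) x) = x"
    using linear_injective_isomorphism[OF has_derivative_linear[OF F']] by blast
  have inv: "Blinfun g0 o\<^sub>L F' (x0, l0) = id_blinfun"
    using g0 by (intro blinfun_eqI) (simp add: bounded_linear_Blinfun_apply linear_conv_bounded_linear
        del: split_paired_All)
  obtain U' V g g' where U': "open U'" "(x0, l0) \<in> U'" and V: "open V" "F (x0, l0) \<in> V"
    and hom: "homeomorphism U' V F g"
    and g': "\<And>y. y \<in> V \<Longrightarrow> (g has_derivative (g' y)) (at y)"
    and bij: "\<And>y. y \<in> V \<Longrightarrow> bij (blinfun_apply (F' (g y)))"
  proof (rule inverse_function_theorem[of UNIV F F' "(x0, l0)" "Blinfun g0"])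
    show "(F has_derivative blinfun_apply (F' z)) (at z)" for z
      by (rule F')
    fix U' V g g'
    assume A: "open U'" "(x0, l0) \<in> U'" "open V" "F (x0, l0) \<in> V" "homeomorphism U' V F g"
      "\<And>y. y \<in> V \<Longrightarrow> (g has_derivative (g' y)) (at y)"
      "\<And>y. y \<in> V \<Longrightarrow> bij (blinfun_apply (F' (g y)))"
    show thesis by (rule that[OF A])
  qed (use cont inv in simp_all)
  obtain A W where AW: "open A" "open W" "x0 \<in> A" "l0 \<in> W" "A \<times> W \<subseteq> U'"
    using open_prod_elim[OF U'] by (metis mem_Sigma_iff)
  have gF: "g (F z) = z" if "z \<in> U'" for z
    using hom that by (auto simp: homeomorphism_def)
  have Fg: "F (g y) = y" if "y \<in> V" for y
    using hom that by (auto simp: homeomorphism_def)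
  \<comment> \<open>On this set the inverse map stays in the box \<open>A \<times> W\<close>, so that solutions with \<open>l \<in> W\<close> are unique.\<close>
  define U where "U = (\<lambda>x. (x, 0)) -` (V \<inter> g -` (A \<times> W))"
  define \<Lambda> where "\<Lambda> x = snd (g (x, 0))" for x
  have "continuous_on V g" using hom by (simp add: homeomorphism_def)
  then have "open (V \<inter> g -` (A \<times> W))"
    using V AW by (simp add: continuous_open_preimage open_Times)
  moreover have "continuous_on UNIV (\<lambda>x::'x. (x, 0::real^'k))"
    by (intro continuous_intros)
  ultimately have "open U"
    unfolding U_def using open_vimage by blast
  have "x0 \<in> U"
    using V AW gF[OF U'(2)] assms(2) by (auto simp: U_def F_def)
  have g_eq: "g (x, 0) = (x, \<Lambda> x)" "G (x, \<Lambda> x) = 0" if "x \<in> U" for x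
    using Fg[of "(x, 0)"] that by (auto simp: U_def F_def \<Lambda>_def prod_eq_iff)
  show thesis
  proof (rule that[OF \<open>open U\<close> \<open>x0 \<in> U\<close> AW(2,4)])
    show \<Lambda>W: "\<Lambda> x \<in> W" if "x \<in> U" for x
      using that g_eq[OF that] by (auto simp: U_def)
    show "G (x, l) = 0 \<longleftrightarrow> l = \<Lambda> x" if "x \<in> U" "l \<in> W" for x l
    proof
      assume "G (x, l) = 0"
      then have F: "F (x, l) = F (x, \<Lambda> x)" using g_eq that by (simp add: F_def)
      have "x \<in> A" using g_eq[OF that(1)] that by (auto simp: U_def)
      then have "(x, l) \<in> U'" "(x, \<Lambda> x) \<in> U'"
        using AW(5) that(2) \<Lambda>W[OF that(1)] by blast+
      then have "(x, l) = (x, \<Lambda> x)"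
        using gF F by metis
      then show "l = \<Lambda> x" by simp
    qed (use g_eq that in simp)
    show "(\<Lambda> has_derivative (\<lambda>v. snd (g' (x, 0) (v, 0)))) (at x)" if "x \<in> U" for x
      unfolding \<Lambda>_def using that
      by (intro has_derivative_snd has_derivative_compose[OF has_derivative_Pair[OF has_derivative_ident has_derivative_const] g'])
        (auto simp: U_def)
    show "inj (\<lambda>w. ?G' (x, \<Lambda> x) (0, w))" if "x \<in> U" for x
    proof -
      have "inj (blinfun_apply (F' (g (x, 0))))"
        using bij that by (auto simp: U_def bij_def)
      then show ?thesis unfolding g_eq[OF that] F'_apply by (auto simp: inj_def)
    qed
  qed
qed

text \<open>The derivative of \<open>\<Lambda>\<close> solves the linear system obtained by differentiating \<open>G(x, \<Lambda>(x)) = 0\<close>. Its coefficients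
  are as smooth as \<open>\<Lambda>\<close> itself, so that each order of smoothness of \<open>\<Lambda>\<close> implies the next one.\<close>
lemma smooth_implicit_function:
  fixes G :: "'x::euclidean_space \<times> (real^'k) \<Rightarrow> real^'k"
  assumes "smooth_on UNIV G" "G (x0, l0) = 0"
    and "\<And>w. frechet_derivative G (at (x0, l0)) (0, w) = 0 \<Longrightarrow> w = 0"
  obtains U W \<Lambda> where "open U" "x0 \<in> U" "open W" "l0 \<in> W" "smooth_on U \<Lambda>"
    "\<And>x l. x \<in> U \<Longrightarrow> l \<in> W \<Longrightarrow> G (x, l) = 0 \<longleftrightarrow> l = \<Lambda> x" "\<And>x. x \<in> U \<Longrightarrow> \<Lambda> x \<in> W"
proof -
  let ?G' = "\<lambda>z. frechet_derivative G (at z)"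
  have G': "(G has_derivative ?G' z) (at z)" for z
    using assms(1) by (rule smooth_on_has_derivative) simp
  obtain U W \<Lambda> \<Lambda>' where U: "open U" "x0 \<in> U" and W: "open W" "l0 \<in> W"
    and \<Lambda>: "\<And>x l. x \<in> U \<Longrightarrow> l \<in> W \<Longrightarrow> G (x, l) = 0 \<longleftrightarrow> l = \<Lambda> x" "\<And>x. x \<in> U \<Longrightarrow> \<Lambda> x \<in> W"
    and \<Lambda>': "\<And>x. x \<in> U \<Longrightarrow> (\<Lambda> has_derivative \<Lambda>' x) (at x)"
    and inj: "\<And>x. x \<in> U \<Longrightarrow> inj (\<lambda>w. ?G' (x, \<Lambda> x) (0, w))"
    using implicit_function_has_derivative[OF assms] by blast
  have eq: "?G' (x, \<Lambda> x) (0, \<Lambda>' x v) = - ?G' (x, \<Lambda> x) (v, 0)" if "x \<in> U" for x v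
  proof -
    have graph: "((\<lambda>x. (x, \<Lambda> x)) has_derivative (\<lambda>v. (v, \<Lambda>' x v))) (at x)"
      by (rule has_derivative_Pair[OF has_derivative_ident \<Lambda>'[OF that]])
    have "(G has_derivative ?G' (x, \<Lambda> x)) (at (x, \<Lambda> x))"
      by (rule G')
    then have "((\<lambda>x. G (x, \<Lambda> x)) has_derivative (\<lambda>v. ?G' (x, \<Lambda> x) (v, \<Lambda>' x v))) (at x)"
      by (rule has_derivative_compose[OF graph])
    moreover have "((\<lambda>x. 0 :: real^'k) has_derivative (\<lambda>v. 0)) (at x)"
      by simp
    then have "((\<lambda>x. G (x, \<Lambda> x)) has_derivative (\<lambda>v. 0)) (at x)"
      using U(1) that by (rule has_derivative_transform_within_open) (simp add: \<Lambda>)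
    ultimately have D0: "(\<lambda>v. ?G' (x, \<Lambda> x) (v, \<Lambda>' x v)) = (\<lambda>v. 0)"
      by (rule has_derivative_unique)
    have "linear (?G' (x, \<Lambda> x))"
      using G'[of "(x, \<Lambda> x)"] by (rule has_derivative_linear)
    from linear_add[OF this, of "(v, 0)" "(0, \<Lambda>' x v)"] fun_cong[OF D0, of v]
    show ?thesis by (simp add: add_eq_0_iff)
  qed
  have "Ck_on n U \<Lambda>" for n
  proof (induction n)
    case 0
    have "isCont \<Lambda> x" if "x \<in> U" for x
      using \<Lambda>'[OF that] by (rule has_derivative_continuous)
    then show ?case by (simp add: continuous_at_imp_continuous_on)
  next
    case (Suc n)
    have entries: "Ck_on n U (\<lambda>x. ?G' (x, \<Lambda> x) u)" for u
    proof (rule Ck_on_compose[where f = "\<lambda>x. (x, \<Lambda> x)" and g = "\<lambda>z. ?G' z u", OF U(1) open_UNIV])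
      show "Ck_on n U (\<lambda>x. (x, \<Lambda> x))"
        by (intro Ck_on_Pair Ck_on_ident U Suc)
      show "Ck_on n UNIV (\<lambda>z. ?G' z u)"
        using smooth_on_frechet_derivative[OF assms(1)] by (simp add: smooth_on_def)
    qed simp
    show ?case
    proof (rule Ck_on_SucI[OF U(1)])
      show "(\<Lambda> has_derivative \<Lambda>' x) (at x)" if "x \<in> U" for x
        using that by (rule \<Lambda>')
      show "Ck_on n U (\<lambda>x. \<Lambda>' x v)" for v
      proof (rule Ck_on_linear_solution[where A = "\<lambda>x w. ?G' (x, \<Lambda> x) (0, w)", OF U(1)])
        show "linear (\<lambda>w. ?G' (x, \<Lambda> x) (0, w))" for x
        proof -
          have "linear (?G' (x, \<Lambda> x))"
            using G'[of "(x, \<Lambda> x)"] by (rule has_derivative_linear)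
          moreover have "linear (\<lambda>w. (0::'x, w::real^'k))"
            by (intro bounded_linear.linear bounded_linear_Pair bounded_linear_zero bounded_linear_ident)
          ultimately show ?thesis using linear_compose by (fastforce simp: o_def)
        qed
        show "Ck_on n U (\<lambda>x. - ?G' (x, \<Lambda> x) (v, 0))"
          by (intro Ck_on_minus U entries)
        show "?G' (x, \<Lambda> x) (0, \<Lambda>' x v) = - ?G' (x, \<Lambda> x) (v, 0)" if "x \<in> U" for x
          by (rule eq[OF that])
        show "inj (\<lambda>w. ?G' (x, \<Lambda> x) (0, w))" if "x \<in> U" for x
          by (rule inj[OF that])
        show "Ck_on n U (\<lambda>x. ?G' (x, \<Lambda> x) (0, u))" for u
          by (rule entries)
      qed
    qed
  qed
  then show thesis
    using that[OF U W _ \<Lambda>] by (simp add: smooth_on_def)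
qed

section \<open>Runge--Kutta steps of ordinary differential equations\<close>

lemma has_derivative_norm_le_of_lipschitz:
  fixes f :: "'a::real_normed_vector \<Rightarrow> 'b::real_normed_vector"
  assumes f': "(f has_derivative f') (at x)" and S: "open S" "x \<in> S"
    and B: "\<And>y. y \<in> S \<Longrightarrow> norm (f y - f x) \<le> B * norm (y - x)"
  shows "norm (f' v) \<le> B * norm v"
proof (cases "v = 0")
  case True
  then show ?thesis using linear_0[OF has_derivative_linear[OF f']] by simp
next
  case False
  have "norm (f' v) \<le> B * norm v + e" if "e > 0" for e
  proof -
    define e' where "e' = e / norm v"
    have e': "e' > 0" using that False by (simp add: e'_def)
    obtain d where d: "d > 0" "\<And>y. norm (y - x) < d \<Longrightarrow> norm (f y - f x - f' (y - x)) \<le> e' * norm (y - x)"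
      using f' e' unfolding has_derivative_at_alt by blast
    obtain r where r: "r > 0" "ball x r \<subseteq> S" using S by (meson openE)
    define s where "s = min d r / (2 * norm v)"
    have s: "s > 0" using d r False by (simp add: s_def)
    have "norm (s *\<^sub>R v) = min d r / 2" using d(1) r(1) False by (simp add: s_def)
    then have sv: "norm (s *\<^sub>R v) < d" "norm (s *\<^sub>R v) < r" using d(1) r(1) by linarith+
    have "x + s *\<^sub>R v \<in> S" using r(2) sv(2) by (auto simp: dist_norm)
    from B[OF this] d(2)[of "x + s *\<^sub>R v"] sv
    have "norm (f' (s *\<^sub>R v)) \<le> B * norm (s *\<^sub>R v) + e' * norm (s *\<^sub>R v)"
      using norm_triangle_ineq4[of "f (x + s *\<^sub>R v) - f x" "f (x + s *\<^sub>R v) - f x - f' (s *\<^sub>R v)"]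
      by simp
    then have "s * norm (f' v) \<le> s * (B * norm v + e' * norm v)"
      using s by (simp add: linear_scale[OF has_derivative_linear[OF f']] algebra_simps)
    then have "norm (f' v) \<le> B * norm v + e' * norm v" using s by simp
    then show ?thesis using False by (simp add: e'_def)
  qed
  then show ?thesis by (rule field_le_epsilon)
qed

lemma smooth_locally_lipschitz:
  fixes f :: "'a::euclidean_space \<Rightarrow> 'b::real_normed_vector"
  assumes "smooth_on U f" "open U" "x \<in> U"
  obtains r L where "r > 0" "L > 0" "cball x r \<subseteq> U" "\<And>y. y \<in> cball x r \<Longrightarrow> norm (f y) \<le> L"
    "\<And>y y'. y \<in> cball x r \<Longrightarrow> y' \<in> cball x r \<Longrightarrow> norm (f y - f y') \<le> L * norm (y - y')"
proof -
  let ?f' = "\<lambda>y. frechet_derivative f (at y)"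
  obtain r where r: "r > 0" "cball x r \<subseteq> U"
    using assms open_contains_cball by blast
  have "bounded (f ` cball x r)"
    by (intro compact_imp_bounded compact_continuous_image smooth_on_continuous_on
        smooth_on_subset[OF assms(1) r(2)]) simp
  then obtain M where M: "M > 0" "\<And>y. y \<in> cball x r \<Longrightarrow> norm (f y) \<le> M"
    unfolding bounded_pos by auto
  have "\<exists>B. \<forall>y\<in>cball x r. norm (?f' y b) \<le> B" for b
  proof -
    have "bounded ((\<lambda>y. ?f' y b) ` cball x r)"
      by (intro compact_imp_bounded compact_continuous_image smooth_on_continuous_on
          smooth_on_subset[OF smooth_on_frechet_derivative[OF assms(1)] r(2)]) simp
    then show ?thesis unfolding bounded_iff by auto
  qed
  then obtain B where B: "\<And>b y. y \<in> cball x r \<Longrightarrow> norm (?f' y b) \<le> B b" by metis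
  define L where "L = M + (\<Sum>b\<in>Basis. \<bar>B b\<bar>)"
  have L: "L \<ge> M" "L \<ge> (\<Sum>b\<in>Basis. \<bar>B b\<bar>)" unfolding L_def using M(1) by (simp_all add: sum_nonneg)
  have f': "(f has_derivative ?f' y) (at y)" if "y \<in> cball x r" for y
    using that r assms by (intro smooth_on_has_derivative) auto
  have "onorm (?f' y) \<le> L" if y: "y \<in> cball x r" for y
  proof (rule onorm_le)
    fix v
    have "?f' y v = (\<Sum>b\<in>Basis. (v \<bullet> b) *\<^sub>R ?f' y b)"
      by (rule linear_eq_sum_Basis[OF has_derivative_linear[OF f'[OF y]]])
    also have "norm \<dots> \<le> (\<Sum>b\<in>Basis. norm v * \<bar>B b\<bar>)"
    proof (rule sum_norm_le)
      fix b :: 'a assume "b \<in> Basis"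
      then have "\<bar>v \<bullet> b\<bar> \<le> norm v" by (rule Basis_le_norm)
      moreover have "norm (?f' y b) \<le> \<bar>B b\<bar>" using B[OF y, of b] by linarith
      ultimately show "norm ((v \<bullet> b) *\<^sub>R ?f' y b) \<le> norm v * \<bar>B b\<bar>"
        by (simp add: mult_mono)
    qed
    also have "\<dots> = norm v * (\<Sum>b\<in>Basis. \<bar>B b\<bar>)" by (simp add: sum_distrib_left)
    also have "\<dots> \<le> L * norm v" using L(2) by (subst mult.commute) (simp add: mult_right_mono)
    finally show "norm (?f' y v) \<le> L * norm v" .
  qed
  then have "norm (f y - f y') \<le> L * norm (y - y')" if "y \<in> cball x r" "y' \<in> cball x r" for y y'
    using that f' by (intro differentiable_bound[of "cball x r" f ?f'])
      (auto intro: has_derivative_at_withinI)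
  then show thesis
    using that[of r L] r M L by (meson less_le_trans order_trans)
qed

text \<open>Existence, uniqueness and the Lipschitz bound come from the contraction \<open>x \<mapsto> w + \<Psi> x\<close>. For
  differentiability, \<open>\<sigma>\<close> is a continuous right inverse of \<open>x \<mapsto> x - \<Psi> x\<close>, whose derivative is invertible as \<open>\<Psi>'\<close>
  has norm at most \<open>1/2\<close>. This argument needs right-hand sides \<open>w\<close> that fill an open set.\<close>
lemma perturbed_identity_solution:
  fixes \<Psi> :: "'e::euclidean_space \<Rightarrow> 'e"
  assumes S: "closed S" "S \<noteq> {}"
    and contraction: "\<forall>x\<in>S. \<forall>y\<in>S. norm (\<Psi> x - \<Psi> y) \<le> 1/2 * norm (x - y)"
    and self_map: "\<forall>w\<in>W. \<forall>x\<in>S. w + \<Psi> x \<in> S"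
  shows "\<exists>\<sigma>. \<forall>w\<in>W. \<sigma> w \<in> S \<and> \<sigma> w = w + \<Psi> (\<sigma> w) \<and> (\<forall>x\<in>S. x = w + \<Psi> x \<longrightarrow> x = \<sigma> w) \<and>
    (\<forall>w'\<in>W. norm (\<sigma> w - \<sigma> w') \<le> 2 * norm (w - w')) \<and>
    (open W \<longrightarrow> \<sigma> w \<in> interior S \<longrightarrow> \<Psi> differentiable (at (\<sigma> w)) \<longrightarrow> \<sigma> differentiable (at w))"
proof -
  note lip = bspec[OF bspec[OF contraction]] and maps = bspec[OF bspec[OF self_map]]
  have "\<exists>!x\<in>S. w + \<Psi> x = x" if "w \<in> W" for w
  proof (rule Banach_fix[where c = "1/2"])
    show "complete S" using S(1) by (simp add: complete_eq_closed)
    show "dist (w + \<Psi> x) (w + \<Psi> y) \<le> 1/2 * dist x y" if "x \<in> S" "y \<in> S" for x y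
      using lip[OF that] by (simp add: dist_norm)
  qed (use S(2) maps that in auto)
  then obtain \<sigma> where \<sigma>: "\<And>w. w \<in> W \<Longrightarrow> \<sigma> w \<in> S" "\<And>w. w \<in> W \<Longrightarrow> \<sigma> w = w + \<Psi> (\<sigma> w)"
    and uniq: "\<And>w x. w \<in> W \<Longrightarrow> x \<in> S \<Longrightarrow> x = w + \<Psi> x \<Longrightarrow> x = \<sigma> w"
    by metis
  have \<sigma>_lip: "norm (\<sigma> w - \<sigma> w') \<le> 2 * norm (w - w')" if "w \<in> W" "w' \<in> W" for w w'
  proof -
    have "\<sigma> w - \<sigma> w' = (w - w') + (\<Psi> (\<sigma> w) - \<Psi> (\<sigma> w'))"
      using \<sigma>(2)[OF that(1)] \<sigma>(2)[OF that(2)] by (metis add_diff_add)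
    then have "norm (\<sigma> w - \<sigma> w') \<le> norm (w - w') + norm (\<Psi> (\<sigma> w) - \<Psi> (\<sigma> w'))"
      by (metis norm_triangle_ineq)
    with lip[OF \<sigma>(1)[OF that(1)] \<sigma>(1)[OF that(2)]] show ?thesis by simp
  qed
  have "\<sigma> differentiable (at w)"
    if W: "open W" "w \<in> W" and int: "\<sigma> w \<in> interior S" and dif: "\<Psi> differentiable (at (\<sigma> w))" for w
  proof -
    obtain \<Psi>' where \<Psi>': "(\<Psi> has_derivative \<Psi>') (at (\<sigma> w))"
      using dif unfolding differentiable_def by blast
    have contr: "norm (\<Psi>' v) \<le> 1/2 * norm v" for v
      using int interior_subset lip \<sigma>(1)[OF W(2)]
      by (intro has_derivative_norm_le_of_lipschitz[OF \<Psi>' open_interior[of S]]) auto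
    let ?f' = "\<lambda>v. v - \<Psi>' v"
    have f': "((\<lambda>x. x - \<Psi> x) has_derivative ?f') (at (\<sigma> w))"
      by (intro has_derivative_diff has_derivative_ident \<Psi>')
    have "inj ?f'"
    proof (rule linear_injective_0[THEN iffD2, rule_format])
      show "linear ?f'" by (rule has_derivative_linear[OF f'])
      show "v = 0" if "v - \<Psi>' v = 0" for v
        using contr[of v] that by simp
    qed
    then obtain g' where g': "linear g'" "\<forall>x. g' (?f' x) = x"
      using linear_injective_isomorphism[OF has_derivative_linear[OF f']] by blast
    have "continuous_on W \<sigma>"
      unfolding continuous_on_iff
    proof (intro ballI allI impI)
      fix x e :: real and w assume "w \<in> W" "0 < e"
      then show "\<exists>d>0. \<forall>w'\<in>W. dist w' w < d \<longrightarrow> dist (\<sigma> w') (\<sigma> w) < e"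
        using \<sigma>_lip by (intro exI[of _ "e / 2"]) (force simp: dist_norm)
    qed
    then have "continuous (at w) \<sigma>"
      using W continuous_on_eq_continuous_at by blast
    moreover have "g' \<circ> ?f' = id" using g'(2) by (simp add: fun_eq_iff)
    moreover have "\<sigma> z - \<Psi> (\<sigma> z) = z" if "z \<in> W" for z
      using \<sigma>(2)[OF that] by (metis add_diff_cancel_right')
    ultimately have "(\<sigma> has_derivative g') (at w)"
      using W g'(1) f'
      by (intro has_derivative_inverse_basic[where f = "\<lambda>x. x - \<Psi> x" and f' = ?f' and g = \<sigma> and T = W])
        (simp_all add: linear_conv_bounded_linear)
    then show ?thesis by (rule differentiableI)
  qed
  with \<sigma> uniq \<sigma>_lip show ?thesis
    by (intro exI[of _ \<sigma>] ballI conjI impI) blast+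
qed

definition stage_equations ::
  "(real \<times> 'a \<Rightarrow> 'a::real_vector) \<Rightarrow> ('s::finite \<Rightarrow> 's \<Rightarrow> real) \<Rightarrow> real \<Rightarrow> real \<Rightarrow> 'a \<Rightarrow> ('s \<Rightarrow> 'a) \<Rightarrow> bool" where
  "stage_equations f a t h y0 Y \<longleftrightarrow>
     (\<forall>i. Y i = y0 + h *\<^sub>R (\<Sum>j\<in>UNIV. a i j *\<^sub>R f (t + abscissa a j * h, Y j)))"

definition rk_update ::
  "(real \<times> 'a \<Rightarrow> 'a::real_vector) \<Rightarrow> ('s::finite \<Rightarrow> 's \<Rightarrow> real) \<Rightarrow> ('s \<Rightarrow> real) \<Rightarrow> real \<Rightarrow> real \<Rightarrow> 'a \<Rightarrow> ('s \<Rightarrow> 'a) \<Rightarrow> 'a" where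
  "rk_update f a b t h y0 Y = y0 + h *\<^sub>R (\<Sum>j\<in>UNIV. b j *\<^sub>R f (t + abscissa a j * h, Y j))"

lemma ode_rk_step_iff:
  "ode_rk_step f a b t h y0 Y y1 \<longleftrightarrow> stage_equations f a t h y0 Y \<and> y1 = rk_update f a b t h y0 Y"
  by (simp add: ode_rk_step_def stage_equations_def rk_update_def)

lemma norm_weighted_sum_le:
  fixes x :: "'s::finite \<Rightarrow> 'a::real_normed_vector"
  assumes "\<And>j. norm (x j) \<le> B"
  shows "norm (\<Sum>j\<in>UNIV. c j *\<^sub>R x j) \<le> (\<Sum>j\<in>UNIV. \<bar>c j\<bar>) * B"
  unfolding sum_distrib_right using assms
  by (intro sum_norm_le) (simp add: mult_left_mono)

lemma norm_le_sum_norm_nth: "norm Y \<le> (\<Sum>i\<in>UNIV. norm (Y $ i))"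
  unfolding norm_vec_def by (rule L2_set_le_sum) simp

text \<open>Uniqueness refers to the full ball, while initial values come from the ball of half the radius: the stages may
  move away from the initial value.\<close>
definition solves_stages where
  "solves_stages f a t h yc R (S :: 'y::real_normed_vector \<Rightarrow> 's::finite \<Rightarrow> 'y) \<longleftrightarrow>
     (\<forall>y\<in>ball yc (R/2). stage_equations f a t h y (S y) \<and> (\<forall>i. S y i \<in> ball yc R) \<and>
        (\<forall>Y. stage_equations f a t h y Y \<longrightarrow> (\<forall>i. Y i \<in> cball yc R) \<longrightarrow> Y = S y) \<and>
        (\<forall>y'\<in>ball yc (R/2). \<forall>i. norm (S y i - S y' i) \<le> 2 * real CARD('s) * norm (y - y')) \<and>
        (\<forall>i. (\<lambda>y. S y i) differentiable (at y)))"

text \<open>The stage equations are a perturbed identity on the product space \<open>'y^'s\<close>, with the constant vector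
  \<open>(y, \<dots>, y)\<close> as right-hand side. The two bounds on \<open>h\<close> make the perturbation a contraction and keep the
  stages in the ball on which \<open>f\<close> is controlled.\<close>
lemma stage_solution_map:
  fixes f :: "real \<times> 'y::euclidean_space \<Rightarrow> 'y" and a :: "'s::finite \<Rightarrow> 's \<Rightarrow> real" and t h :: real
  defines "F \<equiv> \<lambda>j y. f (t + abscissa a j * h, y)"
  assumes R: "R > 0" and L: "L > 0"
    and bound: "\<And>j y. y \<in> cball yc R \<Longrightarrow> norm (F j y) \<le> L"
    and lip: "\<And>j y y'. y \<in> cball yc R \<Longrightarrow> y' \<in> cball yc R \<Longrightarrow> norm (F j y - F j y') \<le> L * norm (y - y')"
    and diff: "\<And>j y. y \<in> ball yc R \<Longrightarrow> F j differentiable (at y)"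
    and A: "A = (\<Sum>i\<in>UNIV. \<Sum>j\<in>UNIV. \<bar>a i j\<bar>)"
    and h: "h > 0" "h * A * L \<le> 1/2" "h * A * L \<le> R/4"
  shows "\<exists>S. solves_stages f a t h yc R S"
proof -
  have stage_eq: "stage_equations f a t h y Y \<longleftrightarrow> (\<forall>i. Y i = y + h *\<^sub>R (\<Sum>j\<in>UNIV. a i j *\<^sub>R F j (Y j)))" for y Y
    by (simp add: stage_equations_def F_def)
  define \<Psi> where "\<Psi> Y = (\<chi> i. h *\<^sub>R (\<Sum>j\<in>UNIV. a i j *\<^sub>R F j (Y $ j)))" for Y :: "'y^'s"
  define K where "K = {Y :: 'y^'s. \<forall>i. Y $ i \<in> cball yc R}"
  define W where "W = {w :: 'y^'s. \<forall>i. w $ i \<in> ball yc (R/2)}"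
  have row: "(\<Sum>j\<in>UNIV. \<bar>a i j\<bar>) \<le> A" for i
    unfolding A by (rule member_le_sum) (auto simp: sum_nonneg)
  have "A \<ge> 0" unfolding A by (simp add: sum_nonneg)
  have clK: "closed K"
    unfolding K_def by (intro closed_vector_box allI closed_cball)
  have opW: "open W"
    unfolding W_def by (intro open_vector_box allI open_ball)
  have "(\<chi> i. yc) \<in> K" using R by (simp add: K_def)
  then have neK: "K \<noteq> {}" by blast
  have \<Psi>_lt: "norm (\<Psi> Y $ i) \<le> R/4" if "Y \<in> K" for Y i
  proof -
    have "norm (\<Psi> Y $ i) = h * norm (\<Sum>j\<in>UNIV. a i j *\<^sub>R F j (Y $ j))"
      using h by (simp add: \<Psi>_def)
    also have "\<dots> \<le> h * ((\<Sum>j\<in>UNIV. \<bar>a i j\<bar>) * L)"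
      using that h bound by (intro mult_left_mono norm_weighted_sum_le) (auto simp: K_def)
    also have "\<dots> \<le> h * (A * L)" using row h L by (intro mult_left_mono mult_right_mono) auto
    finally show ?thesis using h by (simp add: mult.assoc)
  qed
  have in_ball: "(w + \<Psi> Y) $ i \<in> ball yc R" if "w \<in> W" "Y \<in> K" for w Y i
  proof -
    have "norm (w $ i + \<Psi> Y $ i - yc) \<le> norm (w $ i - yc) + norm (\<Psi> Y $ i)"
      by (metis add_diff_eq add.commute norm_triangle_ineq)
    moreover have "norm (w $ i - yc) < R/2" using that by (simp add: W_def dist_norm norm_minus_commute)
    ultimately show ?thesis using \<Psi>_lt[OF that(2), of i] R by (simp add: dist_norm norm_minus_commute)
  qed
  have maps: "\<forall>w\<in>W. \<forall>Y\<in>K. w + \<Psi> Y \<in> K"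
    using in_ball unfolding K_def by (simp add: less_imp_le)
  have \<Psi>_lip: "\<forall>Y\<in>K. \<forall>Y'\<in>K. norm (\<Psi> Y - \<Psi> Y') \<le> 1/2 * norm (Y - Y')"
  proof (intro ballI)
    fix Y Y' assume Y: "Y \<in> K" "Y' \<in> K"
    have "norm ((\<Psi> Y - \<Psi> Y') $ i) \<le> h * ((\<Sum>j\<in>UNIV. \<bar>a i j\<bar>) * (L * norm (Y - Y')))" for i
    proof -
      have "(\<Psi> Y - \<Psi> Y') $ i = h *\<^sub>R (\<Sum>j\<in>UNIV. a i j *\<^sub>R (F j (Y $ j) - F j (Y' $ j)))"
        by (simp add: \<Psi>_def scaleR_right_diff_distrib sum_subtractf)
      moreover have "norm (F j (Y $ j) - F j (Y' $ j)) \<le> L * norm (Y - Y')" for j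
      proof -
        have "norm (F j (Y $ j) - F j (Y' $ j)) \<le> L * norm (Y $ j - Y' $ j)"
          using Y by (intro lip) (auto simp: K_def)
        also have "\<dots> \<le> L * norm (Y - Y')"
          using L Finite_Cartesian_Product.norm_nth_le[of "Y - Y'" j] by simp
        finally show ?thesis .
      qed
      ultimately show ?thesis using h by (simp add: mult_left_mono norm_weighted_sum_le)
    qed
    then have "norm (\<Psi> Y - \<Psi> Y') \<le> (\<Sum>i\<in>UNIV. h * ((\<Sum>j\<in>UNIV. \<bar>a i j\<bar>) * (L * norm (Y - Y'))))"
      by (intro order_trans[OF norm_le_sum_norm_nth] sum_mono)
    also have "\<dots> = h * A * L * norm (Y - Y')"
      unfolding A by (simp add: sum_distrib_left sum_distrib_right mult.assoc)
    also have "\<dots> \<le> 1/2 * norm (Y - Y')" using h by (intro mult_right_mono) auto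
    finally show "norm (\<Psi> Y - \<Psi> Y') \<le> 1/2 * norm (Y - Y')" .
  qed
  have \<Psi>_diff: "\<Psi> differentiable (at Y)" if "\<And>i. Y $ i \<in> ball yc R" for Y
  proof -
    have "(\<lambda>Y :: 'y^'s. F j (Y $ j)) differentiable (at Y)" for j
      using differentiable_compose[of "F j" "\<lambda>Y. Y $ j", OF diff[OF that[of j]]]
        bounded_linear_imp_differentiable[OF bounded_linear_vec_nth[of j]] by blast
    then have rows: "(\<lambda>Y. h *\<^sub>R (\<Sum>j\<in>UNIV. a i j *\<^sub>R F j (Y $ j))) differentiable (at Y)" for i
      by (intro differentiable_scaleR differentiable_const differentiable_sum) auto
    have "(\<lambda>Y. \<Psi> Y \<bullet> b) differentiable (at Y)" if bB: "b \<in> Basis" for b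
    proof -
      obtain i u where b: "b = axis i u" using bB by (auto simp: Basis_vec_def)
      have "(\<lambda>Y. \<Psi> Y \<bullet> b) = (\<lambda>Y. (h *\<^sub>R (\<Sum>j\<in>UNIV. a i j *\<^sub>R F j (Y $ j))) \<bullet> u)"
        unfolding b by (simp only: inner_axis \<Psi>_def vec_lambda_beta)
      then show ?thesis
        using differentiable_inner[OF rows[of i] differentiable_const[of u]] by metis
    qed
    then show ?thesis by (subst differentiable_componentwise_within) blast
  qed
  obtain \<sigma> where sol: "\<forall>w\<in>W. \<sigma> w \<in> K \<and> \<sigma> w = w + \<Psi> (\<sigma> w) \<and> (\<forall>x\<in>K. x = w + \<Psi> x \<longrightarrow> x = \<sigma> w) \<and>
      (\<forall>w'\<in>W. norm (\<sigma> w - \<sigma> w') \<le> 2 * norm (w - w')) \<and>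
      (open W \<longrightarrow> \<sigma> w \<in> interior K \<longrightarrow> \<Psi> differentiable (at (\<sigma> w)) \<longrightarrow> \<sigma> differentiable (at w))"
    using perturbed_identity_solution[of K \<Psi> W, OF clK neK \<Psi>_lip maps] by (elim exE)
  have \<sigma>: "\<sigma> w \<in> K" "\<sigma> w = w + \<Psi> (\<sigma> w)" if "w \<in> W" for w
    using bspec[OF sol that] by blast+
  have \<sigma>_uniq: "x = \<sigma> w" if "w \<in> W" "x \<in> K" "x = w + \<Psi> x" for w x
    using bspec[OF sol that(1)] that(2,3) by blast
  have \<sigma>_lip: "norm (\<sigma> w - \<sigma> w') \<le> 2 * norm (w - w')" if "w \<in> W" "w' \<in> W" for w w'
    using bspec[OF sol that(1)] that(2) by blast
  have \<sigma>_diff: "\<sigma> differentiable (at w)"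
    if "open W" "w \<in> W" "\<sigma> w \<in> interior K" "\<Psi> differentiable (at (\<sigma> w))" for w
    using bspec[OF sol that(2)] that(1,3,4) by blast
  let ?v = "\<lambda>y::'y. (\<chi> i::'s. y)"
  have vW: "?v y \<in> W" if "y \<in> ball yc (R/2)" for y using that by (simp add: W_def)
  have inb: "\<sigma> w $ i \<in> ball yc R" if "w \<in> W" for w i
  proof -
    have eq: "\<sigma> w $ i = (w + \<Psi> (\<sigma> w)) $ i"
      by (rule arg_cong[OF \<sigma>(2)[OF that]])
    show ?thesis unfolding eq by (rule in_ball[OF that \<sigma>(1)[OF that]])
  qed
  have "stage_equations f a t h y (\<lambda>i. \<sigma> (?v y) $ i)" if "y \<in> ball yc (R/2)" for y
    unfolding stage_eq
  proof
    show "\<sigma> (?v y) $ i = y + h *\<^sub>R (\<Sum>j\<in>UNIV. a i j *\<^sub>R F j (\<sigma> (?v y) $ j))" for i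
      using arg_cong[OF \<sigma>(2)[OF vW[OF that]], of "\<lambda>Y. Y $ i"]
      by (simp only: vector_add_component vec_lambda_beta \<Psi>_def)
  qed
  moreover have "\<sigma> (?v y) $ i \<in> ball yc R" if "y \<in> ball yc (R/2)" for y i
    by (rule inb[OF vW[OF that]])
  moreover have "Y = (\<lambda>i. \<sigma> (?v y) $ i)"
    if y: "y \<in> ball yc (R/2)" and eqs: "stage_equations f a t h y Y" and Y: "\<forall>i. Y i \<in> cball yc R" for y Y
  proof -
    have "(\<chi> i. Y i) = ?v y + \<Psi> (\<chi> i. Y i)"
      unfolding vec_eq_iff \<Psi>_def vector_add_component vec_lambda_beta using eqs unfolding stage_eq .
    moreover have "(\<chi> i. Y i) \<in> K" using Y by (simp add: K_def)
    ultimately have "(\<chi> i. Y i) = \<sigma> (?v y)" using \<sigma>_uniq[OF vW[OF y]] by simp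
    then have "Y i = \<sigma> (?v y) $ i" for i by (metis vec_lambda_beta)
    then show ?thesis by (rule ext)
  qed
  moreover have "norm (\<sigma> (?v y) $ i - \<sigma> (?v y') $ i) \<le> 2 * real CARD('s) * norm (y - y')"
    if "y \<in> ball yc (R/2)" "y' \<in> ball yc (R/2)" for y y' i
  proof -
    have "norm (\<sigma> (?v y) $ i - \<sigma> (?v y') $ i) \<le> norm (\<sigma> (?v y) - \<sigma> (?v y'))"
      using Finite_Cartesian_Product.norm_nth_le[of "\<sigma> (?v y) - \<sigma> (?v y')" i] by simp
    also have "\<dots> \<le> 2 * norm (?v y - ?v y')"
      by (rule \<sigma>_lip[OF vW[OF that(1)] vW[OF that(2)]])
    also have "norm (?v y - ?v y') \<le> (\<Sum>i\<in>(UNIV::'s set). norm (y - y'))"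
      by (rule order_trans[OF norm_le_sum_norm_nth]) simp
    finally show ?thesis by simp
  qed
  moreover have "(\<lambda>y. \<sigma> (?v y) $ i) differentiable (at y)" if "y \<in> ball yc (R/2)" for y i
  proof -
    have "{Y :: 'y^'s. \<forall>i. Y $ i \<in> ball yc R} \<subseteq> interior K"
    proof (rule interior_maximal)
      show "open {Y :: 'y^'s. \<forall>i. Y $ i \<in> ball yc R}"
        by (intro open_vector_box allI open_ball)
    qed (auto simp: K_def less_imp_le)
    then have "\<sigma> differentiable (at (?v y))"
      using inb[OF vW[OF that]] by (intro \<sigma>_diff opW vW that \<Psi>_diff) auto
    moreover have "bounded_linear ?v"
    proof -
      have "linear ?v" by (rule linearI) (simp_all add: vec_eq_iff)
      then show ?thesis by (simp add: linear_conv_bounded_linear)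
    qed
    ultimately have "(\<lambda>y. \<sigma> (?v y)) differentiable (at y)"
      using differentiable_compose[of \<sigma> ?v y] bounded_linear_imp_differentiable by blast
    then show ?thesis
      using differentiable_compose[of "\<lambda>Y. Y $ i" "\<lambda>y. \<sigma> (?v y)" y]
        bounded_linear_imp_differentiable[OF bounded_linear_vec_nth] by blast
  qed
  ultimately show ?thesis
    unfolding solves_stages_def by (intro exI[of _ "\<lambda>y i. \<sigma> (?v y) $ i"] ballI conjI allI impI) blast+
qed

text \<open>Three radii occur: for initial values within \<open>\<delta>\<close> of \<open>y0\<close> the stages and the endpoint are within \<open>\<epsilon>\<close>, and the
  stages are the only ones within \<open>\<rho>\<close>. The number \<open>\<rho>\<close> stays fixed when \<open>\<epsilon>\<close> is decreased.\<close>
definition local_stage_map where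
  "local_stage_map f a b t h y0 \<delta> \<epsilon> \<rho> C S \<longleftrightarrow>
     (\<forall>y\<in>ball y0 \<delta>. stage_equations f a t h y (S y) \<and> (\<forall>i. S y i \<in> ball y0 \<epsilon>) \<and>
        rk_update f a b t h y (S y) \<in> ball y0 \<epsilon> \<and>
        (\<forall>Y. stage_equations f a t h y Y \<longrightarrow> (\<forall>i. Y i \<in> ball y0 \<rho>) \<longrightarrow> Y = S y) \<and>
        (\<forall>i. (\<lambda>y. S y i) differentiable (at y)) \<and>
        (\<lambda>y. rk_update f a b t h y (S y)) differentiable (at y) \<and>
        (\<forall>y'\<in>ball y0 \<delta>. norm (rk_update f a b t h y (S y) - rk_update f a b t h y' (S y'))
           \<le> (1 + C * h) * norm (y - y')))"

lemma dist_Pair_le: "dist (x, y) (x', y') \<le> dist x x' + dist y y'"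
  unfolding dist_Pair_Pair by (rule order_trans[OF sqrt_sum_squares_le_sum_abs]) simp

lemma local_stage_map_exists:
  fixes f :: "real \<times> 'y::euclidean_space \<Rightarrow> 'y" and a :: "'s::finite \<Rightarrow> 's \<Rightarrow> real"
  assumes U: "open U" "smooth_on U f" "(t0, y0) \<in> U"
  obtains \<rho> C where "\<rho> > 0" "C > 0" "ball t0 \<rho> \<times> ball y0 \<rho> \<subseteq> U"
    "\<And>\<epsilon>. 0 < \<epsilon> \<Longrightarrow> \<epsilon> \<le> \<rho> \<Longrightarrow> \<exists>\<delta>>0. \<delta> \<le> \<epsilon> \<and>
       (\<forall>t\<in>ball t0 \<delta>. \<forall>h\<in>{0<..<\<delta>}. (\<forall>i. t + abscissa a i * h \<in> ball t0 \<epsilon>) \<and> t + h \<in> ball t0 \<epsilon> \<and>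
          (\<exists>S. local_stage_map f a b t h y0 \<delta> \<epsilon> \<rho> C S))"
proof -
  obtain r L where r: "r > 0" "cball (t0, y0) r \<subseteq> U" and L: "L > 0"
    and bnd: "\<And>z. z \<in> cball (t0, y0) r \<Longrightarrow> norm (f z) \<le> L"
    and lip: "\<And>z z'. z \<in> cball (t0, y0) r \<Longrightarrow> z' \<in> cball (t0, y0) r \<Longrightarrow> norm (f z - f z') \<le> L * norm (z - z')"
    using smooth_locally_lipschitz[OF U(2,1,3)] by metis
  define \<rho> where "\<rho> = r / 2"
  have \<rho>: "\<rho> > 0" using r by (simp add: \<rho>_def)
  have in_r: "(s, y) \<in> cball (t0, y0) r" if "s \<in> ball t0 \<rho>" "y \<in> cball y0 \<rho>" for s y
    using dist_Pair_le[of t0 y0 s y] that by (simp add: \<rho>_def)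
  have sub: "ball t0 \<rho> \<times> ball y0 \<rho> \<subseteq> U"
    using in_r r(2) ball_subset_cball by blast
  define A where "A = (\<Sum>i\<in>UNIV. \<Sum>j\<in>UNIV. \<bar>a i j\<bar>)"
  define B where "B = (\<Sum>j\<in>UNIV. \<bar>b j\<bar>)"
  define D where "D = (\<Sum>j\<in>UNIV. \<bar>abscissa a j\<bar>)"
  define C where "C = B * (L * (2 * real CARD('s))) + 1"
  have nonneg: "A \<ge> 0" "B \<ge> 0" "D \<ge> 0" by (simp_all add: A_def B_def D_def sum_nonneg)
  have C: "C > 0" using nonneg L by (simp add: C_def add_nonneg_pos)
  \<comment> \<open>One number that dominates \<open>A * L\<close>, \<open>B * L\<close> and \<open>1 + D\<close>, so that a single condition on the step size suffices.\<close>
  define N where "N = (1 + (A + B + D)) * (1 + L)"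
  have N: "N \<ge> 1" "N \<ge> A * L" "N \<ge> B * L" "N \<ge> 1 + D"
    using nonneg L by (auto simp: N_def algebra_simps intro: add_increasing add_increasing2)
  have row: "(\<Sum>j\<in>UNIV. \<bar>a i j\<bar>) \<le> A" for i
    unfolding A_def by (rule member_le_sum) (auto simp: sum_nonneg)
  have main: "\<exists>\<delta>>0. \<delta> \<le> \<epsilon> \<and>
       (\<forall>t\<in>ball t0 \<delta>. \<forall>h\<in>{0<..<\<delta>}. (\<forall>i. t + abscissa a i * h \<in> ball t0 \<epsilon>) \<and> t + h \<in> ball t0 \<epsilon> \<and>
          (\<exists>S. local_stage_map f a b t h y0 \<delta> \<epsilon> \<rho> C S))"
    if \<epsilon>: "0 < \<epsilon>" "\<epsilon> \<le> \<rho>" for \<epsilon>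
  proof -
    define \<delta> where "\<delta> = min (1/2) (\<epsilon>/4) / N"
    have \<delta>: "\<delta> > 0" "\<delta> * N \<le> 1/2" "\<delta> * N \<le> \<epsilon>/4"
      using N(1) \<epsilon> by (simp_all add: \<delta>_def)
    have \<delta>\<epsilon>: "\<delta> \<le> \<epsilon>/4"
      using \<delta> N(1) mult_left_mono[of 1 N \<delta>] by linarith
    have "(\<forall>i. t + abscissa a i * h \<in> ball t0 \<epsilon>) \<and> t + h \<in> ball t0 \<epsilon> \<and>
          (\<exists>S. local_stage_map f a b t h y0 \<delta> \<epsilon> \<rho> C S)"
      if t: "t \<in> ball t0 \<delta>" and h: "0 < h" "h < \<delta>" for t h
    proof -
      have hN: "h * x \<le> \<delta> * N" if "x \<le> N" for x
        using h N(1) that by (meson less_imp_le mult_mono order_trans[OF zero_le_one] mult_left_mono mult_right_mono order_trans)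
      have time: "t + abscissa a i * h \<in> ball t0 \<epsilon>" for i
      proof -
        have "\<bar>abscissa a i\<bar> \<le> D" unfolding D_def by (rule member_le_sum) auto
        then have "h * \<bar>abscissa a i\<bar> \<le> \<delta> * N" using N(4) by (intro hN) simp
        then have "\<bar>abscissa a i * h\<bar> \<le> \<epsilon>/4" using \<delta>(3) h by (simp add: abs_mult mult.commute)
        then show ?thesis using t \<delta>\<epsilon> \<epsilon> by (simp add: dist_real_def)
      qed
      let ?\<tau> = "\<lambda>j. t + abscissa a j * h"
      have \<tau>: "?\<tau> j \<in> ball t0 \<rho>" for j using time[of j] \<epsilon> by simp
      have "\<exists>S. solves_stages f a t h y0 \<rho> S"
      proof (rule stage_solution_map[where L = L and A = A])
        show "norm (f (?\<tau> j, y)) \<le> L" if "y \<in> cball y0 \<rho>" for j y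
          by (rule bnd[OF in_r[OF \<tau> that]])
        show "norm (f (?\<tau> j, y) - f (?\<tau> j, y')) \<le> L * norm (y - y')"
          if "y \<in> cball y0 \<rho>" "y' \<in> cball y0 \<rho>" for j y y'
          using lip[OF in_r[OF \<tau>[of j] that(1)] in_r[OF \<tau>[of j] that(2)]] by (simp add: norm_Pair)
        show "(\<lambda>y. f (?\<tau> j, y)) differentiable (at y)" if "y \<in> ball y0 \<rho>" for j y
        proof -
          have "(?\<tau> j, y) \<in> U" using sub \<tau> that by blast
          then have "f differentiable (at (?\<tau> j, y))"
            using smooth_on_has_derivative[OF U(2)] differentiableI by blast
          then show ?thesis
            by (rule differentiable_compose[of f "\<lambda>y. (?\<tau> j, y)"])
              (auto simp: differentiable_def intro!: derivative_eq_intros exI)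
        qed
        show "A = (\<Sum>i\<in>UNIV. \<Sum>j\<in>UNIV. \<bar>a i j\<bar>)" by (rule A_def)
        show "h * A * L \<le> 1/2" "h * A * L \<le> \<rho>/4"
          using hN[OF N(2)] \<delta> \<epsilon> by (simp_all add: mult.assoc)
      qed (rule \<rho> L h(1))+
      then obtain S where "solves_stages f a t h y0 \<rho> S" by blast
      note sol = this[unfolded solves_stages_def]
      have half: "y \<in> ball y0 (\<rho>/2)" if "y \<in> ball y0 \<delta>" for y
        using that \<delta>\<epsilon> \<epsilon> by simp
      have S: "stage_equations f a t h y (S y)" and S\<rho>: "S y i \<in> ball y0 \<rho>"
        and Sdiff: "(\<lambda>y. S y i) differentiable (at y)" if "y \<in> ball y0 \<delta>" for y i
        using bspec[OF sol half[OF that]] by blast+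
      have near: "y + h *\<^sub>R (\<Sum>j\<in>UNIV. c j *\<^sub>R f (?\<tau> j, S y j)) \<in> ball y0 \<epsilon>"
        if y: "y \<in> ball y0 \<delta>" and c: "(\<Sum>j\<in>UNIV. \<bar>c j\<bar>) * L \<le> N" for y c
      proof -
        have "norm (f (?\<tau> j, S y j)) \<le> L" for j
          using S\<rho>[OF y, of j] by (intro bnd in_r[OF \<tau>]) simp
        then have "norm (\<Sum>j\<in>UNIV. c j *\<^sub>R f (?\<tau> j, S y j)) \<le> (\<Sum>j\<in>UNIV. \<bar>c j\<bar>) * L"
          by (rule norm_weighted_sum_le)
        then have "norm (h *\<^sub>R (\<Sum>j\<in>UNIV. c j *\<^sub>R f (?\<tau> j, S y j))) \<le> \<delta> * N"
          using hN c h by (simp add: order_trans)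
        then have "norm (h *\<^sub>R (\<Sum>j\<in>UNIV. c j *\<^sub>R f (?\<tau> j, S y j))) \<le> \<epsilon>/4" using \<delta> by simp
        moreover have "norm (y - y0) < \<epsilon>/4" using y \<delta>\<epsilon> by (simp add: dist_norm norm_minus_commute)
        ultimately show ?thesis
          using norm_triangle_ineq[of "y - y0" "h *\<^sub>R (\<Sum>j\<in>UNIV. c j *\<^sub>R f (?\<tau> j, S y j))"] \<epsilon>
          by (simp add: dist_norm norm_minus_commute algebra_simps)
      qed
      let ?R = "\<lambda>y. y + h *\<^sub>R (\<Sum>j\<in>UNIV. b j *\<^sub>R f (?\<tau> j, S y j))"
      have "S y i \<in> ball y0 \<epsilon>" if y: "y \<in> ball y0 \<delta>" for y i
      proof -
        have "(\<Sum>j\<in>UNIV. \<bar>a i j\<bar>) * L \<le> N"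
          using row[of i] L N(2) by (meson less_imp_le mult_right_mono order_trans)
        from near[OF y this] show ?thesis
          using S[OF y] unfolding stage_equations_def by metis
      qed
      moreover have "?R y \<in> ball y0 \<epsilon>" if y: "y \<in> ball y0 \<delta>" for y
        by (rule near[OF y]) (use N(3) in \<open>simp add: B_def\<close>)
      moreover have "?R differentiable (at y)" if y: "y \<in> ball y0 \<delta>" for y
      proof -
        have "(\<lambda>y. f (?\<tau> j, S y j)) differentiable (at y)" for j
        proof -
          have "(?\<tau> j, S y j) \<in> U" using sub \<tau> S\<rho>[OF y] by blast
          then have "f differentiable (at (?\<tau> j, S y j))"
            using smooth_on_has_derivative[OF U(2)] differentiableI by blast
          moreover have "(\<lambda>y. (?\<tau> j, S y j)) differentiable (at y)"
            using Sdiff[OF y, of j] has_derivative_Pair[OF has_derivative_const]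
            unfolding differentiable_def by blast
          ultimately show ?thesis by (rule differentiable_compose[of f "\<lambda>y. (?\<tau> j, S y j)"])
        qed
        then show ?thesis
          by (intro differentiable_add differentiable_scaleR differentiable_const differentiable_sum
              differentiable_ident) auto
      qed
      moreover have "norm (?R y - ?R y') \<le> (1 + C * h) * norm (y - y')"
        if y: "y \<in> ball y0 \<delta>" and y': "y' \<in> ball y0 \<delta>" for y y'
      proof -
        have "norm (f (?\<tau> j, S y j) - f (?\<tau> j, S y' j)) \<le> L * (2 * real CARD('s) * norm (y - y'))" for j
        proof -
          have "norm (f (?\<tau> j, S y j) - f (?\<tau> j, S y' j)) \<le> L * norm ((?\<tau> j, S y j) - (?\<tau> j, S y' j))"
            using S\<rho>[OF y, of j] S\<rho>[OF y', of j] by (intro lip in_r[OF \<tau>]) simp_all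
          also have "\<dots> = L * norm (S y j - S y' j)" by (simp add: norm_Pair)
          also have "\<dots> \<le> L * (2 * real CARD('s) * norm (y - y'))"
            using L bspec[OF sol half[OF y]] half[OF y'] by (intro mult_left_mono) (blast, simp)
          finally show ?thesis .
        qed
        then have 1: "norm (\<Sum>j\<in>UNIV. b j *\<^sub>R (f (?\<tau> j, S y j) - f (?\<tau> j, S y' j)))
            \<le> B * (L * (2 * real CARD('s) * norm (y - y')))"
          unfolding B_def by (rule norm_weighted_sum_le)
        have "?R y - ?R y' = (y - y') + h *\<^sub>R (\<Sum>j\<in>UNIV. b j *\<^sub>R (f (?\<tau> j, S y j) - f (?\<tau> j, S y' j)))"
          by (simp add: scaleR_right_diff_distrib sum_subtractf)
        then have "norm (?R y - ?R y') \<le> norm (y - y')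
            + norm (h *\<^sub>R (\<Sum>j\<in>UNIV. b j *\<^sub>R (f (?\<tau> j, S y j) - f (?\<tau> j, S y' j))))"
          by (simp only: norm_triangle_ineq)
        also have "\<dots> \<le> norm (y - y') + h * (B * (L * (2 * real CARD('s) * norm (y - y'))))"
          using mult_left_mono[OF 1, of h] h by simp
        also have "\<dots> \<le> (1 + C * h) * norm (y - y')"
          using h by (simp add: C_def algebra_simps)
        finally show ?thesis .
      qed
      ultimately have "local_stage_map f a b t h y0 \<delta> \<epsilon> \<rho> C S"
        unfolding local_stage_map_def rk_update_def
      proof (intro ballI conjI allI impI)
        show "stage_equations f a t h y (S y)" "(\<lambda>y. S y i) differentiable (at y)" if "y \<in> ball y0 \<delta>" for y i
          by (rule S[OF that] Sdiff[OF that])+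
        show "Y = S y" if y: "y \<in> ball y0 \<delta>" and Y: "stage_equations f a t h y Y" "\<forall>i. Y i \<in> ball y0 \<rho>" for y Y
        proof -
          have "\<forall>i. Y i \<in> cball y0 \<rho>" using Y(2) ball_subset_cball by blast
          then show ?thesis using bspec[OF sol half[OF y]] Y(1) by blast
        qed
      qed
      moreover have "t + h \<in> ball t0 \<epsilon>" using t h \<delta>\<epsilon> by (simp add: dist_real_def)
      ultimately show ?thesis using time by blast
    qed
    with \<delta> \<delta>\<epsilon> \<epsilon> show ?thesis by (intro exI[of _ \<delta>]) auto
  qed
  show thesis by (rule that[OF \<rho> C sub main])
qed

section \<open>Gradients\<close>

lemma grad_eqI: "GDERIV f x :> d \<Longrightarrow> grad f x = d"
  unfolding grad_def
proof (rule the_equality)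
  fix d' assume "GDERIV f x :> d" "GDERIV f x :> d'"
  then have "(\<lambda>u. inner u d) = (\<lambda>u. inner u d')"
    unfolding gderiv_def by (rule has_derivative_unique)
  then have "inner (d - d') d = inner (d - d') d'" by (rule fun_cong)
  then have "inner (d - d') (d - d') = 0" by (simp add: inner_diff_right)
  then show "d' = d" by simp
qed

lemma has_gradient:
  fixes f :: "'a::euclidean_space \<Rightarrow> real"
  assumes "(f has_derivative f') (at x)"
  shows "(f has_derivative (\<lambda>u. u \<bullet> grad f x)) (at x)" "grad f x = (\<Sum>b\<in>Basis. f' b *\<^sub>R b)"
    "\<And>u. u \<bullet> grad f x = f' u"
proof -
  have f': "u \<bullet> (\<Sum>b\<in>Basis. f' b *\<^sub>R b) = f' u" for u
    using linear_eq_sum_Basis[OF has_derivative_linear[OF assms], of u]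
    by (simp add: inner_sum_right mult.commute)
  then have "GDERIV f x :> (\<Sum>b\<in>Basis. f' b *\<^sub>R b)"
    using assms by (simp add: gderiv_def)
  then show g: "grad f x = (\<Sum>b\<in>Basis. f' b *\<^sub>R b)"
    by (rule grad_eqI)
  show "u \<bullet> grad f x = f' u" for u unfolding g by (rule f')
  then show "(f has_derivative (\<lambda>u. u \<bullet> grad f x)) (at x)" using assms by simp
qed

lemma differentiable_has_gradient:
  fixes f :: "'a::euclidean_space \<Rightarrow> real"
  shows "f differentiable (at x) \<Longrightarrow> (f has_derivative (\<lambda>u. u \<bullet> grad f x)) (at x)"
  using has_gradient(1) unfolding differentiable_def by blast

section \<open>Phase space\<close>

definition pos_mom :: "('n::finite, 'k::finite) phase \<Rightarrow> (real^'n) \<times> (real^'n)" where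
  "pos_mom z = (fst z, fst (snd z))"

definition multiplier :: "('n::finite, 'k::finite) phase \<Rightarrow> real^'k" where
  "multiplier z = snd (snd z)"

definition phase_point :: "(real^'n) \<times> (real^'n) \<Rightarrow> real^'k \<Rightarrow> ('n::finite, 'k::finite) phase" where
  "phase_point y l = (fst y, snd y, l)"

lemma phase_point_simps [simp]:
  "pos_mom (phase_point y l) = y" "multiplier (phase_point y l) = l"
  "phase_point (pos_mom z) (multiplier z) = z"
  by (simp_all add: pos_mom_def multiplier_def phase_point_def)

lemma bounded_linear_pos_mom: "bounded_linear pos_mom"
  unfolding pos_mom_def
  by (intro bounded_linear_Pair bounded_linear_fst bounded_linear_fst_comp bounded_linear_snd)

lemma bounded_linear_multiplier: "bounded_linear multiplier"
  unfolding multiplier_def by (intro bounded_linear_snd_comp bounded_linear_snd)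

lemma bounded_linear_phase_point: "bounded_linear (\<lambda>x. phase_point (fst x) (snd x))"
  unfolding phase_point_def
  by (intro bounded_linear_Pair bounded_linear_fst_comp bounded_linear_snd_comp bounded_linear_fst bounded_linear_snd)

lemma norm_phase_point: "norm (phase_point y l) = norm (y, l)"
  by (cases y) (simp add: phase_point_def norm_Pair)

lemma dist_phase_point: "dist (phase_point y l) (phase_point y' l') = dist (y, l) (y', l')"
  using norm_phase_point[of "y - y'" "l - l'"] by (simp add: dist_norm phase_point_def)

lemma dist_pos_mom_le: "dist (pos_mom z) (pos_mom z') \<le> dist z z'"
  and dist_multiplier_le: "dist (multiplier z) (multiplier z') \<le> dist z z'"
  and dist_le_pos_mom_multiplier: "dist z z' \<le> dist (pos_mom z) (pos_mom z') + dist (multiplier z) (multiplier z')"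
proof -
  have "dist z z' = dist (pos_mom z, multiplier z) (pos_mom z', multiplier z')"
    using dist_phase_point[of "pos_mom z" "multiplier z" "pos_mom z'" "multiplier z'"] by simp
  then show "dist (pos_mom z) (pos_mom z') \<le> dist z z'" "dist (multiplier z) (multiplier z') \<le> dist z z'"
    "dist z z' \<le> dist (pos_mom z) (pos_mom z') + dist (multiplier z) (multiplier z')"
    using dist_fst_le[of "(pos_mom z, multiplier z)" "(pos_mom z', multiplier z')"]
      dist_snd_le[of "(pos_mom z, multiplier z)" "(pos_mom z', multiplier z')"] dist_Pair_le
    by (simp_all only: fst_conv snd_conv)
qed

lemma Jmap_eq: "Jmap z = (- snd (pos_mom z), fst (pos_mom z), 0)"
  by (cases z) (simp add: pos_mom_def)

lemma bounded_linear_Jmap: "bounded_linear Jmap"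
proof -
  have "linear (Jmap :: ('a::finite, 'b::finite) phase \<Rightarrow> _)"
    by (rule linearI) (simp_all add: Jmap_eq pos_mom_def)
  then show ?thesis by (simp add: linear_conv_bounded_linear)
qed

text \<open>The form \<open>dq \<and> dp\<close> expressed through \<open>J\<close>; this is how \<open>J F = \<nabla>H\<close> enters the symplecticity argument.\<close>
lemma omega_eq: "omega u w = - (u \<bullet> Jmap w)"
  by (cases u; cases w) (simp add: inner_commute)

section \<open>Smooth Hamiltonians\<close>

locale smooth_hamiltonian =
  fixes H :: "real \<Rightarrow> ('n::finite, 'k::finite) phase \<Rightarrow> real"
  assumes smooth_H: "smooth_on UNIV (\<lambda>(t, z). H t z)"
begin

definition gradH :: "real \<times> ('n, 'k) phase \<Rightarrow> ('n, 'k) phase" where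
  "gradH x = grad (H (fst x)) (snd x)"

definition hamiltonian_field :: "real \<times> ('n, 'k) phase \<Rightarrow> (real^'n) \<times> (real^'n)" where
  "hamiltonian_field x = (fst (snd (gradH x)), - fst (gradH x))"

lemma has_derivative_H:
  "(H t has_derivative (\<lambda>u. frechet_derivative (\<lambda>(t, z). H t z) (at (t, z)) (0, u))) (at z)"
proof -
  have 1: "((\<lambda>z. (t, z)) has_derivative (\<lambda>u. (0, u))) (at z)"
    by (rule has_derivative_Pair[OF has_derivative_const has_derivative_ident])
  have 2: "((\<lambda>(t, z). H t z) has_derivative frechet_derivative (\<lambda>(t, z). H t z) (at (t, z))) (at (t, z))"
    by (rule smooth_on_has_derivative[OF smooth_H UNIV_I])
  show ?thesis using has_derivative_compose[OF 1 2] by simp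
qed

lemma inner_gradH: "u \<bullet> gradH x = frechet_derivative (\<lambda>(t, z). H t z) (at x) (0, u)"
  using has_gradient(3)[OF has_derivative_H[of "fst x" "snd x"], of u] by (simp add: gradH_def)

lemma smooth_gradH: "smooth_on UNIV gradH"
proof (rule smooth_on_cong)
  show "smooth_on UNIV (\<lambda>x. \<Sum>b\<in>Basis. frechet_derivative (\<lambda>(t, z). H t z) (at x) (0, b) *\<^sub>R b)"
    by (intro smooth_on_sum smooth_on_scaleR smooth_on_const open_UNIV smooth_on_frechet_derivative smooth_H)
  show "(\<Sum>b\<in>Basis. frechet_derivative (\<lambda>(t, z). H t z) (at x) (0, b) *\<^sub>R b) = gradH x" for x
    using has_gradient(2)[OF has_derivative_H[of "fst x" "snd x"]] by (simp add: gradH_def)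
qed simp

lemma grad_lambda_H: "grad_lambda (H t) z = multiplier (gradH (t, z))"
proof (cases z)
  case (fields q p l)
  have 1: "((\<lambda>l'. (q, p, l')) has_derivative (\<lambda>u. (0, 0, u))) (at l)"
    by (intro has_derivative_Pair has_derivative_const has_derivative_ident)
  have 2: "(H t has_derivative (\<lambda>u. u \<bullet> gradH (t, z))) (at (q, p, l))"
    using has_gradient(1)[OF has_derivative_H[of t z]] unfolding fields by (simp add: gradH_def)
  have "((\<lambda>l'. H t (q, p, l')) has_derivative (\<lambda>u. u \<bullet> multiplier (gradH (t, z)))) (at l)"
    using has_derivative_compose[OF 1 2] by (simp add: multiplier_def inner_prod_def)
  then have "GDERIV (\<lambda>l'. H t (q, p, l')) l :> multiplier (gradH (t, z))"
    by (simp add: gderiv_def)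
  then show ?thesis unfolding fields by (simp add: grad_eqI)
qed

lemma constraint_set_iff: "z \<in> constraint_set H t \<longleftrightarrow> multiplier (gradH (t, z)) = 0"
  by (simp add: constraint_set_def grad_lambda_H)

lemma hessian_symmetric:
  "u \<bullet> frechet_derivative gradH (at x) (0, w) = w \<bullet> frechet_derivative gradH (at x) (0, u)"
proof -
  let ?F = "\<lambda>(t, z). H t z"
  have "u \<bullet> frechet_derivative gradH (at x) (0, w) =
     frechet_derivative (\<lambda>x. frechet_derivative ?F (at x) (0, u)) (at x) (0, w)" for u w
  proof -
    have "(gradH has_derivative frechet_derivative gradH (at x)) (at x)"
      by (rule smooth_on_has_derivative[OF smooth_gradH UNIV_I])
    then have "((\<lambda>x. u \<bullet> gradH x) has_derivative (\<lambda>v. u \<bullet> frechet_derivative gradH (at x) v)) (at x)"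
      by (rule has_derivative_inner_right)
    then show ?thesis unfolding inner_gradH by (metis frechet_derivative_at)
  qed
  moreover have "Ck_on 2 UNIV ?F" using smooth_H unfolding smooth_on_def by blast
  ultimately show ?thesis using symmetric_second_derivative by metis
qed

lemma smooth_hamiltonian_field: "smooth_on UNIV hamiltonian_field"
  unfolding hamiltonian_field_def
  by (intro smooth_on_Pair smooth_on_minus smooth_on_fst smooth_on_snd smooth_gradH open_UNIV)

lemma Jmap_eq_gradH_iff:
  "Jmap z = gradH x \<longleftrightarrow> pos_mom z = hamiltonian_field x \<and> multiplier (gradH x) = 0"
  by (cases "gradH x") (auto simp: Jmap_eq hamiltonian_field_def multiplier_def prod_eq_iff pos_mom_def
      minus_equation_iff[of "fst (snd z)"])

text \<open>The vectors \<open>F\<^sub>j\<close> are eliminated: the first two rows of \<open>J F\<^sub>j = \<nabla>H(Z\<^sub>j)\<close> determine the position and momentum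
  parts of \<open>F\<^sub>j\<close>, and the last row is solvable exactly if the stage lies on the constraint set.\<close>
lemma rk_step_iff:
  fixes Z :: "'s::finite \<Rightarrow> ('n, 'k) phase"
  shows "rk_step H a b t h z0 Z z1 \<longleftrightarrow>
     (\<forall>j. Z j \<in> constraint_set H (t + abscissa a j * h)) \<and>
     (\<forall>i. pos_mom (Z i) = pos_mom z0 + h *\<^sub>R (\<Sum>j\<in>UNIV. a i j *\<^sub>R hamiltonian_field (t + abscissa a j * h, Z j))) \<and>
     pos_mom z1 = pos_mom z0 + h *\<^sub>R (\<Sum>j\<in>UNIV. b j *\<^sub>R hamiltonian_field (t + abscissa a j * h, Z j))"
  (is "?L \<longleftrightarrow> ?R")
proof -
  have J: "Jmap u = Jmap z0 + h *\<^sub>R (\<Sum>j\<in>UNIV. c j *\<^sub>R Jmap (F j)) \<longleftrightarrow>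
     pos_mom u = pos_mom z0 + h *\<^sub>R (\<Sum>j\<in>UNIV. c j *\<^sub>R pos_mom (F j))"
    for u :: "('n, 'k) phase" and c :: "'s \<Rightarrow> real" and F :: "'s \<Rightarrow> ('n, 'k) phase"
  proof -
    interpret J: bounded_linear "Jmap :: ('n, 'k) phase \<Rightarrow> _" by (rule bounded_linear_Jmap)
    interpret P: bounded_linear "pos_mom :: ('n, 'k) phase \<Rightarrow> _" by (rule bounded_linear_pos_mom)
    have "Jmap z0 + h *\<^sub>R (\<Sum>j\<in>UNIV. c j *\<^sub>R Jmap (F j)) = Jmap (z0 + h *\<^sub>R (\<Sum>j\<in>UNIV. c j *\<^sub>R F j))"
      by (simp only: J.add J.scaleR J.sum)
    moreover have "pos_mom z0 + h *\<^sub>R (\<Sum>j\<in>UNIV. c j *\<^sub>R pos_mom (F j)) = pos_mom (z0 + h *\<^sub>R (\<Sum>j\<in>UNIV. c j *\<^sub>R F j))"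
      by (simp only: P.add P.scaleR P.sum)
    moreover have "Jmap u = Jmap v \<longleftrightarrow> pos_mom u = pos_mom v" for v
      by (auto simp: Jmap_eq prod_eq_iff)
    ultimately show ?thesis by simp
  qed
  have g: "Jmap (F j) = grad (H s) (Z j) \<longleftrightarrow> pos_mom (F j) = hamiltonian_field (s, Z j) \<and> Z j \<in> constraint_set H s"
    for F :: "'s \<Rightarrow> ('n, 'k) phase" and j s
    using Jmap_eq_gradH_iff[of "F j" "(s, Z j)"] by (simp add: gradH_def constraint_set_iff)
  show ?thesis
  proof
    assume ?L
    then show ?R unfolding rk_step_def J g by auto
  next
    assume R: ?R
    show ?L unfolding rk_step_def J g
      by (rule exI[of _ "\<lambda>j. phase_point (hamiltonian_field (t + abscissa a j * h, Z j)) 0"])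
        (use R in simp)
  qed
qed

end

section \<open>Elimination of the multipliers\<close>

text \<open>The assumption is that \<open>H\<^sub>\<lambda>\<^sub>\<lambda>\<close> is injective at the points of the constraint set.\<close>
locale regular_hamiltonian = smooth_hamiltonian H
  for H :: "real \<Rightarrow> ('n::finite, 'k::finite) phase \<Rightarrow> real" +
  assumes nondegenerate: "z \<in> constraint_set H t \<Longrightarrow>
    multiplier (frechet_derivative gradH (at (t, z)) (0, phase_point 0 w)) = 0 \<Longrightarrow> w = 0"

text \<open>\<open>Zs y\<close> and \<open>Ze y\<close> are the stages and the endpoint of the step from any phase point with position and momentum
  \<open>y\<close>, since the equations involve the initial value only through \<open>J z\<^sub>0\<close>. The radii have the same meaning as for
  ordinary differential equations.\<close>
definition step_maps where
  "step_maps H f a b t h z0 \<delta> \<epsilon> \<rho> C Zs Ze \<longleftrightarrow>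
     (\<forall>y\<in>ball (pos_mom z0) \<delta>.
        (\<forall>z. pos_mom z = y \<longrightarrow> rk_step H a b t h z (Zs y) (Ze y)) \<and>
        ode_rk_step f a b t h y (\<lambda>i. pos_mom (Zs y i)) (pos_mom (Ze y)) \<and>
        (\<forall>i. Zs y i \<in> ball z0 \<epsilon>) \<and> Ze y \<in> ball z0 \<epsilon> \<and> Ze y \<in> constraint_set H (t + h) \<and>
        (\<forall>z Z z1. pos_mom z = y \<longrightarrow> rk_step H a b t h z Z z1 \<longrightarrow> z1 \<in> constraint_set H (t + h) \<longrightarrow>
           (\<forall>i. Z i \<in> ball z0 \<rho>) \<longrightarrow> z1 \<in> ball z0 \<rho> \<longrightarrow> Z = Zs y \<and> z1 = Ze y) \<and>
        (\<forall>i. (\<lambda>y. Zs y i) differentiable (at y)) \<and> Ze differentiable (at y) \<and>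
        (\<forall>y'\<in>ball (pos_mom z0) \<delta>.
           norm (pos_mom (Ze y) - pos_mom (Ze y')) \<le> (1 + C * h) * norm (y - y')))"

context regular_hamiltonian
begin

text \<open>Near a point of the constraint set, constrained points are determined by time, position and momentum. Away from
  it the constraint set may have further sheets, hence the neighbourhood \<open>W\<close> of multipliers.\<close>
lemma constraint_sheet:
  assumes "z0 \<in> constraint_set H t0"
  obtains U W \<Lambda> where "open U" "(t0, pos_mom z0) \<in> U" "open W" "multiplier z0 \<in> W" "smooth_on U \<Lambda>"
    "\<And>t z. (t, pos_mom z) \<in> U \<Longrightarrow> multiplier z \<in> W \<Longrightarrow>
       z \<in> constraint_set H t \<longleftrightarrow> multiplier z = \<Lambda> (t, pos_mom z)"
    "\<And>x. x \<in> U \<Longrightarrow> \<Lambda> x \<in> W"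
proof -
  define e where "e x = (fst (fst x), phase_point (snd (fst x)) (snd x))"
    for x :: "(real \<times> (real^'n) \<times> (real^'n)) \<times> (real^'k)"
  have e: "bounded_linear e"
    unfolding e_def phase_point_def
    by (intro bounded_linear_Pair bounded_linear_fst_comp bounded_linear_snd_comp bounded_linear_fst bounded_linear_snd)
  define G where "G x = multiplier (gradH (e x))" for x
  have smooth: "smooth_on UNIV G"
    unfolding G_def
    by (intro smooth_on_bounded_linear_compose[OF bounded_linear_multiplier]
        smooth_on_compose[where f = e and g = gradH and T = UNIV] smooth_gradH smooth_on_bounded_linear e) auto
  let ?x0 = "((t0, pos_mom z0), multiplier z0)"
  have e0: "e ?x0 = (t0, z0)" by (simp add: e_def)
  have "(gradH has_derivative frechet_derivative gradH (at (e ?x0))) (at (e ?x0))"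
    by (rule smooth_on_has_derivative[OF smooth_gradH UNIV_I])
  from bounded_linear.has_derivative[OF bounded_linear_multiplier
      has_derivative_compose[OF bounded_linear_imp_has_derivative[OF e] this]]
  have "(G has_derivative (\<lambda>u. multiplier (frechet_derivative gradH (at (t0, z0)) (e u)))) (at ?x0)"
    unfolding G_def e0 .
  then have G': "frechet_derivative G (at ?x0) = (\<lambda>u. multiplier (frechet_derivative gradH (at (t0, z0)) (e u)))"
    by (rule frechet_derivative_at[symmetric])
  have "G ?x0 = 0" using assms by (simp add: G_def e0 constraint_set_iff)
  moreover have "w = 0" if "frechet_derivative G (at ?x0) (0, w) = 0" for w
    using that nondegenerate[OF assms, of w] by (simp add: G' e_def)
  ultimately obtain U W \<Lambda> where *: "open U" "(t0, pos_mom z0) \<in> U" "open W" "multiplier z0 \<in> W" "smooth_on U \<Lambda>"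
    and **: "\<And>x l. x \<in> U \<Longrightarrow> l \<in> W \<Longrightarrow> G (x, l) = 0 \<longleftrightarrow> l = \<Lambda> x" "\<And>x. x \<in> U \<Longrightarrow> \<Lambda> x \<in> W"
    using smooth_implicit_function[OF smooth] by blast
  have "z \<in> constraint_set H t \<longleftrightarrow> multiplier z = \<Lambda> (t, pos_mom z)"
    if "(t, pos_mom z) \<in> U" "multiplier z \<in> W" for t z
    using **(1)[OF that] by (simp add: G_def e_def constraint_set_iff)
  with * **(2) show thesis using that by blast
qed

text \<open>The reduced equation \<open>y' = f(t, y)\<close> on \<open>U\<close>, together with the step maps that it induces on phase space. The bound on
  \<open>dist z z'\<close> allows errors in position and momentum to be turned into errors of the multiplier.\<close>
definition local_step_family where
  "local_step_family a b t0 z0 U f \<rho> C \<longleftrightarrow>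
     open U \<and> smooth_on U f \<and> \<rho> > 0 \<and> C > 0 \<and> ball t0 \<rho> \<times> ball (pos_mom z0) \<rho> \<subseteq> U \<and>
     (\<forall>t\<in>ball t0 \<rho>. \<forall>z\<in>ball z0 \<rho> \<inter> constraint_set H t. f (t, pos_mom z) = hamiltonian_field (t, z)) \<and>
     (\<forall>t\<in>ball t0 \<rho>. \<forall>z\<in>ball z0 \<rho> \<inter> constraint_set H t. \<forall>z'\<in>ball z0 \<rho> \<inter> constraint_set H t.
        dist z z' \<le> C * dist (pos_mom z) (pos_mom z')) \<and>
     (\<forall>\<epsilon>. 0 < \<epsilon> \<longrightarrow> \<epsilon> \<le> \<rho> \<longrightarrow> (\<exists>\<delta>>0. \<delta> \<le> \<epsilon> \<and> (\<forall>t\<in>ball t0 \<delta>. \<forall>h\<in>{0<..<\<delta>}.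
        (\<forall>i. t + abscissa a i * h \<in> ball t0 \<epsilon>) \<and> (\<exists>Zs Ze. step_maps H f a b t h z0 \<delta> \<epsilon> \<rho> C Zs Ze))))"

text \<open>The lift \<open>(t, y) \<mapsto> (y, \<Lambda>(t, y))\<close> onto the constraint set translates the stage equations of the reduced equation
  into those of the constrained system, and back.\<close>
lemma local_step_family_exists:
  assumes z0: "z0 \<in> constraint_set H t0"
  obtains U f \<rho> C where "local_step_family a b t0 z0 U f \<rho> C"
proof -
  let ?y0 = "pos_mom z0"
  obtain U W \<Lambda> where U: "open U" "(t0, ?y0) \<in> U" and W: "open W" "multiplier z0 \<in> W"
    and \<Lambda>: "smooth_on U \<Lambda>"
    and sheet: "\<And>t z. (t, pos_mom z) \<in> U \<Longrightarrow> multiplier z \<in> W \<Longrightarrow>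
       z \<in> constraint_set H t \<longleftrightarrow> multiplier z = \<Lambda> (t, pos_mom z)"
    and \<Lambda>W: "\<And>x. x \<in> U \<Longrightarrow> \<Lambda> x \<in> W"
    using constraint_sheet[OF z0] by blast
  define lift where "lift x = phase_point (snd x) (\<Lambda> x)" for x
  have lift_simps: "pos_mom (lift x) = snd x" "multiplier (lift x) = \<Lambda> x" for x
    by (simp_all add: lift_def)
  have lift_C: "lift (t, y) \<in> constraint_set H t" if "(t, y) \<in> U" for t y
    using sheet[of t "lift (t, y)"] \<Lambda>W[OF that] that by (simp add: lift_simps)
  have lift_smooth: "smooth_on U lift"
    using smooth_on_bounded_linear_compose[OF bounded_linear_phase_point U(1)
        smooth_on_Pair[OF U(1) smooth_on_bounded_linear[OF bounded_linear_snd U(1)] \<Lambda>]]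
    by (simp add: lift_def[abs_def])
  define f where "f x = hamiltonian_field (fst x, lift x)" for x
  have f: "smooth_on U f"
    unfolding f_def
    by (intro smooth_on_compose[where f = "\<lambda>x. (fst x, lift x)" and g = hamiltonian_field and T = UNIV]
        smooth_hamiltonian_field smooth_on_Pair smooth_on_bounded_linear bounded_linear_fst lift_smooth U(1)) auto
  obtain \<rho>1 C1 where \<rho>1: "\<rho>1 > 0" "C1 > 0" "ball t0 \<rho>1 \<times> ball ?y0 \<rho>1 \<subseteq> U"
    and stages: "\<And>\<epsilon>. 0 < \<epsilon> \<Longrightarrow> \<epsilon> \<le> \<rho>1 \<Longrightarrow> \<exists>\<delta>>0. \<delta> \<le> \<epsilon> \<and>
       (\<forall>t\<in>ball t0 \<delta>. \<forall>h\<in>{0<..<\<delta>}. (\<forall>i. t + abscissa a i * h \<in> ball t0 \<epsilon>) \<and> t + h \<in> ball t0 \<epsilon> \<and>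
          (\<exists>S. local_stage_map f a b t h ?y0 \<delta> \<epsilon> \<rho>1 C1 S))"
    using local_stage_map_exists[OF U(1) f U(2), of a b] by metis
  obtain r L where r: "r > 0" "L > 0" "cball (t0, ?y0) r \<subseteq> U"
    and lip: "\<And>x x'. x \<in> cball (t0, ?y0) r \<Longrightarrow> x' \<in> cball (t0, ?y0) r \<Longrightarrow> norm (\<Lambda> x - \<Lambda> x') \<le> L * norm (x - x')"
    using smooth_locally_lipschitz[OF \<Lambda> U] by metis
  obtain rW where rW: "rW > 0" "ball (multiplier z0) rW \<subseteq> W" using W by (meson openE)
  define \<rho> where "\<rho> = min \<rho>1 (min (r/2) rW)"
  define C where "C = 1 + C1 + L"
  have \<rho>: "\<rho> > 0" "\<rho> \<le> \<rho>1" "\<rho> \<le> r/2" "\<rho> \<le> rW" using \<rho>1 r rW by (auto simp: \<rho>_def)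
  have C: "C > 0" "C1 \<le> C" "1 + L \<le> C" using \<rho>1 r by (auto simp: C_def)
  have in_r: "(t, y) \<in> cball (t0, ?y0) r" if "t \<in> ball t0 \<rho>" "y \<in> ball ?y0 \<rho>" for t y
    using dist_Pair_le[of t0 ?y0 t y] that \<rho>(3) by simp
  have in_U: "(t, y) \<in> U" if "t \<in> ball t0 \<rho>" "y \<in> ball ?y0 \<rho>" for t y
    using in_r[OF that] r(3) by blast
  have pm_ball: "pos_mom z \<in> ball ?y0 \<epsilon>" "multiplier z \<in> ball (multiplier z0) \<epsilon>" if "z \<in> ball z0 \<epsilon>" for z \<epsilon>
    using that dist_pos_mom_le[of z0 z] dist_multiplier_le[of z0 z] by simp_all
  have sheet': "z = lift (t, pos_mom z)" if "t \<in> ball t0 \<rho>" "z \<in> ball z0 \<rho>" "z \<in> constraint_set H t" for t z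
  proof -
    have "multiplier z \<in> W" using pm_ball[OF that(2)] rW(2) \<rho>(4) by auto
    then have "multiplier z = \<Lambda> (t, pos_mom z)"
      using sheet[OF in_U[OF that(1) pm_ball(1)[OF that(2)]]] that(3) by blast
    then have "lift (t, pos_mom z) = phase_point (pos_mom z) (multiplier z)" by (simp add: lift_def)
    then show ?thesis by simp
  qed
  have field: "f (t, pos_mom z) = hamiltonian_field (t, z)"
    if "t \<in> ball t0 \<rho>" "z \<in> ball z0 \<rho>" "z \<in> constraint_set H t" for t z
    using arg_cong[OF sheet'[OF that], of "\<lambda>z. hamiltonian_field (t, z)"] by (simp add: f_def)
  have sheet_lip: "dist z z' \<le> C * dist (pos_mom z) (pos_mom z')"
    if "t \<in> ball t0 \<rho>" "z \<in> ball z0 \<rho>" "z' \<in> ball z0 \<rho>" "z \<in> constraint_set H t" "z' \<in> constraint_set H t" for t z z'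
  proof -
    have m: "multiplier z = \<Lambda> (t, pos_mom z)" "multiplier z' = \<Lambda> (t, pos_mom z')"
      using arg_cong[OF sheet'[OF that(1,2,4)], of multiplier] arg_cong[OF sheet'[OF that(1,3,5)], of multiplier]
      by (simp_all only: lift_simps)
    have "dist (multiplier z) (multiplier z') \<le> L * norm ((t, pos_mom z) - (t, pos_mom z'))"
      unfolding m dist_norm using pm_ball(1)[OF that(2)] pm_ball(1)[OF that(3)] that(1) by (intro lip in_r)
    also have "\<dots> = L * dist (pos_mom z) (pos_mom z')" by (simp add: norm_Pair dist_norm)
    finally have "dist z z' \<le> (1 + L) * dist (pos_mom z) (pos_mom z')"
      using dist_le_pos_mom_multiplier[of z z'] by (simp add: algebra_simps)
    also have "\<dots> \<le> C * dist (pos_mom z) (pos_mom z')" using C by (simp add: mult_right_mono)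
    finally show ?thesis .
  qed
  have lift0: "lift (t0, ?y0) = z0" using sheet'[of t0 z0] \<rho> z0 by simp
  have main: "\<exists>\<delta>>0. \<delta> \<le> \<epsilon> \<and> (\<forall>t\<in>ball t0 \<delta>. \<forall>h\<in>{0<..<\<delta>}.
       (\<forall>i. t + abscissa a i * h \<in> ball t0 \<epsilon>) \<and> (\<exists>Zs Ze. step_maps H f a b t h z0 \<delta> \<epsilon> \<rho> C Zs Ze))"
    if \<epsilon>: "0 < \<epsilon>" "\<epsilon> \<le> \<rho>" for \<epsilon>
  proof -
    \<comment> \<open>Chosen such that the lift maps the \<open>\<eta>\<close>-neighbourhood into the \<open>\<epsilon>\<close>-ball.\<close>
    define \<eta> where "\<eta> = \<epsilon> / (1 + 2 * L)"
    have \<eta>: "\<eta> > 0" "\<eta> \<le> \<epsilon>" "\<eta> + L * (2 * \<eta>) = \<epsilon>"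
    proof -
      have "1 + 2 * L > 0" "\<eta> * (1 + 2 * L) = \<epsilon>" using r(2) by (simp_all add: \<eta>_def)
      then show "\<eta> + L * (2 * \<eta>) = \<epsilon>" by (simp add: algebra_simps)
      show "\<eta> > 0" using \<epsilon> r(2) by (simp add: \<eta>_def)
      with r(2) have "0 \<le> L * (2 * \<eta>)" by simp
      with \<open>\<eta> + L * (2 * \<eta>) = \<epsilon>\<close> show "\<eta> \<le> \<epsilon>" by linarith
    qed
    have lift_near: "lift (s, y) \<in> ball z0 \<epsilon>" if "s \<in> ball t0 \<eta>" "y \<in> ball ?y0 \<eta>" for s y
    proof -
      have "norm (\<Lambda> (t0, ?y0) - \<Lambda> (s, y)) \<le> L * dist (t0, ?y0) (s, y)"
        unfolding dist_norm using that \<eta> \<epsilon> \<rho>(1) by (intro lip in_r) auto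
      also have "\<dots> \<le> L * (2 * \<eta>)"
        using dist_Pair_le[of t0 ?y0 s y] that r(2) by (intro mult_left_mono) auto
      finally have "dist (multiplier z0) (multiplier (lift (s, y))) \<le> L * (2 * \<eta>)"
        using lift0 lift_simps(2)[of "(t0, ?y0)"] by (simp add: lift_simps dist_norm)
      moreover have "dist ?y0 (pos_mom (lift (s, y))) < \<eta>" using that by (simp add: lift_simps)
      ultimately show ?thesis
        using dist_le_pos_mom_multiplier[of z0 "lift (s, y)"] \<eta>(3) by simp
    qed
    obtain \<delta> where \<delta>: "\<delta> > 0" "\<delta> \<le> \<eta>" and steps:
      "\<And>t h. t \<in> ball t0 \<delta> \<Longrightarrow> h \<in> {0<..<\<delta>} \<Longrightarrow> (\<forall>i. t + abscissa a i * h \<in> ball t0 \<eta>) \<and> t + h \<in> ball t0 \<eta> \<and>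
          (\<exists>S. local_stage_map f a b t h ?y0 \<delta> \<eta> \<rho>1 C1 S)"
      using stages[of \<eta>] \<eta> \<epsilon> \<rho>(2) by (meson order_trans)
    have "(\<forall>i. t + abscissa a i * h \<in> ball t0 \<epsilon>) \<and> (\<exists>Zs Ze. step_maps H f a b t h z0 \<delta> \<epsilon> \<rho> C Zs Ze)"
      if t: "t \<in> ball t0 \<delta>" and h: "h \<in> {0<..<\<delta>}" for t h
    proof -
      let ?\<tau> = "\<lambda>i. t + abscissa a i * h"
      obtain S where S: "local_stage_map f a b t h ?y0 \<delta> \<eta> \<rho>1 C1 S"
        using steps[OF t h] by blast
      have \<tau>: "?\<tau> i \<in> ball t0 \<eta>" "t + h \<in> ball t0 \<eta>" for i using steps[OF t h] by blast+
      have \<tau>\<rho>: "?\<tau> i \<in> ball t0 \<rho>" "t + h \<in> ball t0 \<rho>" for i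
        using \<tau> \<eta> \<epsilon> subset_ball[of \<eta> \<rho> t0] by (meson order_trans subsetD)+
      define Zs where "Zs y i = lift (?\<tau> i, S y i)" for y i
      define R where "R y = rk_update f a b t h y (S y)" for y
      define Ze where "Ze y = lift (t + h, R y)" for y
      have "step_maps H f a b t h z0 \<delta> \<epsilon> \<rho> C Zs Ze"
        unfolding step_maps_def
      proof (rule ballI, intro conjI allI impI ballI)
        fix y assume y: "y \<in> ball ?y0 \<delta>"
        note S' = bspec[OF S[unfolded local_stage_map_def] y, folded R_def]
        have eqs: "stage_equations f a t h y (S y)" and S\<eta>: "\<And>i. S y i \<in> ball ?y0 \<eta>"
          and R\<eta>: "R y \<in> ball ?y0 \<eta>"
          and uniq: "\<And>Y. stage_equations f a t h y Y \<Longrightarrow> \<forall>i. Y i \<in> ball ?y0 \<rho>1 \<Longrightarrow> Y = S y"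
          and Sd: "\<And>i. (\<lambda>y. S y i) differentiable (at y)" and Rd: "R differentiable (at y)"
          and Rlip: "\<And>y'. y' \<in> ball ?y0 \<delta> \<Longrightarrow> norm (R y - R y') \<le> (1 + C1 * h) * norm (y - y')"
          using S' unfolding R_def[abs_def, symmetric] by blast+
        have S\<rho>: "S y i \<in> ball ?y0 \<rho>" "R y \<in> ball ?y0 \<rho>" for i
          using S\<eta>[of i] R\<eta> \<eta> \<epsilon> by simp_all
        have SU: "(?\<tau> i, S y i) \<in> U" "(t + h, R y) \<in> U" for i
          by (intro in_U \<tau>\<rho> S\<rho>)+
        have lift_diff: "(\<lambda>y. lift (s, g y)) differentiable (at y)"
          if "g differentiable (at y)" "(s, g y) \<in> U" for g s
        proof -
          have "lift differentiable (at (s, g y))"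
            using smooth_on_has_derivative[OF lift_smooth that(2)] by (rule differentiableI)
          moreover have "(\<lambda>y. (s, g y)) differentiable (at y)"
            using that(1) has_derivative_Pair[OF has_derivative_const] unfolding differentiable_def by blast
          ultimately show ?thesis by (rule differentiable_compose[of lift "\<lambda>y. (s, g y)"])
        qed
        have F: "f (?\<tau> i, S y i) = hamiltonian_field (?\<tau> i, Zs y i)" for i
          by (simp add: f_def Zs_def)
        show "rk_step H a b t h z (Zs y) (Ze y)" if "pos_mom z = y" for z
          unfolding rk_step_iff that F[symmetric]
        proof (intro conjI allI)
          show "Zs y j \<in> constraint_set H (?\<tau> j)" for j unfolding Zs_def by (rule lift_C[OF SU(1)])
          show "pos_mom (Zs y i) = y + h *\<^sub>R (\<Sum>j\<in>UNIV. a i j *\<^sub>R f (?\<tau> j, S y j))" for i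
            unfolding Zs_def lift_simps snd_conv by (rule eqs[unfolded stage_equations_def, rule_format])
          show "pos_mom (Ze y) = y + h *\<^sub>R (\<Sum>j\<in>UNIV. b j *\<^sub>R f (?\<tau> j, S y j))"
            by (simp add: Ze_def lift_simps R_def rk_update_def)
        qed
        show "ode_rk_step f a b t h y (\<lambda>i. pos_mom (Zs y i)) (pos_mom (Ze y))"
          unfolding ode_rk_step_iff Zs_def Ze_def lift_simps snd_conv R_def
          by (intro conjI eqs refl)
        show "Zs y i \<in> ball z0 \<epsilon>" for i unfolding Zs_def by (rule lift_near[OF \<tau>(1) S\<eta>])
        show "Ze y \<in> ball z0 \<epsilon>" unfolding Ze_def by (rule lift_near[OF \<tau>(2) R\<eta>])
        show "Ze y \<in> constraint_set H (t + h)" unfolding Ze_def by (rule lift_C[OF SU(2)])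
        show "(\<lambda>y. Zs y i) differentiable (at y)" for i
          unfolding Zs_def by (rule lift_diff[OF Sd SU(1)])
        show "Ze differentiable (at y)"
          unfolding Ze_def by (rule lift_diff[OF Rd SU(2)])
        show "norm (pos_mom (Ze y) - pos_mom (Ze y')) \<le> (1 + C * h) * norm (y - y')" if "y' \<in> ball ?y0 \<delta>" for y'
        proof -
          have "norm (R y - R y') \<le> (1 + C1 * h) * norm (y - y')" by (rule Rlip[OF that])
          also have "\<dots> \<le> (1 + C * h) * norm (y - y')"
            using C h by (intro mult_right_mono add_left_mono) auto
          finally show ?thesis by (simp add: Ze_def lift_simps)
        qed
        fix z Z z1
        assume zy: "pos_mom z = y" and step: "rk_step H a b t h z Z z1" and z1: "z1 \<in> constraint_set H (t + h)"
          and near: "\<forall>i. Z i \<in> ball z0 \<rho>" "z1 \<in> ball z0 \<rho>"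
        have ZC: "Z j \<in> constraint_set H (?\<tau> j)" for j using step unfolding rk_step_iff by blast
        have Zf: "hamiltonian_field (?\<tau> j, Z j) = f (?\<tau> j, pos_mom (Z j))" for j
          by (rule field[OF \<tau>\<rho>(1) spec[OF near(1)] ZC, symmetric])
        note step' = step[unfolded rk_step_iff Zf zy]
        have "(\<lambda>i. pos_mom (Z i)) = S y"
        proof (rule uniq)
          show "stage_equations f a t h y (\<lambda>i. pos_mom (Z i))"
            using step' unfolding stage_equations_def by blast
          show "\<forall>i. pos_mom (Z i) \<in> ball ?y0 \<rho>1"
            using near(1) pm_ball(1) \<rho>(2) by (meson subset_ball subsetD)
        qed
        then have ZS: "pos_mom (Z i) = S y i" for i by (rule fun_cong)
        have "Z i = Zs y i" for i
          using sheet'[OF \<tau>\<rho>(1) spec[OF near(1)] ZC, of i] unfolding ZS Zs_def .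
        then show "Z = Zs y" by (rule ext)
        have "pos_mom z1 = R y"
          using step' unfolding ZS R_def rk_update_def by blast
        then show "z1 = Ze y"
          using sheet'[OF \<tau>\<rho>(2) near(2) z1] by (simp add: Ze_def)
      qed
      moreover have "?\<tau> i \<in> ball t0 \<epsilon>" for i using \<tau>(1)[of i] \<eta> by simp
      ultimately show ?thesis by blast
    qed
    with \<delta> \<eta> show ?thesis by (intro exI[of _ \<delta>]) auto
  qed
  have "ball t0 \<rho> \<times> ball ?y0 \<rho> \<subseteq> U" using in_U by blast
  then have "local_step_family a b t0 z0 U f \<rho> C"
    unfolding local_step_family_def using U(1) f \<rho>(1) C(1) field sheet_lip main
    by (intro conjI ballI allI impI) auto
  then show thesis by (rule that)
qed

end

section \<open>Existence and uniqueness of the integrator\<close>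

text \<open>A property of points and small parameters that holds locally uniformly holds uniformly on a compact set. Constants
  are treated by taking \<open>e\<close> both as a radius and as the reciprocal of the constant.\<close>
lemma compact_uniformly_small:
  fixes K :: "'a::metric_space set"
  assumes "compact K"
    and local: "\<And>x. x \<in> K \<Longrightarrow> \<exists>\<delta>>0. \<forall>x'\<in>K. dist x' x < \<delta> \<longrightarrow> (\<forall>e\<in>{0<..<\<delta>}. Q x' e)"
  shows "\<exists>\<delta>>0. \<forall>x\<in>K. \<forall>e\<in>{0<..<\<delta>}. Q x (e::real)"
proof -
  obtain d where d: "\<And>x. x \<in> K \<Longrightarrow> d x > 0"
    "\<And>x x' e. x \<in> K \<Longrightarrow> x' \<in> K \<Longrightarrow> dist x' x < d x \<Longrightarrow> e \<in> {0<..<d x} \<Longrightarrow> Q x' e"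
    using local by metis
  have "K \<subseteq> (\<Union>x\<in>K. ball x (d x))" using d(1) by fastforce
  then obtain X where X: "X \<subseteq> K" "finite X" "K \<subseteq> (\<Union>x\<in>X. ball x (d x))"
    using compactE_image[OF assms(1), of K "\<lambda>x. ball x (d x)"] by auto
  define \<delta> where "\<delta> = Min (insert 1 (d ` X))"
  have "\<delta> > 0" unfolding \<delta>_def using X d(1) by (subst Min_gr_iff) auto
  moreover have "\<delta> \<le> d x" if "x \<in> X" for x unfolding \<delta>_def using X(2) that by (intro Min_le) auto
  ultimately show ?thesis
  proof (intro exI[of _ \<delta>] conjI ballI)
    fix x e assume "x \<in> K" "e \<in> {0<..<\<delta>}"
    then obtain y where "y \<in> X" "dist x y < d y" using X(3) by (auto simp: dist_commute)
    then show "Q x e"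
      using d(2)[of y x e] X(1) \<open>x \<in> K\<close> \<open>e \<in> _\<close> \<open>\<And>x. x \<in> X \<Longrightarrow> \<delta> \<le> d x\<close> by force
  qed
qed

definition rk_solutions where
  "rk_solutions H a b t h z \<epsilon> = {(Z, z1). rk_step H a b t h z Z z1 \<and> z1 \<in> constraint_set H (t + h) \<and>
                      (\<forall>i. dist (Z i) z < \<epsilon>) \<and> dist z1 z < \<epsilon>}"

lemma rk_solutions_mono: "\<epsilon> \<le> \<epsilon>' \<Longrightarrow> rk_solutions H a b t h z \<epsilon> \<subseteq> rk_solutions H a b t h z \<epsilon>'"
  unfolding rk_solutions_def by (auto intro: less_le_trans)

lemma rk_solutions_singleton_unique:
  assumes "rk_solutions H a b t h z \<epsilon> = {(Z, z1)}" "rk_solutions H a b t h z \<epsilon>' = {(Z', z1')}"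
  shows "z1 = z1'"
proof (cases "\<epsilon> \<le> \<epsilon>'")
  case True
  then show ?thesis using rk_solutions_mono[OF True, of H a b t h z] assms by auto
next
  case False
  then have "\<epsilon>' \<le> \<epsilon>" by simp
  then show ?thesis using rk_solutions_mono[of \<epsilon>' \<epsilon> H a b t h z] assms by auto
qed

lemma ball_case_prod: "(\<forall>(t, z)\<in>K. P t z) \<longleftrightarrow> (\<forall>t z. (t, z) \<in> K \<longrightarrow> P t z)"
  by auto

lemma rk_integrator_iff:
  "rk_integrator H a b \<Phi> \<longleftrightarrow>
     (\<forall>K. compact K \<and> K \<subseteq> {(t, z). z \<in> constraint_set H t} \<longrightarrow>
        (\<exists>\<epsilon>>0. \<exists>h0>0. \<forall>t z. (t, z) \<in> K \<longrightarrow> (\<forall>h\<in>{0<..<h0}. \<exists>Z. rk_solutions H a b t h z \<epsilon> = {(Z, \<Phi> t h z)})))"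
  unfolding rk_integrator_def rk_solutions_def ball_case_prod ..

lemma step_maps_mono:
  assumes "step_maps H f a b t h z0 \<delta> \<epsilon> \<rho> C Zs Ze" "\<delta>' \<le> \<delta>" "\<epsilon> \<le> \<epsilon>'"
  shows "step_maps H f a b t h z0 \<delta>' \<epsilon>' \<rho> C Zs Ze"
  using assms subset_ball[OF assms(2), of "pos_mom z0"] subset_ball[OF assms(3), of z0]
  unfolding step_maps_def by blast

lemma pos_mom_in_ball: "z \<in> ball z0 r \<Longrightarrow> pos_mom z \<in> ball (pos_mom z0) r"
  using dist_pos_mom_le[of z0 z] by simp

lemma step_mapsD:
  assumes "step_maps H f a b t h z0 \<delta> \<epsilon> \<rho> C Zs Ze" "z \<in> ball z0 \<delta>"
  shows "rk_step H a b t h z (Zs (pos_mom z)) (Ze (pos_mom z))"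
    "ode_rk_step f a b t h (pos_mom z) (\<lambda>i. pos_mom (Zs (pos_mom z) i)) (pos_mom (Ze (pos_mom z)))"
    "Zs (pos_mom z) i \<in> ball z0 \<epsilon>" "Ze (pos_mom z) \<in> ball z0 \<epsilon>" "Ze (pos_mom z) \<in> constraint_set H (t + h)"
    "rk_step H a b t h z Z z1 \<Longrightarrow> z1 \<in> constraint_set H (t + h) \<Longrightarrow> (\<And>i. Z i \<in> ball z0 \<rho>) \<Longrightarrow>
       z1 \<in> ball z0 \<rho> \<Longrightarrow> Z = Zs (pos_mom z) \<and> z1 = Ze (pos_mom z)"
    "(\<lambda>y. Zs y i) differentiable (at (pos_mom z))" "Ze differentiable (at (pos_mom z))"
    "z' \<in> ball z0 \<delta> \<Longrightarrow> norm (pos_mom (Ze (pos_mom z)) - pos_mom (Ze (pos_mom z'))) \<le> (1 + C * h) * norm (pos_mom z - pos_mom z')"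
  using bspec[OF assms(1)[unfolded step_maps_def] pos_mom_in_ball[OF assms(2)]] pos_mom_in_ball[of z' z0 \<delta>] by blast+

lemma step_maps_in_rk_solutions:
  assumes "step_maps H f a b t h z0 \<delta> \<epsilon> \<rho> C Zs Ze" "z \<in> ball z0 \<delta>" "\<epsilon> + \<delta> \<le> r"
  shows "(Zs (pos_mom z), Ze (pos_mom z)) \<in> rk_solutions H a b t h z r"
proof -
  have "dist x z < r" if "x \<in> ball z0 \<epsilon>" for x
    using that assms(2,3) dist_triangle[of x z z0] by (simp add: dist_commute)
  then show ?thesis
    unfolding rk_solutions_def using step_mapsD(1,3,4,5)[OF assms(1,2)] by simp
qed

context regular_hamiltonian
begin

lemma closed_constraint_graph: "closed {(t, z). z \<in> constraint_set H t}"
proof -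
  have "continuous_on UNIV (\<lambda>x. multiplier (gradH x))"
    by (rule bounded_linear.continuous_on[OF bounded_linear_multiplier smooth_on_continuous_on[OF smooth_gradH]])
  then have "closed {x. multiplier (gradH x) = 0}"
    by (intro closed_Collect_eq continuous_on_const)
  moreover have "{(t, z). z \<in> constraint_set H t} = {x. multiplier (gradH x) = 0}"
    by (auto simp: constraint_set_iff)
  ultimately show ?thesis by simp
qed

lemma local_step_familyD:
  assumes "local_step_family a b t0 z0 U f \<rho> C" "0 < \<epsilon>" "\<epsilon> \<le> \<rho>"
  shows "\<exists>\<delta>>0. \<delta> \<le> \<epsilon> \<and> (\<forall>t\<in>ball t0 \<delta>. \<forall>h\<in>{0<..<\<delta>}.
       (\<forall>i. t + abscissa a i * h \<in> ball t0 \<epsilon>) \<and> (\<exists>Zs Ze. step_maps H f a b t h z0 \<delta> \<epsilon> \<rho> C Zs Ze))"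
  using assms unfolding local_step_family_def by blast

text \<open>Locally, any solution within \<open>\<rho>\<close> of the reference point is the one given by the step maps.\<close>
lemma rk_solutions_unique:
  assumes K: "compact K" "K \<subseteq> {(t, z). z \<in> constraint_set H t}"
  shows "\<exists>\<epsilon>>0. \<exists>h0>0. \<forall>t z. (t, z) \<in> K \<longrightarrow> (\<forall>h\<in>{0<..<h0}. \<forall>x y.
    x \<in> rk_solutions H a b t h z \<epsilon> \<longrightarrow> y \<in> rk_solutions H a b t h z \<epsilon> \<longrightarrow> x = y)"
proof -
  let ?Q = "\<lambda>x e. \<forall>h\<in>{0<..<e}. \<forall>p q. p \<in> rk_solutions H a b (fst x) h (snd x) e \<longrightarrow>
    q \<in> rk_solutions H a b (fst x) h (snd x) e \<longrightarrow> p = q"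
  have "\<exists>\<delta>>0. \<forall>x\<in>K. \<forall>e\<in>{0<..<\<delta>}. ?Q x e"
  proof (rule compact_uniformly_small[OF K(1)])
    fix x0 assume "x0 \<in> K"
    then obtain t0 z0 where x0: "x0 = (t0, z0)" and z0: "z0 \<in> constraint_set H t0" using K(2) by auto
    obtain U f \<rho> C where fam: "local_step_family a b t0 z0 U f \<rho> C"
      by (rule local_step_family_exists[OF z0])
    then have \<rho>: "\<rho> > 0" by (simp add: local_step_family_def)
    obtain \<delta> where \<delta>: "\<delta> > 0" and maps: "\<And>t h. t \<in> ball t0 \<delta> \<Longrightarrow> h \<in> {0<..<\<delta>} \<Longrightarrow>
       \<exists>Zs Ze. step_maps H f a b t h z0 \<delta> \<rho> \<rho> C Zs Ze"
      using local_step_familyD[OF fam \<rho> order_refl] by blast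
    have main: "?Q x e" if near: "dist x x0 < min \<delta> (\<rho>/2)" and e: "e \<in> {0<..<min \<delta> (\<rho>/2)}" for x e
    proof -
      obtain t z where x: "x = (t, z)" and t: "t \<in> ball t0 \<delta>" and z: "z \<in> ball z0 \<delta>" "dist z z0 < \<rho>/2"
        using near dist_fst_le[of x x0] dist_snd_le[of x x0] by (cases x) (auto simp: x0 dist_commute)
      have "p = q" if h: "h \<in> {0<..<e}" and p: "p \<in> rk_solutions H a b t h z e" and q: "q \<in> rk_solutions H a b t h z e" for h p q
      proof -
        have "h \<in> {0<..<\<delta>}" using h e by auto
        then obtain Zs Ze where sm: "step_maps H f a b t h z0 \<delta> \<rho> \<rho> C Zs Ze"
          using maps t by blast
        have "r = (Zs (pos_mom z), Ze (pos_mom z))" if r: "r \<in> rk_solutions H a b t h z e" for r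
        proof -
          have "u \<in> ball z0 \<rho>" if "dist u z < e" for u
            using that e z(2) dist_triangle[of u z0 z] by (simp add: dist_commute)
          then show ?thesis
            using r step_mapsD(6)[OF sm z(1), of "fst r" "snd r"] unfolding rk_solutions_def by (cases r) auto
        qed
        then show ?thesis using p q by metis
      qed
      then show ?thesis unfolding x fst_conv snd_conv by blast
    qed
    have pos: "0 < min \<delta> (\<rho>/2)" using \<delta> \<rho> by simp
    show "\<exists>\<delta>>0. \<forall>x\<in>K. dist x x0 < \<delta> \<longrightarrow> (\<forall>e\<in>{0<..<\<delta>}. ?Q x e)"
      by (rule exI[of _ "min \<delta> (\<rho>/2)"], rule conjI[OF pos], rule ballI, rule impI, rule ballI, rule main)
  qed
  then obtain \<delta> where \<delta>: "\<delta> > 0" and Q: "\<forall>x\<in>K. \<forall>e\<in>{0<..<\<delta>}. ?Q x e"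
    by (elim exE conjE)
  have half: "\<delta>/2 \<in> {0<..<\<delta>}" "0 < \<delta>/2" using \<delta> by simp_all
  have "?Q (t, z) (\<delta>/2)" if "(t, z) \<in> K" for t z
    by (rule bspec[OF bspec[OF Q that] half(1)])
  then show ?thesis
    unfolding fst_conv snd_conv by (intro exI[of _ "\<delta>/2"] conjI half allI impI)
qed

lemma rk_solutions_nonempty:
  assumes K: "compact K" "K \<subseteq> {(t, z). z \<in> constraint_set H t}" and r: "r > 0"
  shows "\<exists>h0>0. \<forall>t z. (t, z) \<in> K \<longrightarrow> (\<forall>h\<in>{0<..<h0}. rk_solutions H a b t h z r \<noteq> {})"
proof -
  have "\<exists>\<delta>>0. \<forall>x\<in>K. \<forall>h\<in>{0<..<\<delta>}. rk_solutions H a b (fst x) h (snd x) r \<noteq> {}"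
  proof (rule compact_uniformly_small[OF K(1)])
    fix x0 assume "x0 \<in> K"
    then obtain t0 z0 where x0: "x0 = (t0, z0)" and z0: "z0 \<in> constraint_set H t0" using K(2) by auto
    obtain U f \<rho> C where fam: "local_step_family a b t0 z0 U f \<rho> C"
      by (rule local_step_family_exists[OF z0])
    then have \<rho>: "\<rho> > 0" by (simp add: local_step_family_def)
    define \<epsilon> where "\<epsilon> = min \<rho> (r/2)"
    have \<epsilon>: "0 < \<epsilon>" "\<epsilon> \<le> \<rho>" "\<epsilon> \<le> r/2" using \<rho> r by (auto simp: \<epsilon>_def)
    obtain \<delta> where \<delta>: "\<delta> > 0" "\<delta> \<le> \<epsilon>" and maps: "\<And>t h. t \<in> ball t0 \<delta> \<Longrightarrow> h \<in> {0<..<\<delta>} \<Longrightarrow>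
       \<exists>Zs Ze. step_maps H f a b t h z0 \<delta> \<epsilon> \<rho> C Zs Ze"
      using local_step_familyD[OF fam \<epsilon>(1,2)] by blast
    show "\<exists>\<delta>>0. \<forall>x\<in>K. dist x x0 < \<delta> \<longrightarrow> (\<forall>h\<in>{0<..<\<delta>}. rk_solutions H a b (fst x) h (snd x) r \<noteq> {})"
    proof (intro exI[of _ \<delta>] conjI ballI impI)
      fix x h assume x: "dist x x0 < \<delta>" and h: "h \<in> {0<..<\<delta>}"
      then have t: "fst x \<in> ball t0 \<delta>" and z: "snd x \<in> ball z0 \<delta>"
        using dist_fst_le[of x x0] dist_snd_le[of x x0] by (auto simp: x0 dist_commute)
      obtain Zs Ze where "step_maps H f a b (fst x) h z0 \<delta> \<epsilon> \<rho> C Zs Ze"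
        using maps[OF t h] by blast
      from step_maps_in_rk_solutions[OF this z, of r] \<delta> \<epsilon>
      show "rk_solutions H a b (fst x) h (snd x) r \<noteq> {}" by auto
    qed (rule \<delta>(1))
  qed
  then show ?thesis by fastforce
qed

text \<open>Small balls contain exactly one solution. Which ball is used does not matter since the solution sets are nested,
  so that one map \<open>\<Phi>\<close> serves all compact sets at once.\<close>
lemma rk_integrator_exists:
  shows "\<exists>\<Phi>. rk_integrator H a b \<Phi>"
proof
  define \<Phi> where "\<Phi> t h z = (THE z1. \<exists>\<epsilon> Z. rk_solutions H a b t h z \<epsilon> = {(Z, z1)})" for t h z
  have \<Phi>_eq: "\<Phi> t h z = z1" if "rk_solutions H a b t h z \<epsilon> = {(Z, z1)}" for t h z \<epsilon> Z z1
    unfolding \<Phi>_def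
  proof (rule the_equality)
    show "\<exists>\<epsilon> Z. rk_solutions H a b t h z \<epsilon> = {(Z, z1)}" using that by (intro exI)
    show "z1' = z1" if "\<exists>\<epsilon> Z. rk_solutions H a b t h z \<epsilon> = {(Z, z1')}" for z1'
      using that \<open>rk_solutions H a b t h z \<epsilon> = {(Z, z1)}\<close> by (elim exE) (rule rk_solutions_singleton_unique)
  qed
  show "rk_integrator H a b \<Phi>"
    unfolding rk_integrator_iff
  proof (intro allI impI)
    fix K assume K: "compact K \<and> K \<subseteq> {(t, z). z \<in> constraint_set H t}"
    obtain \<epsilon> h0 where \<epsilon>: "\<epsilon> > 0" "h0 > 0" and uniq: "\<forall>t z. (t, z) \<in> K \<longrightarrow> (\<forall>h\<in>{0<..<h0}. \<forall>x y.
      x \<in> rk_solutions H a b t h z \<epsilon> \<longrightarrow> y \<in> rk_solutions H a b t h z \<epsilon> \<longrightarrow> x = y)"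
      using rk_solutions_unique[OF conjunct1[OF K] conjunct2[OF K], of a b] by (elim exE conjE)
    obtain h1 where h1: "h1 > 0" and ex: "\<forall>t z. (t, z) \<in> K \<longrightarrow> (\<forall>h\<in>{0<..<h1}. rk_solutions H a b t h z \<epsilon> \<noteq> {})"
      using rk_solutions_nonempty[OF conjunct1[OF K] conjunct2[OF K] \<epsilon>(1), of a b] by (elim exE conjE)
    have "\<exists>Z. rk_solutions H a b t h z \<epsilon> = {(Z, \<Phi> t h z)}"
      if K': "(t, z) \<in> K" and h: "h \<in> {0<..<min h0 h1}" for t z h
    proof -
      have h': "h \<in> {0<..<h0}" "h \<in> {0<..<h1}" using h by auto
      obtain Z z1 where sol: "(Z, z1) \<in> rk_solutions H a b t h z \<epsilon>" using ex K' h'(2) by fastforce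
      have "rk_solutions H a b t h z \<epsilon> = {(Z, z1)}"
        using sol uniq[rule_format, OF K' h'(1) _ sol] by blast
      with \<Phi>_eq[OF this] show ?thesis by blast
    qed
    then show "\<exists>\<epsilon>>0. \<exists>h0>0. \<forall>t z. (t, z) \<in> K \<longrightarrow> (\<forall>h\<in>{0<..<h0}. \<exists>Z. rk_solutions H a b t h z \<epsilon> = {(Z, \<Phi> t h z)})"
      using \<epsilon> h1 by (intro exI[of _ \<epsilon>] conjI exI[of _ "min h0 h1"] allI impI ballI) simp_all
  qed
qed

text \<open>An arbitrary integrator is only known on compact subsets of the constraint graph. A compact neighbourhood of the
  point in this closed graph provides a radius within which its value is the unique solution; the step maps
  give a solution within this radius.\<close>
lemma rk_integrator_follows_steps:
  assumes \<Phi>: "rk_integrator H a b \<Phi>" and fam: "local_step_family a b t0 z0 U f \<rho> C" and \<epsilon>: "0 < \<epsilon>" "\<epsilon> \<le> \<rho>"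
  shows "\<exists>\<delta>>0. \<delta> \<le> \<epsilon> \<and> (\<forall>t\<in>ball t0 \<delta>. \<forall>h\<in>{0<..<\<delta>}.
       (\<forall>i. t + abscissa a i * h \<in> ball t0 \<epsilon>) \<and> (\<exists>Zs Ze. step_maps H f a b t h z0 \<delta> \<epsilon> \<rho> C Zs Ze \<and>
          (\<forall>z\<in>constraint_set H t \<inter> ball z0 \<delta>. \<Phi> t h z = Ze (pos_mom z))))"
proof -
  define K where "K = {(t, z). z \<in> constraint_set H t} \<inter> cball (t0, z0) 1"
  have "compact K" unfolding K_def by (intro closed_Int_compact closed_constraint_graph compact_cball)
  moreover have "K \<subseteq> {(t, z). z \<in> constraint_set H t}" unfolding K_def by blast
  ultimately have "compact K \<and> K \<subseteq> {(t, z). z \<in> constraint_set H t}" by (rule conjI)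
  note \<Phi>[unfolded rk_integrator_iff, rule_format, OF this]
  then obtain r h0 where r: "r > 0" "h0 > 0" and \<Phi>K: "\<forall>t z. (t, z) \<in> K \<longrightarrow> (\<forall>h\<in>{0<..<h0}.
      \<exists>Z. rk_solutions H a b t h z r = {(Z, \<Phi> t h z)})"
    by (elim exE conjE)
    define \<epsilon>' where "\<epsilon>' = min \<epsilon> (r/2)"
    have \<epsilon>': "0 < \<epsilon>'" "\<epsilon>' \<le> \<rho>" "\<epsilon>' \<le> r/2" "\<epsilon>' \<le> \<epsilon>" using \<epsilon> r by (auto simp: \<epsilon>'_def)
    obtain \<delta>1 where \<delta>1: "\<delta>1 > 0" "\<delta>1 \<le> \<epsilon>'" and maps: "\<And>t h. t \<in> ball t0 \<delta>1 \<Longrightarrow> h \<in> {0<..<\<delta>1} \<Longrightarrow>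
       (\<forall>i. t + abscissa a i * h \<in> ball t0 \<epsilon>') \<and> (\<exists>Zs Ze. step_maps H f a b t h z0 \<delta>1 \<epsilon>' \<rho> C Zs Ze)"
      using local_step_familyD[OF fam \<epsilon>'(1,2)] by blast
    define \<delta> where "\<delta> = min \<delta>1 (min h0 (1/2))"
    have \<delta>: "\<delta> > 0" "\<delta> \<le> \<delta>1" "\<delta> \<le> h0" "\<delta> \<le> 1/2" using \<delta>1 r by (auto simp: \<delta>_def)
    have "(\<forall>i. t + abscissa a i * h \<in> ball t0 \<epsilon>) \<and> (\<exists>Zs Ze. step_maps H f a b t h z0 \<delta> \<epsilon> \<rho> C Zs Ze \<and>
          (\<forall>z\<in>constraint_set H t \<inter> ball z0 \<delta>. \<Phi> t h z = Ze (pos_mom z)))"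
      if t: "t \<in> ball t0 \<delta>" and h: "h \<in> {0<..<\<delta>}" for t h
    proof -
      have t1: "t \<in> ball t0 \<delta>1" and h1: "h \<in> {0<..<\<delta>1}" and h0: "h \<in> {0<..<h0}" using t h \<delta> by auto
      obtain Zs Ze where sm: "step_maps H f a b t h z0 \<delta>1 \<epsilon>' \<rho> C Zs Ze"
        using maps[OF t1 h1] by blast
      have "\<Phi> t h z = Ze (pos_mom z)" if z: "z \<in> constraint_set H t" "z \<in> ball z0 \<delta>" for z
      proof -
        have "(t, z) \<in> K"
          unfolding K_def using z t \<delta>(4) dist_Pair_le[of t0 z0 t z] by simp
        then obtain Z where Z: "rk_solutions H a b t h z r = {(Z, \<Phi> t h z)}"
          using \<Phi>K[rule_format, OF _ h0] by blast
        have "(Zs (pos_mom z), Ze (pos_mom z)) \<in> rk_solutions H a b t h z r"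
          using z \<delta> \<delta>1 \<epsilon>' by (intro step_maps_in_rk_solutions[OF sm]) auto
        then show ?thesis unfolding Z by simp
      qed
      moreover have "step_maps H f a b t h z0 \<delta> \<epsilon> \<rho> C Zs Ze"
        by (rule step_maps_mono[OF sm \<delta>(2) \<epsilon>'(4)])
      moreover have "t + abscissa a i * h \<in> ball t0 \<epsilon>" for i
        using maps[OF t1 h1] subset_ball[OF \<epsilon>'(4)] by blast
      ultimately show ?thesis by blast
    qed
    then show ?thesis using \<delta> \<delta>1 \<epsilon>' by (intro exI[of _ \<delta>]) auto
qed

lemma rk_integrator_constraint_preserving:
  assumes "rk_integrator H a b \<Phi>"
  shows "constraint_preserving H \<Phi>"
  unfolding constraint_preserving_def for_small_steps_def
proof (intro allI impI)
  fix K assume K: "compact K \<and> K \<subseteq> {(t, z). z \<in> constraint_set H t}"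
  obtain \<epsilon> h0 where h0: "h0 > 0" and sol: "\<forall>t z. (t, z) \<in> K \<longrightarrow> (\<forall>h\<in>{0<..<h0}.
      \<exists>Z. rk_solutions H a b t h z \<epsilon> = {(Z, \<Phi> t h z)})"
    using assms[unfolded rk_integrator_iff, rule_format, OF K] by (elim exE conjE)
  have "\<Phi> t h z \<in> constraint_set H (t + h)" if tz: "(t, z) \<in> K" "h \<in> {0<..<h0}" for t z h
  proof -
    obtain Z where "rk_solutions H a b t h z \<epsilon> = {(Z, \<Phi> t h z)}"
      using sol[rule_format, OF tz] by (elim exE)
    then have "(Z, \<Phi> t h z) \<in> rk_solutions H a b t h z \<epsilon>" by simp
    then show ?thesis by (simp add: rk_solutions_def)
  qed
  then show "\<exists>h0>0. \<forall>(t, z)\<in>K. \<forall>h\<in>{0<..<h0}. \<Phi> t h z \<in> constraint_set H (t + h)"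
    unfolding ball_case_prod using h0 by (intro exI[of _ h0] conjI allI impI ballI)
qed

end

section \<open>Symplecticity\<close>

text \<open>Expanding \<open>\<sigma> x x'\<close> and replacing \<open>u\<close> and \<open>u'\<close> in the mixed terms by means of the stage equations leaves, besides
  terms that cancel by the invariance assumption, the sum of \<open>(b\<^sub>i b\<^sub>j - b\<^sub>j a\<^sub>j\<^sub>i - b\<^sub>i a\<^sub>i\<^sub>j) \<sigma> (F i) (F' j)\<close>.\<close>
lemma symplectic_rk_preserves_bilinear:
  fixes \<sigma> :: "'v::real_normed_vector \<Rightarrow> 'v \<Rightarrow> real" and X X' F F' :: "'s::finite \<Rightarrow> 'v"
  assumes \<sigma>: "bounded_bilinear \<sigma>" and ab: "symplectic_rk a b"
    and X: "\<And>i. X i = u + h *\<^sub>R (\<Sum>j\<in>UNIV. a i j *\<^sub>R F j)" "\<And>i. X' i = u' + h *\<^sub>R (\<Sum>j\<in>UNIV. a i j *\<^sub>R F' j)"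
    and x: "x = u + h *\<^sub>R (\<Sum>j\<in>UNIV. b j *\<^sub>R F j)" "x' = u' + h *\<^sub>R (\<Sum>j\<in>UNIV. b j *\<^sub>R F' j)"
    and inv: "\<And>i. \<sigma> (X i) (F' i) + \<sigma> (F i) (X' i) = 0"
  shows "\<sigma> x x' = \<sigma> u u'"
proof -
  interpret \<sigma>: bounded_bilinear \<sigma> by fact
  have stage: "\<sigma> u (F' i) + \<sigma> (F i) u' = - (h * (\<Sum>j\<in>UNIV. a i j * \<sigma> (F j) (F' i)) + h * (\<Sum>j\<in>UNIV. a i j * \<sigma> (F i) (F' j)))" for i
    using inv[of i] unfolding X
    by (simp add: \<sigma>.add_left \<sigma>.add_right \<sigma>.scaleR_left \<sigma>.scaleR_right \<sigma>.sum_left \<sigma>.sum_right)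
  have double: "\<sigma> (\<Sum>i\<in>UNIV. b i *\<^sub>R F i) (\<Sum>j\<in>UNIV. b j *\<^sub>R F' j) = (\<Sum>i\<in>UNIV. \<Sum>j\<in>UNIV. b i * b j * \<sigma> (F i) (F' j))"
  proof -
    have "\<sigma> (\<Sum>i\<in>UNIV. b i *\<^sub>R F i) (\<Sum>j\<in>UNIV. b j *\<^sub>R F' j) = (\<Sum>i\<in>UNIV. \<sigma> (b i *\<^sub>R F i) (\<Sum>j\<in>UNIV. b j *\<^sub>R F' j))"
      by (rule \<sigma>.sum_left)
    also have "\<dots> = (\<Sum>i\<in>UNIV. \<Sum>j\<in>UNIV. b i * b j * \<sigma> (F i) (F' j))"
      by (simp add: \<sigma>.scaleR_left \<sigma>.scaleR_right \<sigma>.sum_right sum_distrib_left mult_ac)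
    finally show ?thesis .
  qed
  have single: "\<sigma> u (\<Sum>j\<in>UNIV. b j *\<^sub>R F' j) = (\<Sum>i\<in>UNIV. b i * \<sigma> u (F' i))"
    "\<sigma> (\<Sum>i\<in>UNIV. b i *\<^sub>R F i) u' = (\<Sum>i\<in>UNIV. b i * \<sigma> (F i) u')"
    by (simp_all add: \<sigma>.scaleR_left \<sigma>.scaleR_right \<sigma>.sum_right \<sigma>.sum_left)
  have "\<sigma> x x' = \<sigma> u u' + h * (\<Sum>i\<in>UNIV. b i * (\<sigma> u (F' i) + \<sigma> (F i) u'))
      + h * (h * (\<Sum>i\<in>UNIV. \<Sum>j\<in>UNIV. b i * b j * \<sigma> (F i) (F' j)))"
    unfolding x
    by (simp add: \<sigma>.add_left \<sigma>.add_right \<sigma>.scaleR_left \<sigma>.scaleR_right double single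
        sum.distrib distrib_left)
  also have "(\<Sum>i\<in>UNIV. b i * (\<sigma> u (F' i) + \<sigma> (F i) u')) =
      - (h * ((\<Sum>i\<in>UNIV. \<Sum>j\<in>UNIV. b i * a i j * \<sigma> (F j) (F' i)) + (\<Sum>i\<in>UNIV. \<Sum>j\<in>UNIV. b i * a i j * \<sigma> (F i) (F' j))))"
    unfolding stage by (simp add: sum_negf[symmetric] sum.distrib[symmetric] sum_distrib_left algebra_simps)
  also have "(\<Sum>i\<in>UNIV. \<Sum>j\<in>UNIV. b i * a i j * \<sigma> (F j) (F' i)) = (\<Sum>i\<in>UNIV. \<Sum>j\<in>UNIV. b j * a j i * \<sigma> (F i) (F' j))"
    by (rule sum.swap)
  finally have "\<sigma> x x' = \<sigma> u u' + h * (h * ((\<Sum>i\<in>UNIV. \<Sum>j\<in>UNIV. b i * b j * \<sigma> (F i) (F' j))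
      - (\<Sum>i\<in>UNIV. \<Sum>j\<in>UNIV. b j * a j i * \<sigma> (F i) (F' j)) - (\<Sum>i\<in>UNIV. \<Sum>j\<in>UNIV. b i * a i j * \<sigma> (F i) (F' j))))"
    by (simp add: algebra_simps)
  also have "(\<Sum>i\<in>UNIV. \<Sum>j\<in>UNIV. b i * b j * \<sigma> (F i) (F' j))
      - (\<Sum>i\<in>UNIV. \<Sum>j\<in>UNIV. b j * a j i * \<sigma> (F i) (F' j)) - (\<Sum>i\<in>UNIV. \<Sum>j\<in>UNIV. b i * a i j * \<sigma> (F i) (F' j))
      = (\<Sum>i\<in>UNIV. \<Sum>j\<in>UNIV. (b i * b j - b j * a j i - b i * a i j) * \<sigma> (F i) (F' j))"
    by (simp add: sum_subtractf left_diff_distrib)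
  finally show ?thesis using ab unfolding symplectic_rk_def by simp
qed

definition canonical_form :: "(real^'n) \<times> (real^'n) \<Rightarrow> (real^'n) \<times> (real^'n) \<Rightarrow> real" where
  "canonical_form y y' = fst y \<bullet> snd y' - snd y \<bullet> fst y'"

lemma bounded_bilinear_canonical_form: "bounded_bilinear canonical_form"
proof -
  have "bilinear (canonical_form :: (real^'n) \<times> (real^'n) \<Rightarrow> _)"
    unfolding bilinear_def canonical_form_def
    by (intro conjI allI linearI) (simp_all add: inner_add_left inner_add_right algebra_simps)
  then show ?thesis by (simp add: bilinear_conv_bounded_bilinear)
qed

lemma omega_eq_canonical_form: "omega u w = canonical_form (pos_mom u) (pos_mom w)"
  by (cases u; cases w) (simp add: canonical_form_def pos_mom_def inner_commute)

context regular_hamiltonian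
begin

text \<open>The step maps are defined for all phase points near \<open>z0\<close>, on the constraint set or not, so the Runge--Kutta
  equations can be differentiated without restriction to tangent vectors. The invariance condition is the
  symmetry of the Hessian of \<open>H\<close>.\<close>
lemma step_maps_symplectic:
  fixes a :: "'s::finite \<Rightarrow> 's \<Rightarrow> real" and b :: "'s \<Rightarrow> real"
  assumes ab: "symplectic_rk a b" and sm: "step_maps H f a b t h z0 \<delta> \<epsilon> \<rho> C Zs Ze" and z: "z \<in> ball z0 \<delta>"
  obtains D where "((\<lambda>z. Ze (pos_mom z)) has_derivative D) (at z)" "\<And>u w. omega (D u) (D w) = omega u w"
proof -
  let ?\<tau> = "\<lambda>i. t + abscissa a i * h"
  have comp: "(\<lambda>z. g (pos_mom z)) differentiable (at z)" if "g differentiable (at (pos_mom z))"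
    for g :: "(real^'n) \<times> (real^'n) \<Rightarrow> ('n, 'k) phase"
    by (rule differentiable_compose[OF that bounded_linear_imp_differentiable[OF bounded_linear_pos_mom]])
  obtain D where D: "((\<lambda>z. Ze (pos_mom z)) has_derivative D) (at z)"
    using comp[OF step_mapsD(8)[OF sm z]] unfolding differentiable_def by blast
  have "\<exists>X. ((\<lambda>z. Zs (pos_mom z) i) has_derivative X) (at z)" for i
    using comp[OF step_mapsD(7)[OF sm z]] unfolding differentiable_def by blast
  then obtain X where X: "\<And>i. ((\<lambda>z. Zs (pos_mom z) i) has_derivative X i) (at z)" by metis
  define N where "N i u = frechet_derivative gradH (at (?\<tau> i, Zs (pos_mom z) i)) (0, u)" for i u
  have grad: "((\<lambda>z. gradH (?\<tau> i, Zs (pos_mom z) i)) has_derivative (\<lambda>u. N i (X i u))) (at z)" for i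
  proof -
    have "(gradH has_derivative frechet_derivative gradH (at (?\<tau> i, Zs (pos_mom z) i))) (at (?\<tau> i, Zs (pos_mom z) i))"
      by (rule smooth_on_has_derivative[OF smooth_gradH UNIV_I])
    from has_derivative_compose[OF has_derivative_Pair[OF has_derivative_const X[of i]] this]
    show ?thesis unfolding N_def .
  qed
  have step: "rk_step H a b t h z' (Zs (pos_mom z')) (Ze (pos_mom z'))" if "z' \<in> ball z0 \<delta>" for z'
    by (rule step_mapsD(1)[OF sm that])
  have deriv_eq: "f' = g'" if "(f has_derivative f') (at z)" "(g has_derivative g') (at z)" "\<And>z'. z' \<in> ball z0 \<delta> \<Longrightarrow> f z' = g z'"
    for f g :: "('n, 'k) phase \<Rightarrow> 'v::real_normed_vector" and f' g'
    using has_derivative_transform_within_open[OF that(1) open_ball z that(3)] that(2) has_derivative_unique by blast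
  have mult0: "multiplier (N i (X i u)) = 0" for i u
  proof -
    have "(\<lambda>u. multiplier (N i (X i u))) = (\<lambda>u. 0)"
    proof (rule deriv_eq)
      show "((\<lambda>z. multiplier (gradH (?\<tau> i, Zs (pos_mom z) i))) has_derivative (\<lambda>u. multiplier (N i (X i u)))) (at z)"
        by (rule bounded_linear.has_derivative[OF bounded_linear_multiplier grad])
      show "multiplier (gradH (?\<tau> i, Zs (pos_mom z') i)) = 0" if "z' \<in> ball z0 \<delta>" for z'
        using step[OF that] unfolding rk_step_iff by (simp add: constraint_set_iff)
    qed (rule has_derivative_const)
    then show ?thesis by (rule fun_cong)
  qed
  define F where "F i u = (fst (snd (N i (X i u))), - fst (N i (X i u)))" for i u
  have field: "((\<lambda>z. hamiltonian_field (?\<tau> i, Zs (pos_mom z) i)) has_derivative F i) (at z)" for i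
    unfolding hamiltonian_field_def F_def[abs_def]
    by (intro has_derivative_Pair has_derivative_minus has_derivative_fst has_derivative_snd grad)
  have rhs: "((\<lambda>z. pos_mom z + h *\<^sub>R (\<Sum>j\<in>UNIV. c j *\<^sub>R hamiltonian_field (?\<tau> j, Zs (pos_mom z) j)))
      has_derivative (\<lambda>u. pos_mom u + h *\<^sub>R (\<Sum>j\<in>UNIV. c j *\<^sub>R F j u))) (at z)" for c :: "'s \<Rightarrow> real"
    by (intro has_derivative_add has_derivative_scaleR_right has_derivative_sum field
        bounded_linear_imp_has_derivative[OF bounded_linear_pos_mom])
  have stage_lin: "pos_mom (X i u) = pos_mom u + h *\<^sub>R (\<Sum>j\<in>UNIV. a i j *\<^sub>R F j u)" for i u
  proof -
    have "(\<lambda>u. pos_mom (X i u)) = (\<lambda>u. pos_mom u + h *\<^sub>R (\<Sum>j\<in>UNIV. a i j *\<^sub>R F j u))"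
      using step unfolding rk_step_iff
      by (intro deriv_eq[OF bounded_linear.has_derivative[OF bounded_linear_pos_mom X] rhs]) blast
    then show ?thesis by (rule fun_cong)
  qed
  have end_lin: "pos_mom (D u) = pos_mom u + h *\<^sub>R (\<Sum>j\<in>UNIV. b j *\<^sub>R F j u)" for u
  proof -
    have "(\<lambda>u. pos_mom (D u)) = (\<lambda>u. pos_mom u + h *\<^sub>R (\<Sum>j\<in>UNIV. b j *\<^sub>R F j u))"
      using step unfolding rk_step_iff
      by (intro deriv_eq[OF bounded_linear.has_derivative[OF bounded_linear_pos_mom D] rhs]) blast
    then show ?thesis by (rule fun_cong)
  qed
  have inv: "canonical_form (pos_mom (X i u)) (F i w) + canonical_form (F i u) (pos_mom (X i w)) = 0" for i u w
  proof -
    have JF: "x \<bullet> N i (X i v) = - canonical_form (pos_mom x) (F i v)" for x v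
    proof -
      have "Jmap (phase_point (F i v) 0) = N i (X i v)"
        using mult0[of i v] by (simp add: Jmap_eq F_def prod_eq_iff multiplier_def)
      then show ?thesis
        using omega_eq[of x "phase_point (F i v) 0"] omega_eq_canonical_form[of x "phase_point (F i v) 0"] by simp
    qed
    have "X i u \<bullet> N i (X i w) = X i w \<bullet> N i (X i u)"
      unfolding N_def by (rule hessian_symmetric)
    moreover have "canonical_form (F i u) (pos_mom (X i w)) = - canonical_form (pos_mom (X i w)) (F i u)"
      by (simp add: canonical_form_def inner_commute)
    ultimately show ?thesis unfolding JF by simp
  qed
  have "omega (D u) (D w) = omega u w" for u w
    unfolding omega_eq_canonical_form
    by (rule symplectic_rk_preserves_bilinear[OF bounded_bilinear_canonical_form ab stage_lin stage_lin end_lin end_lin inv])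
  with D show thesis by (rule that)
qed

text \<open>On the constraint set the integrator agrees locally with a map whose derivative preserves \<open>dq \<and> dp\<close> for all vectors. Derivatives within
  the constraint set need not be unique, but on tangent vectors all of them are the derivative along a curve in the
  constraint set.\<close>
lemma rk_integrator_symplectic:
  assumes ab: "symplectic_rk a b" and \<Phi>: "rk_integrator H a b \<Phi>"
  shows "symplectic_integrator H \<Phi>"
  unfolding symplectic_integrator_def for_small_steps_def
proof (intro allI impI)
  fix K assume K: "compact K \<and> K \<subseteq> {(t, z). z \<in> constraint_set H t}"
  let ?P = "\<lambda>t h z. \<Phi> t h differentiable (at z within constraint_set H t) \<and>
       (\<forall>D. (\<Phi> t h has_derivative D) (at z within constraint_set H t) \<longrightarrow>
          (\<forall>u\<in>tangent_vectors (constraint_set H t) z.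
           \<forall>w\<in>tangent_vectors (constraint_set H t) z. omega (D u) (D w) = omega u w))"
  have "\<exists>\<delta>>0. \<forall>x\<in>K. \<forall>h\<in>{0<..<\<delta>}. ?P (fst x) h (snd x)"
  proof (rule compact_uniformly_small)
    show "compact K" using K by blast
    fix x0 assume "x0 \<in> K"
    then obtain t0 z0 where x0: "x0 = (t0, z0)" and z0: "z0 \<in> constraint_set H t0" using K by auto
    obtain U f \<rho> C where fam: "local_step_family a b t0 z0 U f \<rho> C"
      by (rule local_step_family_exists[OF z0])
    then have \<rho>: "\<rho> > 0" by (simp add: local_step_family_def)
    obtain \<delta> where \<delta>: "\<delta> > 0" and maps: "\<And>t h. t \<in> ball t0 \<delta> \<Longrightarrow> h \<in> {0<..<\<delta>} \<Longrightarrow>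
       \<exists>Zs Ze. step_maps H f a b t h z0 \<delta> \<rho> \<rho> C Zs Ze \<and>
          (\<forall>z\<in>constraint_set H t \<inter> ball z0 \<delta>. \<Phi> t h z = Ze (pos_mom z))"
      using rk_integrator_follows_steps[OF \<Phi> fam \<rho> order_refl] by blast
    have main: "?P (fst x) h (snd x)" if xK: "x \<in> K" "dist x x0 < \<delta>" and h: "h \<in> {0<..<\<delta>}" for x h
    proof -
      obtain t z where x: "x = (t, z)" and t: "t \<in> ball t0 \<delta>" and z: "z \<in> ball z0 \<delta>" "z \<in> constraint_set H t"
        using K xK dist_fst_le[of x x0] dist_snd_le[of x x0] by (cases x) (auto simp: x0 dist_commute)
      let ?C = "constraint_set H t"
      obtain Zs Ze where sm: "step_maps H f a b t h z0 \<delta> \<rho> \<rho> C Zs Ze"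
        and eq: "\<And>z. z \<in> ?C \<Longrightarrow> z \<in> ball z0 \<delta> \<Longrightarrow> \<Phi> t h z = Ze (pos_mom z)"
        using maps[OF t h] by blast
      obtain D1 where D1: "((\<lambda>z. Ze (pos_mom z)) has_derivative D1) (at z)" and om: "\<And>u w. omega (D1 u) (D1 w) = omega u w"
        using step_maps_symplectic[OF ab sm z(1)] by blast
      obtain r where r: "r > 0" "ball z r \<subseteq> ball z0 \<delta>" using z(1) by (meson open_ball openE)
      have \<Phi>D1: "(\<Phi> t h has_derivative D1) (at z within ?C)"
      proof (rule has_derivative_transform_within[OF has_derivative_at_withinI[OF D1] r(1) z(2)])
        fix z' assume z': "z' \<in> ?C" "dist z' z < r"
        then have "z' \<in> ball z0 \<delta>" by (intro subsetD[OF r(2)]) (simp add: dist_commute)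
        from eq[OF z'(1) this] show "Ze (pos_mom z') = \<Phi> t h z'" by simp
      qed
      have tangent: "D u = D1 u" if D: "(\<Phi> t h has_derivative D) (at z within ?C)" and u: "u \<in> tangent_vectors ?C z" for D u
      proof -
        obtain \<gamma> where \<gamma>: "\<And>s::real. \<gamma> s \<in> ?C" "\<gamma> 0 = z" "(\<gamma> has_vector_derivative u) (at 0)"
          using u unfolding tangent_vectors_def by blast
        have "((\<lambda>s. \<Phi> t h (\<gamma> s)) has_vector_derivative E u) (at 0)" if E: "(\<Phi> t h has_derivative E) (at z within ?C)" for E
        proof -
          have "(\<gamma> has_derivative (\<lambda>s. s *\<^sub>R u)) (at 0)" using \<gamma>(3) by (simp add: has_vector_derivative_def)
          moreover have "(\<Phi> t h has_derivative E) (at (\<gamma> 0) within range \<gamma>)"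
            unfolding \<gamma>(2) using \<gamma>(1) by (intro has_derivative_subset[OF E]) auto
          ultimately have "((\<lambda>s. \<Phi> t h (\<gamma> s)) has_derivative (\<lambda>s. E (s *\<^sub>R u))) (at 0)"
            by (rule has_derivative_in_compose)
          then show ?thesis
            unfolding has_vector_derivative_def by (simp add: linear_scale[OF has_derivative_linear[OF E]])
        qed
        from vector_derivative_unique_at[OF this[OF D] this[OF \<Phi>D1]] show ?thesis .
      qed
      show ?thesis
        unfolding x fst_conv snd_conv
      proof (intro conjI allI impI ballI)
        show "\<Phi> t h differentiable (at z within ?C)" using \<Phi>D1 by (rule differentiableI)
        show "omega (D u) (D w) = omega u w"
          if "(\<Phi> t h has_derivative D) (at z within ?C)" "u \<in> tangent_vectors ?C z" "w \<in> tangent_vectors ?C z" for D u w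
          using om[of u w] unfolding tangent[OF that(1,2)] tangent[OF that(1,3)] .
      qed
    qed
    show "\<exists>\<delta>>0. \<forall>x\<in>K. dist x x0 < \<delta> \<longrightarrow> (\<forall>h\<in>{0<..<\<delta>}. ?P (fst x) h (snd x))"
      by (rule exI[of _ \<delta>], rule conjI[OF \<delta>], intro ballI impI, rule main)
  qed
  then show "\<exists>h0>0. \<forall>(t, z)\<in>K. \<forall>h\<in>{0<..<h0}. ?P t h z" unfolding split_beta .
qed

end

section \<open>Convergence\<close>

context regular_hamiltonian
begin

lemma solution_onD:
  assumes "solution_on H t0 T z" "t \<in> {t0..T}"
  shows "z t \<in> constraint_set H t"
    "((\<lambda>t. pos_mom (z t)) has_vector_derivative hamiltonian_field (t, z t)) (at t within {t0..T})"
    "continuous (at t within {t0..T}) z"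
proof -
  obtain z' where z': "(z has_vector_derivative z') (at t within {t0..T})" "Jmap z' = gradH (t, z t)"
    using assms unfolding solution_on_def gradH_def fst_conv snd_conv by blast
  show "z t \<in> constraint_set H t" using assms unfolding solution_on_def by blast
  have "pos_mom z' = hamiltonian_field (t, z t)" using z'(2) Jmap_eq_gradH_iff by blast
  with bounded_linear.has_vector_derivative[OF bounded_linear_pos_mom z'(1)]
  show "((\<lambda>t. pos_mom (z t)) has_vector_derivative hamiltonian_field (t, z t)) (at t within {t0..T})" by simp
  show "continuous (at t within {t0..T}) z"
    using z'(1) by (rule has_vector_derivative_continuous)
qed

lemma solution_on_continuous_on: "solution_on H t0 T z \<Longrightarrow> continuous_on {t0..T} z"
  using solution_onD(3) by (simp add: continuous_on_eq_continuous_within)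

definition tube :: "(real \<Rightarrow> ('n, 'k) phase) \<Rightarrow> real \<Rightarrow> real \<Rightarrow> ('n, 'k) phase set" where
  "tube z t e = constraint_set H t \<inter> ball (z t) e"

lemma near_solution:
  assumes "continuous_on {t0..T} z" "t1 \<in> {t0..T}" "r > 0"
  obtains d where "d > 0" "\<And>t. t \<in> {t0..T} \<Longrightarrow> dist t t1 < d \<Longrightarrow> dist (z t) (z t1) < r"
  using assms unfolding continuous_on_iff by blast

text \<open>Near a solution, one step multiplies differences by at most \<open>1 + h / e\<close> and moves points by little, and differences in
  position and momentum control those of the multipliers. The reciprocal of \<open>e\<close> serves as the constant in both estimates.\<close>
lemma tube_stability:
  assumes \<Phi>: "rk_integrator H a b \<Phi>" and z: "continuous_on {t0..T} z" "\<forall>t\<in>{t0..T}. z t \<in> constraint_set H t"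
    and r: "r > 0"
  shows "\<exists>\<delta>>0. \<forall>t\<in>{t0..T}. \<forall>e\<in>{0<..<\<delta>}. \<forall>z1\<in>tube z t e. \<forall>z2\<in>tube z t e.
    dist z1 z2 \<le> dist (pos_mom z1) (pos_mom z2) / e \<and>
    (\<forall>h\<in>{0<..<e}. \<Phi> t h z1 \<in> constraint_set H (t + h) \<and> dist (\<Phi> t h z1) (z t) < r \<and> (\<exists>Z. rk_step H a b t h z1 Z (\<Phi> t h z1)) \<and>
      dist (pos_mom (\<Phi> t h z1)) (pos_mom (\<Phi> t h z2)) \<le> (1 + h / e) * dist (pos_mom z1) (pos_mom z2))"
    (is "\<exists>\<delta>>0. \<forall>t\<in>_. \<forall>e\<in>_. ?P t e")
proof (rule compact_uniformly_small)
  fix t1 assume t1: "t1 \<in> {t0..T}"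
  obtain U f \<rho> C where fam: "local_step_family a b t1 (z t1) U f \<rho> C"
    by (rule local_step_family_exists[OF bspec[OF z(2) t1]])
  then have \<rho>: "\<rho> > 0" and C: "C > 0"
    and sheet: "\<And>t z1 z2. t \<in> ball t1 \<rho> \<Longrightarrow> z1 \<in> ball (z t1) \<rho> \<inter> constraint_set H t \<Longrightarrow>
        z2 \<in> ball (z t1) \<rho> \<inter> constraint_set H t \<Longrightarrow> dist z1 z2 \<le> C * dist (pos_mom z1) (pos_mom z2)"
    by (simp_all add: local_step_family_def)
  define \<epsilon> where "\<epsilon> = min \<rho> (r / 2)"
  have \<epsilon>: "0 < \<epsilon>" "\<epsilon> \<le> \<rho>" "\<epsilon> \<le> r / 2" using \<rho> r by (auto simp: \<epsilon>_def)
  obtain \<delta>1 where \<delta>1: "\<delta>1 > 0" "\<delta>1 \<le> \<epsilon>" and maps: "\<And>t h. t \<in> ball t1 \<delta>1 \<Longrightarrow> h \<in> {0<..<\<delta>1} \<Longrightarrow>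
     \<exists>Zs Ze. step_maps H f a b t h (z t1) \<delta>1 \<epsilon> \<rho> C Zs Ze \<and>
        (\<forall>x\<in>constraint_set H t \<inter> ball (z t1) \<delta>1. \<Phi> t h x = Ze (pos_mom x))"
    using rk_integrator_follows_steps[OF \<Phi> fam \<epsilon>(1,2)] by blast
  have half: "\<delta>1 / 2 > 0" using \<delta>1 by simp
  obtain d where d: "d > 0" "\<And>t. t \<in> {t0..T} \<Longrightarrow> dist t t1 < d \<Longrightarrow> dist (z t) (z t1) < \<delta>1 / 2"
    using near_solution[OF z(1) t1 half] by blast
  define \<delta> where "\<delta> = min (min d (\<delta>1 / 2)) (1 / C)"
  have \<delta>: "\<delta> > 0" "\<delta> \<le> d" "\<delta> \<le> \<delta>1 / 2" "\<delta> \<le> 1 / C" using d \<delta>1 C by (auto simp: \<delta>_def)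
  have "?P t e" if t: "t \<in> {t0..T}" "dist t t1 < \<delta>" and e: "e \<in> {0<..<\<delta>}" for t e
  proof (intro ballI)
    fix z1 z2 assume tube: "z1 \<in> tube z t e" "z2 \<in> tube z t e"
    have sub: "x \<in> ball (z t1) \<delta>1" if "x \<in> tube z t e" for x
      using that d(2)[OF t(1)] t(2) e \<delta> dist_triangle[of "z t1" x "z t"] by (simp add: tube_def dist_commute)
    have tb: "t \<in> ball t1 \<delta>1" using t(2) \<delta> \<delta>1 by (simp add: dist_commute)
    have inC: "x \<in> constraint_set H t" if "x \<in> tube z t e" for x using that by (simp add: tube_def)
    have "C * e \<le> C * (1 / C)" using e \<delta>(4) C by (intro mult_left_mono) auto
    then have Ce: "C \<le> 1 / e" using e C by (simp add: field_simps)
    have "dist z1 z2 \<le> C * dist (pos_mom z1) (pos_mom z2)"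
      using sub[OF tube(1)] sub[OF tube(2)] tb \<delta>1 \<epsilon> inC tube by (intro sheet[of t]) auto
    also have "\<dots> \<le> dist (pos_mom z1) (pos_mom z2) / e"
      using mult_right_mono[OF Ce zero_le_dist, of "pos_mom z1" "pos_mom z2"] by simp
    finally have A: "dist z1 z2 \<le> dist (pos_mom z1) (pos_mom z2) / e" .
    have "\<Phi> t h z1 \<in> constraint_set H (t + h) \<and> dist (\<Phi> t h z1) (z t) < r \<and> (\<exists>Z. rk_step H a b t h z1 Z (\<Phi> t h z1)) \<and>
      dist (pos_mom (\<Phi> t h z1)) (pos_mom (\<Phi> t h z2)) \<le> (1 + h / e) * dist (pos_mom z1) (pos_mom z2)"
      if h: "h \<in> {0<..<e}" for h
    proof -
      have h1: "h \<in> {0<..<\<delta>1}" using h e \<delta> \<delta>1 by auto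
      obtain Zs Ze where sm: "step_maps H f a b t h (z t1) \<delta>1 \<epsilon> \<rho> C Zs Ze"
        and eq: "\<And>x. x \<in> tube z t e \<Longrightarrow> \<Phi> t h x = Ze (pos_mom x)"
        using maps[OF tb h1] sub inC by blast
      have "dist (pos_mom (Ze (pos_mom z1))) (pos_mom (Ze (pos_mom z2))) \<le> (1 + C * h) * dist (pos_mom z1) (pos_mom z2)"
        unfolding dist_norm by (rule step_mapsD(9)[OF sm sub[OF tube(1)] sub[OF tube(2)]])
      also have "\<dots> \<le> (1 + h / e) * dist (pos_mom z1) (pos_mom z2)"
        using mult_right_mono[OF Ce, of h] h by (intro mult_right_mono) auto
      finally have lip: "dist (pos_mom (Ze (pos_mom z1))) (pos_mom (Ze (pos_mom z2)))
          \<le> (1 + h / e) * dist (pos_mom z1) (pos_mom z2)" .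
      have "dist (z t) (z t1) < r / 2" using d(2)[OF t(1)] t(2) \<delta>(2) \<delta>1(2) \<epsilon>(3) r by simp
      then have "dist (Ze (pos_mom z1)) (z t) < r"
        using step_mapsD(4)[OF sm sub[OF tube(1)]] \<epsilon>(3) dist_triangle[of "Ze (pos_mom z1)" "z t" "z t1"]
        by (simp add: dist_commute)
      with lip show ?thesis
        unfolding eq[OF tube(1)] eq[OF tube(2)]
        using step_mapsD(1,5)[OF sm sub[OF tube(1)]] by blast
    qed
    with A show "dist z1 z2 \<le> dist (pos_mom z1) (pos_mom z2) / e \<and>
      (\<forall>h\<in>{0<..<e}. \<Phi> t h z1 \<in> constraint_set H (t + h) \<and> dist (\<Phi> t h z1) (z t) < r \<and> (\<exists>Z. rk_step H a b t h z1 Z (\<Phi> t h z1)) \<and>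
        dist (pos_mom (\<Phi> t h z1)) (pos_mom (\<Phi> t h z2)) \<le> (1 + h / e) * dist (pos_mom z1) (pos_mom z2))"
      by blast
  qed
  with \<delta>(1) show "\<exists>\<delta>>0. \<forall>t\<in>{t0..T}. dist t t1 < \<delta> \<longrightarrow> (\<forall>e\<in>{0<..<\<delta>}. ?P t e)"
    by (intro exI[of _ \<delta>] conjI ballI impI) blast+
qed simp

text \<open>Near a given time the solution is a solution of the reduced equation, to which the order of the method applies. The
  set \<open>K\<close> of initial data is a piece of the solution itself.\<close>
lemma local_error:
  assumes \<Phi>: "rk_integrator H a b \<Phi>" and order: "rk_order TYPE((real^'n) \<times> (real^'n)) a b p"
    and sol: "solution_on H t0 T z"
  shows "\<exists>\<delta>>0. \<forall>t\<in>{t0..T}. \<forall>e\<in>{0<..<\<delta>}. \<forall>h\<in>{0<..<e}. t + h \<le> T \<longrightarrow>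
    dist (pos_mom (\<Phi> t h (z t))) (pos_mom (z (t + h))) \<le> h ^ (p + 1) / e"
    (is "\<exists>\<delta>>0. \<forall>t\<in>_. \<forall>e\<in>_. ?P t e")
proof (rule compact_uniformly_small)
  let ?y = "\<lambda>t. pos_mom (z t)"
  note cont = solution_on_continuous_on[OF sol] and zC = solution_onD(1)[OF sol]
  fix t1 assume t1: "t1 \<in> {t0..T}"
  obtain U f \<rho> C where fam: "local_step_family a b t1 (z t1) U f \<rho> C"
    by (rule local_step_family_exists[OF zC[OF t1]])
  then have \<rho>: "\<rho> > 0" and U: "open U" "smooth_on U f" and sub: "ball t1 \<rho> \<times> ball (?y t1) \<rho> \<subseteq> U"
    and field: "\<And>t x. t \<in> ball t1 \<rho> \<Longrightarrow> x \<in> ball (z t1) \<rho> \<inter> constraint_set H t \<Longrightarrow> f (t, pos_mom x) = hamiltonian_field (t, x)"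
    by (simp_all add: local_step_family_def)
  obtain d where d: "d > 0" "\<And>t. t \<in> {t0..T} \<Longrightarrow> dist t t1 < d \<Longrightarrow> dist (z t) (z t1) < \<rho>"
    using near_solution[OF cont t1 \<rho>] by blast
  define d' where "d' = min d \<rho> / 2"
  have d': "d' > 0" "d' < d" "d' < \<rho>" using d \<rho> by (auto simp: d'_def)
  have near: "(t, ?y t) \<in> U" "t \<in> ball t1 \<rho>" "z t \<in> ball (z t1) \<rho>" if "t \<in> {t0..T}" "dist t t1 \<le> d'" for t
  proof -
    show t: "t \<in> ball t1 \<rho>" and zt: "z t \<in> ball (z t1) \<rho>"
      using that d' d(2)[OF that(1)] by (auto simp: dist_commute)
    have "?y t \<in> ball (?y t1) \<rho>" using zt dist_pos_mom_le[of "z t1" "z t"] by simp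
    then show "(t, ?y t) \<in> U" using sub t by blast
  qed
  define K where "K = (\<lambda>t. (t, ?y t)) ` ({t0..T} \<inter> cball t1 d')"
  have "compact K" unfolding K_def
    by (intro compact_continuous_image continuous_on_Pair continuous_on_id compact_Int compact_cball compact_Icc
        bounded_linear.continuous_on[OF bounded_linear_pos_mom] continuous_on_subset[OF cont]) blast
  moreover have "K \<subseteq> U" unfolding K_def using near(1) by (auto simp: dist_commute)
  ultimately have KU: "compact K \<and> K \<subseteq> U" by (rule conjI)
  obtain \<epsilon>1 h1 C1 where \<epsilon>1: "\<epsilon>1 > 0" "h1 > 0" and err: "\<forall>(t, y0)\<in>K. \<forall>h\<in>{0<..<h1}. \<forall>Y y1 y.
      ode_rk_step f a b t h y0 Y y1 \<and>
      (\<forall>i. (t + abscissa a i * h, Y i) \<in> U \<and> dist (Y i) y0 < \<epsilon>1) \<and> y t = y0 \<and>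
      (\<forall>s\<in>{t..t + h}. (s, y s) \<in> U \<and> (y has_vector_derivative f (s, y s)) (at s within {t..t + h})) \<longrightarrow>
      norm (y1 - y (t + h)) \<le> C1 * h ^ (p + 1)"
    using order[unfolded rk_order_def, rule_format, OF conjI[OF U] KU] by (elim exE conjE)
  define \<epsilon> where "\<epsilon> = min \<rho> (\<epsilon>1 / 2)"
  have \<epsilon>: "0 < \<epsilon>" "\<epsilon> \<le> \<rho>" "\<epsilon> \<le> \<epsilon>1 / 2" using \<rho> \<epsilon>1 by (auto simp: \<epsilon>_def)
  obtain \<delta>1 where \<delta>1: "\<delta>1 > 0" and maps: "\<And>t h. t \<in> ball t1 \<delta>1 \<Longrightarrow> h \<in> {0<..<\<delta>1} \<Longrightarrow>
     (\<forall>i. t + abscissa a i * h \<in> ball t1 \<epsilon>) \<and> (\<exists>Zs Ze. step_maps H f a b t h (z t1) \<delta>1 \<epsilon> \<rho> C Zs Ze \<and>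
        (\<forall>x\<in>constraint_set H t \<inter> ball (z t1) \<delta>1. \<Phi> t h x = Ze (pos_mom x)))"
    using rk_integrator_follows_steps[OF \<Phi> fam \<epsilon>(1,2)] by blast
  have half: "min \<delta>1 (\<epsilon>1 / 2) > 0" using \<delta>1 \<epsilon>1 by simp
  obtain d2 where d2: "d2 > 0" "\<And>t. t \<in> {t0..T} \<Longrightarrow> dist t t1 < d2 \<Longrightarrow> dist (z t) (z t1) < min \<delta>1 (\<epsilon>1 / 2)"
    using near_solution[OF cont t1 half] by blast
  define \<delta> where "\<delta> = min (min (min d2 \<delta>1) (d' / 2)) (min h1 (1 / (1 + \<bar>C1\<bar>)))"
  have \<delta>: "\<delta> > 0" "\<delta> \<le> d2" "\<delta> \<le> \<delta>1" "\<delta> \<le> d' / 2" "\<delta> \<le> h1" "\<delta> \<le> 1 / (1 + \<bar>C1\<bar>)"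
    using d2 \<delta>1 d' \<epsilon>1 by (auto simp: \<delta>_def add_pos_nonneg)
  have "dist (pos_mom (\<Phi> t h (z t))) (?y (t + h)) \<le> h ^ (p + 1) / e"
    if t: "t \<in> {t0..T}" "dist t t1 < \<delta>" and e: "e \<in> {0<..<\<delta>}" and h: "h \<in> {0<..<e}" and T: "t + h \<le> T" for t e h
  proof -
    have dt: "dist (z t) (z t1) < \<delta>1" "dist (z t) (z t1) < \<epsilon>1 / 2" using d2(2)[OF t(1)] t(2) \<delta> by auto
    have zt: "z t \<in> ball (z t1) \<delta>1" using dt by (simp add: dist_commute)
    have tb: "t \<in> ball t1 \<delta>1" using t(2) \<delta> by (simp add: dist_commute)
    have hb: "h \<in> {0<..<\<delta>1}" using h e \<delta> by auto
    obtain Zs Ze where sm: "step_maps H f a b t h (z t1) \<delta>1 \<epsilon> \<rho> C Zs Ze"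
      and eq: "\<Phi> t h (z t) = Ze (?y t)"
      using maps[OF tb hb] zt zC[OF t(1)] by blast
    define Y where "Y i = pos_mom (Zs (?y t) i)" for i
    have "(t, ?y t) \<in> K" unfolding K_def using t \<delta> d' by (intro imageI) (simp add: dist_commute)
    moreover have "h \<in> {0<..<h1}" using h e \<delta> by auto
    moreover have "ode_rk_step f a b t h (?y t) Y (pos_mom (Ze (?y t)))"
      unfolding Y_def by (rule step_mapsD(2)[OF sm zt])
    moreover have "(t + abscissa a i * h, Y i) \<in> U \<and> dist (Y i) (?y t) < \<epsilon>1" for i
    proof -
      have Yi: "Y i \<in> ball (?y t1) \<epsilon>"
        using step_mapsD(3)[OF sm zt, of i] dist_pos_mom_le[of "z t1" "Zs (?y t) i"] by (simp add: Y_def)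
      moreover have "t + abscissa a i * h \<in> ball t1 \<epsilon>" using maps[OF tb hb] by blast
      ultimately have "(t + abscissa a i * h, Y i) \<in> U" using sub \<epsilon>(2) by auto
      moreover have "dist (?y t1) (?y t) < \<epsilon>1 / 2"
        using dt(2) dist_pos_mom_le[of "z t1" "z t"] by (simp add: dist_commute)
      ultimately show ?thesis
        using Yi \<epsilon>(3) dist_triangle[of "Y i" "?y t" "?y t1"] by (simp add: dist_commute)
    qed
    moreover have "(s, ?y s) \<in> U \<and> (?y has_vector_derivative f (s, ?y s)) (at s within {t..t + h})"
      if s: "s \<in> {t..t + h}" for s
    proof -
      have sT: "s \<in> {t0..T}" using s t T by auto
      have "dist s t \<le> h" using s by (simp add: dist_real_def)
      then have "dist s t1 \<le> d'" using dist_triangle[of s t1 t] t(2) h e \<delta> by auto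
      note s' = near[OF sT this]
      have "f (s, ?y s) = hamiltonian_field (s, z s)" using s'(2,3) zC[OF sT] by (intro field) auto
      moreover have "(?y has_vector_derivative hamiltonian_field (s, z s)) (at s within {t..t + h})"
        using t T by (intro has_vector_derivative_within_subset[OF solution_onD(2)[OF sol sT]]) auto
      ultimately show ?thesis using s'(1) by simp
    qed
    ultimately have "norm (pos_mom (Ze (?y t)) - ?y (t + h)) \<le> C1 * h ^ (p + 1)"
      using err[unfolded ball_case_prod, rule_format, of t "?y t" h Y "pos_mom (Ze (?y t))" ?y] by blast
    also have "\<dots> \<le> 1 / e * h ^ (p + 1)"
    proof (rule mult_right_mono)
      have "e * (1 + \<bar>C1\<bar>) < 1 / (1 + \<bar>C1\<bar>) * (1 + \<bar>C1\<bar>)"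
        using e \<delta>(6) by (intro mult_strict_right_mono) auto
      also have "\<dots> = 1" by simp
      finally have "e * (1 + \<bar>C1\<bar>) < 1" .
      moreover have "e * C1 \<le> e * (1 + \<bar>C1\<bar>)" using e by (intro mult_left_mono) auto
      ultimately show "C1 \<le> 1 / e" using e by (simp add: field_simps)
    qed (use h in simp)
    finally show ?thesis by (simp add: eq dist_norm)
  qed
  with \<delta>(1) show "\<exists>\<delta>>0. \<forall>t\<in>{t0..T}. dist t t1 < \<delta> \<longrightarrow> (\<forall>e\<in>{0<..<\<delta>}. ?P t e)"
    by (intro exI[of _ \<delta>] conjI ballI impI) blast+
qed simp

lemma gronwall_step:
  fixes E E' L h \<eta> :: real
  assumes "E \<le> \<eta> * (exp x - 1)" "E' \<le> (1 + h * L) * E + L * (h * \<eta>)" "h \<ge> 0" "L \<ge> 0" "\<eta> \<ge> 0"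
  shows "E' \<le> \<eta> * (exp (x + h * L) - 1)"
proof -
  have "E' \<le> (1 + h * L) * (\<eta> * (exp x - 1)) + L * (h * \<eta>)"
    using assms by (meson add_right_mono mult_left_mono order_trans add_nonneg_nonneg mult_nonneg_nonneg zero_le_one)
  also have "\<dots> = \<eta> * ((1 + h * L) * exp x - 1)" by (simp add: algebra_simps)
  also have "\<dots> \<le> \<eta> * (exp (h * L) * exp x - 1)"
    using assms exp_ge_add_one_self[of "h * L"] by (intro mult_left_mono diff_right_mono mult_right_mono) auto
  also have "\<dots> = \<eta> * (exp (x + h * L) - 1)" by (simp add: exp_add mult.commute)
  finally show ?thesis .
qed

text \<open>With \<open>L = 1 / e\<close> the errors \<open>E\<^sub>n\<close> in position and momentum satisfy \<open>E\<^sub>n\<^sub>+\<^sub>1 \<le> (1 + h L) E\<^sub>n + L h\<^sup>p\<^sup>+\<^sup>1\<close>, hence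
  \<open>E\<^sub>n \<le> h\<^sup>p (exp(n h L) - 1)\<close>. The induction has to show at the same time that the iterates stay in the tube around
  the solution in which these bounds are valid; consistency \<open>p \<ge> 1\<close> makes the error small enough for this.\<close>
lemma rk_integrator_convergent:
  assumes \<Phi>: "rk_integrator H a b \<Phi>" and p: "p \<ge> 1" and order: "rk_order TYPE((real^'n) \<times> (real^'n)) a b p"
  shows "convergent_of_order H a b \<Phi> p"
  unfolding convergent_of_order_def
proof (intro allI impI)
  fix t0 T z assume *: "t0 < T \<and> solution_on H t0 T z"
  then have T: "t0 < T" and sol: "solution_on H t0 T z" by auto
  note cont = solution_on_continuous_on[OF sol] and zC = solution_onD(1)[OF sol]
  have zC': "\<forall>t\<in>{t0..T}. z t \<in> constraint_set H t" using zC by blast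
  let ?y = "\<lambda>t. pos_mom (z t)"
  let ?S = "\<lambda>t e r z1 z2. dist z1 z2 \<le> dist (pos_mom z1) (pos_mom z2) / e \<and>
    (\<forall>h\<in>{0<..<e}. \<Phi> t h z1 \<in> constraint_set H (t + h) \<and> dist (\<Phi> t h z1) (z t) < r \<and>
      (\<exists>Z. rk_step H a b t h z1 Z (\<Phi> t h z1)) \<and>
      dist (pos_mom (\<Phi> t h z1)) (pos_mom (\<Phi> t h z2)) \<le> (1 + h / e) * dist (pos_mom z1) (pos_mom z2))"
  obtain \<delta>1 where \<delta>1: "\<delta>1 > 0"
    and stable: "\<forall>t\<in>{t0..T}. \<forall>e\<in>{0<..<\<delta>1}. \<forall>z1\<in>tube z t e. \<forall>z2\<in>tube z t e. ?S t e 1 z1 z2"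
    using tube_stability[OF \<Phi> cont zC' zero_less_one] by (elim exE conjE)
  obtain \<delta>2 where \<delta>2: "\<delta>2 > 0" and error: "\<forall>t\<in>{t0..T}. \<forall>e\<in>{0<..<\<delta>2}. \<forall>h\<in>{0<..<e}. t + h \<le> T \<longrightarrow>
    dist (pos_mom (\<Phi> t h (z t))) (?y (t + h)) \<le> h ^ (p + 1) / e"
    using local_error[OF \<Phi> order sol] by (elim exE conjE)
  define e where "e = min \<delta>1 \<delta>2 / 2"
  have e: "e > 0" "e \<in> {0<..<\<delta>1}" "e \<in> {0<..<\<delta>2}" using \<delta>1 \<delta>2 by (auto simp: e_def)
  have e2: "e / 2 > 0" using e by simp
  obtain \<delta>3 where \<delta>3: "\<delta>3 > 0"
    and displ: "\<forall>t\<in>{t0..T}. \<forall>r\<in>{0<..<\<delta>3}. \<forall>z1\<in>tube z t r. \<forall>z2\<in>tube z t r. ?S t r (e / 2) z1 z2"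
    using tube_stability[OF \<Phi> cont zC' e2] by (elim exE conjE)
  have "uniformly_continuous_on {t0..T} z" by (intro compact_uniformly_continuous cont compact_Icc)
  then obtain \<delta>4 where \<delta>4: "\<delta>4 > 0" and unif: "\<forall>t\<in>{t0..T}. \<forall>t'\<in>{t0..T}. dist t' t < \<delta>4 \<longrightarrow> dist (z t') (z t) < e / 2"
    using e2 unfolding uniformly_continuous_on_def by blast
  \<comment> \<open>Points of the tube of radius \<open>r\<close> stay in the larger tube of radius \<open>e\<close> after one step; the error bound then brings them back to radius \<open>r\<close>.\<close>
  define r where "r = min e (\<delta>3 / 2)"
  have r: "r > 0" "r \<le> e" "r \<in> {0<..<\<delta>3}" using e \<delta>3 by (auto simp: r_def)
  define L where "L = 1 / e"
  have L: "L > 0" using e by (simp add: L_def)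
  define M where "M = exp (L * (T - t0)) - 1"
  have M: "M > 0" using L T by (simp add: M_def)
  define h0 where "h0 = min (min r \<delta>4) (min 1 (r / (L * M)))"
  have h0: "h0 > 0" "h0 \<le> r" "h0 \<le> \<delta>4" "h0 \<le> 1" "h0 \<le> r / (L * M)"
    using r \<delta>4 L M by (auto simp: h0_def)
  let ?P = "\<lambda>C h n. (t0 + real n * h \<le> T \<longrightarrow>
             norm (iterates \<Phi> t0 h (z t0) n - z (t0 + real n * h)) \<le> C * h ^ p) \<and>
          (t0 + real (Suc n) * h \<le> T \<longrightarrow>
             (\<exists>Z. rk_step H a b (t0 + real n * h) h (iterates \<Phi> t0 h (z t0) n) Z
                    (iterates \<Phi> t0 h (z t0) (Suc n))))"
  have steps: "?P (L * M) h n"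
    if h: "h \<in> {0<..<h0}" for h n
  proof -
    let ?t = "\<lambda>n. t0 + real n * h" and ?z = "\<lambda>n. iterates \<Phi> t0 h (z t0) n"
    let ?E = "\<lambda>n. dist (pos_mom (?z n)) (?y (?t n))"
    have hr: "h \<in> {0<..<r}" "h \<in> {0<..<e}" using h h0 r by auto
    have hp: "h ^ p \<le> h" using h h0 p power_decreasing[of 1 p h] by simp
    have small: "L * M * h ^ p < r"
    proof -
      have "L * M * h ^ p \<le> L * M * h" using hp L M by (intro mult_left_mono) auto
      also have "\<dots> < L * M * (r / (L * M))" using h h0(5) L M by (intro mult_strict_left_mono) auto
      finally show ?thesis using L M by simp
    qed
    have E_le: "\<eta> * (exp (real n * (h * L)) - 1) \<le> M * \<eta>" if "?t n \<le> T" "\<eta> \<ge> 0" for n \<eta>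
    proof -
      have "real n * h \<le> T - t0" using that by simp
      then have "real n * h * L \<le> (T - t0) * L" using L by (intro mult_right_mono) auto
      then have "exp (real n * (h * L)) - 1 \<le> M" by (simp add: M_def mult.commute mult.left_commute)
      from mult_left_mono[OF this that(2)] show ?thesis by (simp only: mult.commute[of M])
    qed
    have z_tube: "z t \<in> tube z t \<epsilon>" if "t \<in> {t0..T}" "\<epsilon> > 0" for t \<epsilon>
      using zC that by (simp add: tube_def)
    have tube_mono: "x \<in> tube z t e" if "x \<in> tube z t r" for x t using that r by (simp add: tube_def)
    have tn: "?t n \<in> {t0..T}" if "?t n \<le> T" for n using that h by simp
    have full: "dist x (z (?t n)) \<le> L * M * h ^ p"
      if n: "?t n \<le> T" and x: "x \<in> tube z (?t n) e" "dist (pos_mom x) (?y (?t n)) \<le> h ^ p * (exp (real n * (h * L)) - 1)" for n x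
    proof -
      have "dist x (z (?t n)) \<le> dist (pos_mom x) (?y (?t n)) / e"
        using stable tn[OF n] e(2) x(1) z_tube[OF tn[OF n] e(1)] by blast
      also have "\<dots> = L * dist (pos_mom x) (?y (?t n))" by (simp add: L_def)
      also have "\<dots> \<le> L * (M * h ^ p)"
        using order_trans[OF x(2) E_le[OF n, of "h ^ p"]] L h by (intro mult_left_mono) auto
      finally show ?thesis by (simp add: mult.assoc)
    qed
    have inv: "?z n \<in> tube z (?t n) r \<and> ?E n \<le> h ^ p * (exp (real n * (h * L)) - 1)" if "?t n \<le> T" for n
      using that
    proof (induction n)
      case 0
      show ?case using z_tube[of t0 r] r T by simp
    next
      case (Suc n)
      have tS: "?t (Suc n) = ?t n + h" by (simp add: algebra_simps)
      have n: "?t n \<le> T" using Suc.prems h unfolding tS by simp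
      note IH = Suc.IH[OF n] and tn' = tn[OF n]
      have tube_n: "?z n \<in> tube z (?t n) e" "z (?t n) \<in> tube z (?t n) e"
        using IH tube_mono z_tube[OF tn' e(1)] by blast+
      have zS: "?z (Suc n) = \<Phi> (?t n) h (?z n)" by simp
      have C: "?z (Suc n) \<in> constraint_set H (?t (Suc n))"
        using stable tn' e(2) tube_n hr(2) unfolding zS tS by blast
      have stab: "dist (pos_mom (\<Phi> (?t n) h (?z n))) (pos_mom (\<Phi> (?t n) h (z (?t n)))) \<le> (1 + h * L) * ?E n"
        using stable tn' e(2) tube_n hr(2) unfolding L_def by fastforce
      have "?t n + h \<le> T" using Suc.prems unfolding tS .
      then have err: "dist (pos_mom (\<Phi> (?t n) h (z (?t n)))) (?y (?t n + h)) \<le> h ^ (p + 1) / e"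
        using error tn' e(3) hr(2) by blast
      have "?E (Suc n) \<le> (1 + h * L) * ?E n + h ^ (p + 1) / e"
        using dist_triangle[of "pos_mom (?z (Suc n))" "?y (?t n + h)" "pos_mom (\<Phi> (?t n) h (z (?t n)))"] stab err
        unfolding zS tS by linarith
      also have "h ^ (p + 1) / e = L * (h * h ^ p)" by (simp add: L_def)
      finally have "?E (Suc n) \<le> h ^ p * (exp (real n * (h * L) + h * L) - 1)"
        using IH h L by (intro gronwall_step[where E = "?E n"]) auto
      then have E: "?E (Suc n) \<le> h ^ p * (exp (real (Suc n) * (h * L)) - 1)" by (simp add: algebra_simps)
      have "dist (?z (Suc n)) (z (?t n)) < e / 2"
        using displ tn' r(3) IH hr(1) unfolding zS by blast
      moreover have "dist (z (?t (Suc n))) (z (?t n)) < e / 2"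
        using unif tn' tn[OF Suc.prems] h h0 unfolding tS by (auto simp: dist_real_def)
      ultimately have "?z (Suc n) \<in> tube z (?t (Suc n)) e"
        using C dist_triangle[of "z (?t (Suc n))" "?z (Suc n)" "z (?t n)"] by (simp add: tube_def dist_commute del: iterates.simps)
      from full[OF Suc.prems this E] small C E show ?case
        by (simp add: tube_def dist_commute del: iterates.simps)
    qed
    have "norm (?z n - z (?t n)) \<le> L * M * h ^ p" if "?t n \<le> T"
      using full[OF that _ conjunct2[OF inv[OF that]]] tube_mono inv[OF that] unfolding dist_norm by blast
    moreover have "\<exists>Z. rk_step H a b (?t n) h (?z n) Z (?z (Suc n))" if "?t (Suc n) \<le> T"
    proof -
      have n: "?t n \<le> T" using that h by (simp add: algebra_simps)
      show ?thesis
        using stable tn[OF n] e(2) tube_mono[OF conjunct1[OF inv[OF n]]] hr(2) unfolding iterates.simps by blast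
    qed
    ultimately show ?thesis by blast
  qed
  show "\<exists>h0>0. \<exists>C. \<forall>h\<in>{0<..<h0}. \<forall>n. ?P C h n"
    by (rule exI[of _ h0], rule conjI[OF h0(1)], rule exI[of _ "L * M"], rule ballI, rule allI, rule steps)
qed

theorem symplectic_rk_convergent_preserving_symplectic:
  assumes "symplectic_rk a b"
  shows "yields_convergent_preserving_symplectic H a b"
  unfolding yields_convergent_preserving_symplectic_def
  using rk_integrator_exists[of a b] rk_integrator_convergent[of a b] rk_integrator_symplectic[OF assms]
    rk_integrator_constraint_preserving by blast

end

section \<open>Hamiltonians from a Legendre transform\<close>

lemma smooth_on_grad:
  fixes f :: "'a::euclidean_space \<Rightarrow> real"
  assumes "smooth_on UNIV f"
  shows "smooth_on UNIV (grad f)"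
proof (rule smooth_on_cong)
  show "smooth_on UNIV (\<lambda>x. \<Sum>b\<in>Basis. frechet_derivative f (at x) b *\<^sub>R b)"
    by (intro smooth_on_sum smooth_on_scaleR smooth_on_const open_UNIV smooth_on_frechet_derivative assms)
  show "(\<Sum>b\<in>Basis. frechet_derivative f (at x) b *\<^sub>R b) = grad f x" for x
    using has_gradient(2)[OF smooth_on_has_derivative[OF assms UNIV_I]] by simp
qed simp

lemma smooth_on_UNIV_compose:
  fixes f :: "'a::real_normed_vector \<Rightarrow> 'b::euclidean_space"
  shows "smooth_on UNIV f \<Longrightarrow> smooth_on UNIV g \<Longrightarrow> smooth_on UNIV (\<lambda>x. g (f x))"
  using smooth_on_compose[of UNIV UNIV f g] by simp

lemmas bounded_linear_projections = bounded_linear_Pair bounded_linear_fst_comp bounded_linear_snd_comp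
  bounded_linear_fst bounded_linear_snd

lemma smooth_on_differentiable: "smooth_on UNIV f \<Longrightarrow> f differentiable (at x)"
  using smooth_on_has_derivative differentiableI UNIV_I by metis

lemma full_rank_rows_independent:
  fixes A :: "real^'n^'k"
  assumes "rank A = CARD('k)" "(\<Sum>i\<in>UNIV. (w $ i) *\<^sub>R A $ i) = 0"
  shows "w = 0"
proof -
  have "inj ((*v) (transpose A))"
    using assms(1) full_rank_injective[of "transpose A"] by (simp add: rank_transpose)
  moreover have "transpose A *v w = 0"
    using assms(2) by (simp add: matrix_mult_sum column_transpose row_def scalar_mult_eq_scaleR)
  ultimately show ?thesis
    by (metis injD matrix_vector_mult_0_right)
qed

locale velocity_constrained =
  fixes L :: "real \<Rightarrow> real^'n \<Rightarrow> real^'n \<Rightarrow> real" and g :: "'k::finite \<Rightarrow> real^'n \<Rightarrow> real^'n::finite \<Rightarrow> real"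
  assumes problem: "problem_B L g"
begin

text \<open>The Legendre transform acts on triples \<open>(v, q, \<lambda>)\<close>; hence the permuted argument of its inverse.\<close>
definition velocity :: "real \<times> ('n, 'k) phase \<Rightarrow> real^'n" where
  "velocity x = fst (inv (legendre_transform L g (fst x)) (fst (snd (snd x)), fst (snd x), snd (snd (snd x))))"

lemma inv_legendre: "inv (legendre_transform L g t) (p, q, l) = (velocity (t, q, p, l), q, l)"
  and legendre_velocity: "grad (\<lambda>v. augmented_lagrangian L g t q v l) (velocity (t, q, p, l)) = p"
proof -
  have "surj (legendre_transform L g t)" using problem by (auto simp: problem_B_def bij_def)
  then have "legendre_transform L g t (inv (legendre_transform L g t) (p, q, l)) = (p, q, l)"
    by (rule surj_f_inv_f)
  then show "inv (legendre_transform L g t) (p, q, l) = (velocity (t, q, p, l), q, l)"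
    "grad (\<lambda>v. augmented_lagrangian L g t q v l) (velocity (t, q, p, l)) = p"
    by (cases "inv (legendre_transform L g t) (p, q, l)"; simp add: velocity_def)+
qed

lemma legendre_B_iff: "legendre_B L g t z v \<longleftrightarrow> v = velocity (t, z)"
proof (cases z)
  case (fields q p l)
  have "v = velocity (t, z)" if "p = grad (\<lambda>v. augmented_lagrangian L g t q v l) v"
  proof -
    have "inj (legendre_transform L g t)" using problem by (auto simp: problem_B_def bij_def)
    then have "inv (legendre_transform L g t) (legendre_transform L g t (v, q, l)) = (v, q, l)"
      by (rule inv_f_f)
    then show ?thesis using that by (simp add: fields inv_legendre)
  qed
  then show ?thesis using legendre_velocity by (auto simp: fields)
qed

lemma smooth_velocity: "smooth_on UNIV velocity"
proof -
  have "smooth_on UNIV (\<lambda>(t, y). inv (legendre_transform L g t) y)"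
    using problem by (simp add: problem_B_def)
  moreover have "smooth_on UNIV (\<lambda>x. (fst x, fst (snd (snd x)), fst (snd x), snd (snd (snd x))))"
    by (intro smooth_on_bounded_linear open_UNIV bounded_linear_projections)
  ultimately have "smooth_on UNIV (\<lambda>x. (\<lambda>(t, y). inv (legendre_transform L g t) y)
      (fst x, fst (snd (snd x)), fst (snd x), snd (snd (snd x))))"
    by (rule smooth_on_UNIV_compose[rotated])
  from smooth_on_fst[OF open_UNIV this] show ?thesis
    by (simp add: velocity_def[abs_def])
qed

lemma smooth_lagrangian: "smooth_on UNIV (\<lambda>(t, q, v). L t q v)"
  and smooth_constraint: "smooth_on UNIV (\<lambda>(q, v). g i q v)"
  using problem by (simp_all add: problem_B_def)

lemma smooth_lagrangian_velocity: "smooth_on UNIV (L t q)"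
  and smooth_constraint_velocity: "smooth_on UNIV (g i q)"
proof -
  have "smooth_on UNIV (\<lambda>v::real^'n. (t, q, v))" "smooth_on UNIV (\<lambda>v::real^'n. (q, v))"
    by (intro smooth_on_Pair smooth_on_const smooth_on_bounded_linear bounded_linear_ident open_UNIV)+
  from smooth_on_UNIV_compose[OF this(1) smooth_lagrangian] smooth_on_UNIV_compose[OF this(2) smooth_constraint]
  show "smooth_on UNIV (L t q)" "smooth_on UNIV (g i q)" by simp_all
qed

definition augmented :: "real \<times> (real^'n) \<times> (real^'n) \<times> (real^'k) \<Rightarrow> real" where
  "augmented x = augmented_lagrangian L g (fst x) (fst (snd x)) (fst (snd (snd x))) (snd (snd (snd x)))"

lemma smooth_augmented: "smooth_on UNIV augmented"
proof -
  have "smooth_on UNIV (\<lambda>x. (fst x, fst (snd x), fst (snd (snd x))))"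
    by (intro smooth_on_bounded_linear open_UNIV bounded_linear_projections)
  note 1 = smooth_on_UNIV_compose[OF this smooth_lagrangian]
  have "smooth_on UNIV (\<lambda>x. (fst (snd x), fst (snd (snd x))))"
    by (intro smooth_on_bounded_linear open_UNIV bounded_linear_projections)
  note 2 = smooth_on_UNIV_compose[OF this smooth_constraint]
  have 3: "smooth_on UNIV (\<lambda>x. snd (snd (snd x)) $ i)" for i
    by (intro smooth_on_bounded_linear bounded_linear_compose[OF bounded_linear_vec_nth]
        bounded_linear_snd_comp bounded_linear_snd open_UNIV)
  show ?thesis
    unfolding augmented_def augmented_lagrangian_def
    using 1 2 3 by (intro smooth_on_diff smooth_on_sum smooth_on_mult open_UNIV) (simp_all only: prod.case)
qed

lemma hamiltonian_B_eq:
  "hamiltonian_B L g t z = velocity (t, z) \<bullet> fst (snd z) - augmented (t, fst z, velocity (t, z), snd (snd z))"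
  by (cases z) (simp add: augmented_def inv_legendre Let_def)

sublocale smooth_hamiltonian "hamiltonian_B L g"
proof
  have "smooth_on UNIV (\<lambda>x. augmented (fst x, fst (snd x), velocity x, snd (snd (snd x))))"
    by (rule smooth_on_UNIV_compose[OF _ smooth_augmented])
      (intro smooth_on_Pair smooth_velocity smooth_on_bounded_linear open_UNIV bounded_linear_projections)
  moreover have "smooth_on UNIV (\<lambda>x. fst (snd (snd x)))"
    by (intro smooth_on_bounded_linear bounded_linear_fst_comp bounded_linear_snd_comp bounded_linear_snd open_UNIV)
  ultimately have "smooth_on UNIV (\<lambda>x. velocity x \<bullet> fst (snd (snd x))
      - augmented (fst x, fst (snd x), velocity x, snd (snd (snd x))))"
    by (intro smooth_on_diff smooth_on_inner smooth_velocity open_UNIV)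
  then show "smooth_on UNIV (\<lambda>(t, z). hamiltonian_B L g t z)"
    unfolding hamiltonian_B_eq case_prod_unfold prod.collapse .
qed

lemma velocity_multiplier_derivative:
  obtains V' where "((\<lambda>l. velocity (t, q, p, l)) has_derivative V') (at l)"
proof -
  have 1: "((\<lambda>l. (t, q, p, l)) has_derivative (\<lambda>u. (0, 0, 0, u))) (at l)"
    by (intro has_derivative_Pair has_derivative_const has_derivative_ident)
  from has_derivative_compose[OF this smooth_on_has_derivative[OF smooth_velocity UNIV_I]] show thesis
    by (rule that)
qed

text \<open>When \<open>H = v \<bullet> p - F(q, v, \<lambda>)\<close> is differentiated in \<open>\<lambda>\<close>, the contributions of \<open>v(q, p, \<lambda>)\<close> cancel because
  \<open>p = \<nabla>\<^sub>v F\<close>. What remains is \<open>- F\<^sub>\<lambda>\<close>, the vector of the constraint functions.\<close>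
lemma grad_lambda_hamiltonian_B:
  "grad_lambda (hamiltonian_B L g t) z = (\<chi> i. g i (fst z) (velocity (t, z)))"
proof (cases z)
  case (fields q p l)
  define v where "v = velocity (t, z)"
  let ?G = "\<chi> i. g i q v"
  let ?A = "frechet_derivative augmented (at (t, q, v, l))"
  have A: "(augmented has_derivative ?A) (at (t, q, v, l))"
    by (rule smooth_on_has_derivative[OF smooth_augmented UNIV_I])
  obtain V' where V': "((\<lambda>l. velocity (t, q, p, l)) has_derivative V') (at l)"
    by (rule velocity_multiplier_derivative)
  have v: "velocity (t, q, p, l) = v" by (simp add: v_def fields)
  have A_v: "?A (0, 0, w, 0) = w \<bullet> p" for w
  proof -
    have "((\<lambda>v. (t, q, v, l)) has_derivative (\<lambda>w. (0, 0, w, 0))) (at v)"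
      by (intro has_derivative_Pair has_derivative_const has_derivative_ident)
    from has_derivative_compose[OF this A]
    have "((\<lambda>v. augmented_lagrangian L g t q v l) has_derivative (\<lambda>w. ?A (0, 0, w, 0))) (at v)"
      by (simp add: augmented_def)
    from has_gradient(3)[OF this, of w] show ?thesis
      using legendre_velocity[of t q l p] by (simp add: v)
  qed
  have A_l: "?A (0, 0, 0, u) = - (u \<bullet> ?G)" for u
  proof -
    have "((\<lambda>l. (t, q, v, l)) has_derivative (\<lambda>u. (0, 0, 0, u))) (at l)"
      by (intro has_derivative_Pair has_derivative_const has_derivative_ident)
    from has_derivative_compose[OF this A]
    have "((\<lambda>l. augmented_lagrangian L g t q v l) has_derivative (\<lambda>u. ?A (0, 0, 0, u))) (at l)"
      by (simp add: augmented_def)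
    moreover have "((\<lambda>l. augmented_lagrangian L g t q v l) has_derivative (\<lambda>u. 0 - (\<Sum>i\<in>UNIV. u $ i * g i q v))) (at l)"
      unfolding augmented_lagrangian_def
      by (intro has_derivative_diff has_derivative_const has_derivative_sum has_derivative_mult_left
          bounded_linear_imp_has_derivative[OF bounded_linear_vec_nth])
    ultimately have "(\<lambda>u. ?A (0, 0, 0, u)) = (\<lambda>u. 0 - (\<Sum>i\<in>UNIV. u $ i * g i q v))"
      by (rule has_derivative_unique)
    from fun_cong[OF this, of u] show ?thesis by (simp add: inner_vec_def)
  qed
  have "((\<lambda>l. (t, q, velocity (t, q, p, l), l)) has_derivative (\<lambda>u. (0, 0, V' u, u))) (at l)"
    by (intro has_derivative_Pair has_derivative_const has_derivative_ident V')
  from has_derivative_compose[OF this A[folded v]]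
  have "((\<lambda>l. augmented (t, q, velocity (t, q, p, l), l)) has_derivative (\<lambda>u. ?A (0, 0, V' u, u))) (at l)"
    by (simp add: v)
  from has_derivative_diff[OF has_derivative_inner_left[OF V', of p] this]
  have "((\<lambda>l. hamiltonian_B L g t (q, p, l)) has_derivative (\<lambda>u. V' u \<bullet> p - ?A (0, 0, V' u, u))) (at l)"
    by (simp only: hamiltonian_B_eq fst_conv snd_conv)
  moreover have "V' u \<bullet> p - ?A (0, 0, V' u, u) = u \<bullet> ?G" for u
    using linear_add[OF has_derivative_linear[OF A], of "(0, 0, V' u, 0)" "(0, 0, 0, u)"] by (simp add: A_v A_l)
  ultimately have "GDERIV (\<lambda>l. hamiltonian_B L g t (q, p, l)) l :> ?G"
    by (simp add: gderiv_def)
  from grad_eqI[OF this] show ?thesis by (simp add: fields v)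
qed

lemma constraint_set_hamiltonian_B:
  "z \<in> constraint_set (hamiltonian_B L g) t \<longleftrightarrow> (\<forall>i. g i (fst z) (velocity (t, z)) = 0)"
  by (simp add: constraint_set_def grad_lambda_hamiltonian_B vec_eq_iff)

lemma velocity_satisfies_constraints:
  assumes "z \<in> constraint_set (hamiltonian_B L g) t"
  shows "velocity_satisfies (legendre_B L g) g t z"
  using assms by (simp add: velocity_satisfies_def legendre_B_iff constraint_set_hamiltonian_B)

lemma exact_at_stages_B: "exact_at_stages (hamiltonian_B L g) a b (legendre_B L g) g"
  unfolding exact_at_stages_def rk_step_iff using velocity_satisfies_constraints by blast

lemma exact_at_endpoints_B: "exact_at_endpoints (hamiltonian_B L g) a b (legendre_B L g) g"
  unfolding exact_at_endpoints_def using velocity_satisfies_constraints by (simp add: constraint_set_def)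

lemma grad_augmented_lagrangian:
  "grad (\<lambda>v. augmented_lagrangian L g t q v l) v = grad (L t q) v - (\<Sum>i\<in>UNIV. (l $ i) *\<^sub>R grad (g i q) v)"
proof (rule grad_eqI)
  have "((\<lambda>v. L t q v - (\<Sum>i\<in>UNIV. l $ i * g i q v)) has_derivative
      (\<lambda>u. u \<bullet> grad (L t q) v - (\<Sum>i\<in>UNIV. l $ i * (u \<bullet> grad (g i q) v)))) (at v)"
    by (intro has_derivative_diff has_derivative_sum has_derivative_mult_right differentiable_has_gradient
        smooth_on_differentiable smooth_lagrangian_velocity smooth_constraint_velocity)
  then show "GDERIV (\<lambda>v. augmented_lagrangian L g t q v l) v :> grad (L t q) v - (\<Sum>i\<in>UNIV. (l $ i) *\<^sub>R grad (g i q) v)"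
    by (simp add: gderiv_def augmented_lagrangian_def inner_diff_right inner_sum_right)
qed

text \<open>Let \<open>u\<close> be the derivative of the velocity in the multiplier direction \<open>w\<close>. If \<open>H\<^sub>\<lambda>\<^sub>\<lambda> w = 0\<close>, then \<open>u\<close> is compatible with the
  constraints. Differentiating \<open>\<nabla>\<^sub>v F = p\<close> shows \<open>F\<^sub>v\<^sub>v u = \<Sum> w\<^sub>i \<nabla>g\<^sub>i\<close>, which is orthogonal to all compatible variations. So
  \<open>u = 0\<close> by nondegeneracy, and \<open>w = 0\<close> since the gradients \<open>\<nabla>g\<^sub>i\<close> are independent.\<close>
lemma regular_B_imp_regular_hamiltonian:
  assumes "regular_B L g"
  shows "regular_hamiltonian (hamiltonian_B L g)"
proof
  fix z :: "('n, 'k) phase" and t w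
  assume z: "z \<in> constraint_set (hamiltonian_B L g) t"
    and deg: "multiplier (frechet_derivative gradH (at (t, z)) (0, phase_point 0 w)) = 0"
  obtain q p l where fields: "z = (q, p, l)" by (cases z)
  define v where "v = velocity (t, z)"
  have v: "velocity (t, q, p, l) = v" by (simp add: v_def fields)
  let ?a = "grad (L t q)" and ?b = "\<lambda>i. grad (g i q)"
  let ?\<Gamma> = "grad (\<lambda>v. augmented_lagrangian L g t q v l)"
  let ?T = "frechet_derivative ?\<Gamma> (at v)"
  obtain V' where V': "((\<lambda>l. velocity (t, q, p, l)) has_derivative V') (at l)"
    by (rule velocity_multiplier_derivative)
  define u where "u = V' w"
  have g0: "g i q v = 0" for i
    using z by (simp add: constraint_set_hamiltonian_B fields v)
  have u: "?b i v \<bullet> u = 0" for i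
  proof -
    have "((\<lambda>l. (t, q, p, l)) has_derivative (\<lambda>u. (0, 0, 0, u))) (at l)"
      by (intro has_derivative_Pair has_derivative_const has_derivative_ident)
    from has_derivative_compose[OF this smooth_on_has_derivative[OF smooth_gradH UNIV_I]]
    have "((\<lambda>l. multiplier (gradH (t, q, p, l)) $ i) has_derivative
        (\<lambda>w. multiplier (frechet_derivative gradH (at (t, q, p, l)) (0, 0, 0, w)) $ i)) (at l)"
      by (intro bounded_linear.has_derivative[OF bounded_linear_vec_nth] bounded_linear.has_derivative[OF bounded_linear_multiplier])
    moreover have "multiplier (gradH (t, q, p, l)) $ i = g i q (velocity (t, q, p, l))" for l
      unfolding grad_lambda_H[symmetric] grad_lambda_hamiltonian_B by simp
    ultimately have D1: "((\<lambda>l. g i q (velocity (t, q, p, l))) has_derivative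
        (\<lambda>w. multiplier (frechet_derivative gradH (at (t, q, p, l)) (0, 0, 0, w)) $ i)) (at l)"
      by simp
    have "(g i q has_derivative (\<lambda>u. u \<bullet> ?b i v)) (at (velocity (t, q, p, l)))"
      unfolding v by (intro differentiable_has_gradient smooth_on_differentiable smooth_constraint_velocity)
    from has_derivative_unique[OF D1 has_derivative_compose[OF V' this], THEN fun_cong, of w] deg
    show ?thesis by (simp add: fields phase_point_def u_def inner_commute)
  qed
  have a': "(?a has_derivative frechet_derivative ?a (at v)) (at v)"
    and b': "\<And>i. (?b i has_derivative frechet_derivative (?b i) (at v)) (at v)"
    by (intro smooth_on_has_derivative[OF smooth_on_grad UNIV_I] smooth_lagrangian_velocity smooth_constraint_velocity)+
  have "(?\<Gamma> has_derivative (\<lambda>u. frechet_derivative ?a (at v) u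
      - (\<Sum>i\<in>UNIV. (l $ i) *\<^sub>R frechet_derivative (?b i) (at v) u))) (at v)"
    unfolding grad_augmented_lagrangian[abs_def]
    by (intro has_derivative_diff a' has_derivative_sum has_derivative_scaleR_right b')
  then have T: "?T = (\<lambda>u. frechet_derivative ?a (at v) u
      - (\<Sum>i\<in>UNIV. (l $ i) *\<^sub>R frechet_derivative (?b i) (at v) u))" and linT: "linear ?T"
    using has_derivative_linear by (simp_all add: frechet_derivative_at[symmetric])
  have Tu: "?T u = (\<Sum>i\<in>UNIV. (w $ i) *\<^sub>R ?b i v)"
  proof -
    have aV: "((\<lambda>l. ?a (velocity (t, q, p, l))) has_derivative (\<lambda>w. frechet_derivative ?a (at v) (V' w))) (at l)"
      by (rule has_derivative_compose[OF V']) (simp add: v a')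
    have bV: "((\<lambda>l. ?b i (velocity (t, q, p, l))) has_derivative (\<lambda>w. frechet_derivative (?b i) (at v) (V' w))) (at l)" for i
      by (rule has_derivative_compose[OF V']) (simp add: v b')
    have "((\<lambda>l. ?a (velocity (t, q, p, l)) - (\<Sum>i\<in>UNIV. (l $ i) *\<^sub>R ?b i (velocity (t, q, p, l)))) has_derivative
      (\<lambda>w. frechet_derivative ?a (at v) (V' w) - (\<Sum>i\<in>UNIV. (l $ i) *\<^sub>R frechet_derivative (?b i) (at v) (V' w)
         + (w $ i) *\<^sub>R ?b i (velocity (t, q, p, l))))) (at l)"
      by (intro has_derivative_diff aV has_derivative_sum has_derivative_scaleR bV
          bounded_linear_imp_has_derivative[OF bounded_linear_vec_nth])
    moreover have "?a (velocity (t, q, p, l)) - (\<Sum>i\<in>UNIV. (l $ i) *\<^sub>R ?b i (velocity (t, q, p, l))) = p" for l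
      using legendre_velocity[of t q l p] by (simp add: grad_augmented_lagrangian)
    ultimately have "((\<lambda>l::real^'k. p) has_derivative
      (\<lambda>w. frechet_derivative ?a (at v) (V' w) - (\<Sum>i\<in>UNIV. (l $ i) *\<^sub>R frechet_derivative (?b i) (at v) (V' w)
         + (w $ i) *\<^sub>R ?b i (velocity (t, q, p, l))))) (at l)" by simp
    from has_derivative_unique[OF this has_derivative_const, THEN fun_cong, of w]
    show ?thesis unfolding T by (simp add: u_def v sum.distrib)
  qed
  have "nondegenerate_on {u. \<forall>i. ?b i v \<bullet> u = 0} ?T"
    using assms g0 unfolding regular_B_def by blast
  moreover have "x \<bullet> ?T u = 0" if "\<forall>i. ?b i v \<bullet> x = 0" for x
    using that unfolding Tu by (simp add: inner_sum_right inner_commute)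
  ultimately have "u = 0" using u unfolding nondegenerate_on_def by blast
  then have "(\<Sum>i\<in>UNIV. (w $ i) *\<^sub>R ?b i v) = 0" using Tu linear_0[OF linT] by simp
  moreover have "rank (\<chi> i. ?b i v) = CARD('k)" using problem by (simp add: problem_B_def)
  ultimately show "w = 0" using full_rank_rows_independent[of "\<chi> i. ?b i v" w] by simp
qed

lemma yields_B:
  assumes "regular_B L g" "symplectic_rk a b"
  shows "yields_convergent_preserving_symplectic (hamiltonian_B L g) a b"
  using regular_hamiltonian.symplectic_rk_convergent_preserving_symplectic[OF regular_B_imp_regular_hamiltonian] assms
  by blast

end

section \<open>Quadratic kinetic energy and constraints linear in the velocity\<close>

definition mechanical_lagrangian :: "real^'n^'n \<Rightarrow> (real^'n \<Rightarrow> real) \<Rightarrow> real \<Rightarrow> real^'n \<Rightarrow> real^'n \<Rightarrow> real" where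
  "mechanical_lagrangian M V t q v = v \<bullet> (M *v v) / 2 - V q"

lemma matrix_inv_inverse:
  assumes "invertible M"
  shows "M *v (matrix_inv M *v x) = x" "matrix_inv M *v (M *v x) = x"
proof -
  have "M ** matrix_inv M = mat 1 \<and> matrix_inv M ** M = mat 1"
    using assms unfolding invertible_def matrix_inv_def by (rule someI_ex)
  then show "M *v (matrix_inv M *v x) = x" "matrix_inv M *v (M *v x) = x"
    by (simp_all add: matrix_vector_mul_assoc)
qed

context
  fixes M :: "real^'n^'n" and V :: "real^'n \<Rightarrow> real" and g :: "'k::finite \<Rightarrow> real^'n \<Rightarrow> real^'n::finite"
  assumes problem: "problem_A M V g"
begin

abbreviation (input) "linear_constraints \<equiv> \<lambda>i q v. g i q \<bullet> v"

lemma symmetric: "x \<bullet> (M *v y) = y \<bullet> (M *v x)"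
proof -
  have "transpose M = M" using problem by (simp add: problem_A_def)
  then have "x \<bullet> (M *v y) = (M *v x) \<bullet> y"
    using dot_lmul_matrix[of x M y] transpose_matrix_vector[of M x] by simp
  then show ?thesis by (simp add: inner_commute)
qed

lemma matrix_inv_M: "M *v (matrix_inv M *v x) = x" "matrix_inv M *v (M *v x) = x"
  by (rule matrix_inv_inverse, use problem in \<open>simp add: problem_A_def\<close>)+

lemma grad_mechanical:
  "grad (\<lambda>v. augmented_lagrangian (mechanical_lagrangian M V) linear_constraints t q v l) v =
     M *v v - (\<Sum>i\<in>UNIV. (l $ i) *\<^sub>R g i q)"
proof (rule grad_eqI)
  have "((\<lambda>v. (v \<bullet> (M *v v)) / 2 - V q - (\<Sum>i\<in>UNIV. l $ i * (g i q \<bullet> v))) has_derivative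
      (\<lambda>u. (v \<bullet> (M *v u) + u \<bullet> (M *v v)) / 2 - 0 - (\<Sum>i\<in>UNIV. l $ i * (g i q \<bullet> u)))) (at v)"
    by (intro has_derivative_diff bounded_linear.has_derivative[OF bounded_linear_divide] has_derivative_inner has_derivative_ident
        bounded_linear_imp_has_derivative[OF matrix_vector_mul_bounded_linear] has_derivative_const
        has_derivative_sum has_derivative_mult_right has_derivative_inner_right)
  moreover have "(v \<bullet> (M *v u) + u \<bullet> (M *v v)) / 2 - 0 - (\<Sum>i\<in>UNIV. l $ i * (g i q \<bullet> u)) =
      u \<bullet> (M *v v - (\<Sum>i\<in>UNIV. (l $ i) *\<^sub>R g i q))" for u
    using symmetric[of v u] by (simp add: inner_diff_right inner_sum_right inner_commute)
  ultimately show "GDERIV (\<lambda>v. augmented_lagrangian (mechanical_lagrangian M V) linear_constraints t q v l) v :>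
      M *v v - (\<Sum>i\<in>UNIV. (l $ i) *\<^sub>R g i q)"
    unfolding gderiv_def augmented_lagrangian_def mechanical_lagrangian_def by simp
qed

lemma legendre_A_eq: "(\<lambda>t. legendre_A M g) = legendre_B (mechanical_lagrangian M V) linear_constraints"
proof (intro ext)
  fix t z v
  show "legendre_A M g z v = legendre_B (mechanical_lagrangian M V) linear_constraints t z v"
    by (cases z) (simp only: legendre_A.simps legendre_B.simps grad_mechanical)
qed

lemma legendre_mechanical:
  "bij (legendre_transform (mechanical_lagrangian M V) linear_constraints t)"
  "inv (legendre_transform (mechanical_lagrangian M V) linear_constraints t) (p, q, l) =
     (matrix_inv M *v (p + (\<Sum>i\<in>UNIV. (l $ i) *\<^sub>R g i q)), q, l)"
proof -
  let ?T = "legendre_transform (mechanical_lagrangian M V) linear_constraints t"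
  define S where "S = (\<lambda>(p, q, l). (matrix_inv M *v (p + (\<Sum>i\<in>UNIV. (l $ i) *\<^sub>R g i q)), q, l))"
  have T: "?T (v, q, l) = (M *v v - (\<Sum>i\<in>UNIV. (l $ i) *\<^sub>R g i q), q, l)" for v q l
    by (simp only: legendre_transform.simps grad_mechanical)
  have S: "S (?T y) = y" "?T (S y) = y" for y
    by (cases y, simp only: T S_def prod.case matrix_inv_M diff_add_cancel add_diff_cancel_right')+
  show bij: "bij ?T"
    by (rule bijI[OF inj_on_inverseI[of UNIV S ?T, OF S(1)] surjI[of ?T S, OF S(2)]])
  have "inv ?T (p, q, l) = S (p, q, l)"
    by (rule inv_f_eq[OF bij_is_inj[OF bij] S(2)])
  then show "inv ?T (p, q, l) = (matrix_inv M *v (p + (\<Sum>i\<in>UNIV. (l $ i) *\<^sub>R g i q)), q, l)"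
    unfolding S_def prod.case .
qed

lemma problem_A_imp_B: "problem_B (mechanical_lagrangian M V) linear_constraints"
proof -
  note proj = smooth_on_bounded_linear[OF _ open_UNIV]
  have V: "smooth_on UNIV V" and g: "\<And>i. smooth_on UNIV (g i)" using problem by (auto simp: problem_A_def)
  have q: "smooth_on UNIV (\<lambda>x::real \<times> (real^'n) \<times> (real^'n). fst (snd x))"
    and v: "smooth_on UNIV (\<lambda>x::real \<times> (real^'n) \<times> (real^'n). snd (snd x))"
    by (intro proj bounded_linear_projections)+
  have "smooth_on UNIV (\<lambda>x::real \<times> (real^'n) \<times> (real^'n).
      snd (snd x) \<bullet> (M *v snd (snd x)) * (1/2) - V (fst (snd x)))"
    by (intro smooth_on_diff smooth_on_mult smooth_on_inner v smooth_on_const open_UNIV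
        smooth_on_UNIV_compose[OF q V] smooth_on_bounded_linear_compose[OF matrix_vector_mul_bounded_linear])
  then have 1: "smooth_on UNIV (\<lambda>(t, q, v). mechanical_lagrangian M V t q v)"
    by (simp add: mechanical_lagrangian_def case_prod_unfold)
  have "smooth_on UNIV (\<lambda>x::(real^'n) \<times> (real^'n). g i (fst x) \<bullet> snd x)" for i
    by (intro smooth_on_inner smooth_on_UNIV_compose[OF _ g] proj bounded_linear_projections open_UNIV)
  then have 2: "smooth_on UNIV (\<lambda>(q, v). g i q \<bullet> v)" for i by (simp add: case_prod_unfold)
  have "smooth_on UNIV (\<lambda>x::real \<times> (real^'n) \<times> (real^'n) \<times> (real^'k).
      (matrix_inv M *v (fst (snd x) + (\<Sum>i\<in>UNIV. (snd (snd (snd x)) $ i) *\<^sub>R g i (fst (snd (snd x))))),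
       fst (snd (snd x)), snd (snd (snd x))))"
    by (intro smooth_on_Pair smooth_on_bounded_linear_compose[OF matrix_vector_mul_bounded_linear] smooth_on_add
        smooth_on_sum smooth_on_scaleR smooth_on_UNIV_compose[OF _ g] open_UNIV
        smooth_on_bounded_linear_compose[OF bounded_linear_vec_nth] proj bounded_linear_projections)
  moreover have "inv (legendre_transform (mechanical_lagrangian M V) linear_constraints t) y =
      (matrix_inv M *v (fst y + (\<Sum>i\<in>UNIV. (snd (snd y) $ i) *\<^sub>R g i (fst (snd y)))), fst (snd y), snd (snd y))" for t y
    using legendre_mechanical(2)[of t "fst y" "fst (snd y)" "snd (snd y)"] by simp
  ultimately have 3: "smooth_on UNIV (\<lambda>(t, y). inv (legendre_transform (mechanical_lagrangian M V) linear_constraints t) y)"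
    by (simp add: case_prod_unfold)
  have 4: "rank (\<chi> i. grad (linear_constraints i q) v) = CARD('k)" for q v
  proof -
    have "grad (\<lambda>v. g i q \<bullet> v) v = g i q" for i
      by (rule grad_eqI) (auto simp: gderiv_def inner_commute intro!: derivative_eq_intros)
    then have "(\<chi> i. grad (linear_constraints i q) v) = (\<chi> i. g i q)" by simp
    moreover have "rows (\<chi> i. g i q) = range (\<lambda>i. g i q)"
      by (auto simp: rows_def row_def)
    ultimately show ?thesis
      using problem by (auto simp: problem_A_def row_rank_def dim_eq_card_independent card_image)
  qed
  show ?thesis unfolding problem_B_def using 1 2 3 4 legendre_mechanical(1) by simp
qed

lemma hamiltonian_A_eq: "(\<lambda>t. hamiltonian_A M V g) = hamiltonian_B (mechanical_lagrangian M V) linear_constraints"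
proof (intro ext)
  fix t and z :: "('n, 'k) phase"
  obtain q p l where z: "z = (q, p, l)" by (cases z)
  define w where "w = p + (\<Sum>i\<in>UNIV. (l $ i) *\<^sub>R g i q)"
  let ?v = "matrix_inv M *v w"
  have "augmented_lagrangian (mechanical_lagrangian M V) linear_constraints t q ?v l = ?v \<bullet> p - (w \<bullet> ?v / 2 + V q)"
  proof -
    have "(\<Sum>i\<in>UNIV. l $ i * (g i q \<bullet> ?v)) = (\<Sum>i\<in>UNIV. (l $ i) *\<^sub>R g i q) \<bullet> ?v"
      by (simp add: inner_sum_left)
    also have "\<dots> = w \<bullet> ?v - p \<bullet> ?v" by (simp add: w_def inner_add_left)
    finally show ?thesis
      by (simp add: augmented_lagrangian_def mechanical_lagrangian_def matrix_inv_M inner_commute)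
  qed
  then show "hamiltonian_A M V g z = hamiltonian_B (mechanical_lagrangian M V) linear_constraints t z"
    by (simp add: z legendre_mechanical(2) w_def[symmetric] Let_def)
qed

lemma regular_A_imp_B:
  assumes "regular_A M g"
  shows "regular_B (mechanical_lagrangian M V) linear_constraints"
  unfolding regular_B_def
proof (intro allI impI)
  fix t q v and l :: "real^'k"
  have "grad (\<lambda>v. g i q \<bullet> v) v = g i q" for i
    by (rule grad_eqI) (auto simp: gderiv_def inner_commute intro!: derivative_eq_intros)
  moreover have "frechet_derivative (grad (\<lambda>v. augmented_lagrangian (mechanical_lagrangian M V) linear_constraints t q v l)) (at v)
      = (*v) M"
  proof (rule frechet_derivative_at[symmetric])
    have "((\<lambda>v. M *v v - (\<Sum>i\<in>UNIV. (l $ i) *\<^sub>R g i q)) has_derivative (\<lambda>u. M *v u - 0)) (at v)"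
      by (intro has_derivative_diff has_derivative_const bounded_linear_imp_has_derivative[OF matrix_vector_mul_bounded_linear])
    then show "(grad (\<lambda>v. augmented_lagrangian (mechanical_lagrangian M V) linear_constraints t q v l) has_derivative (*v) M) (at v)"
      unfolding grad_mechanical[abs_def] by simp
  qed
  ultimately show "nondegenerate_on {u. \<forall>i. grad (linear_constraints i q) v \<bullet> u = 0}
     (frechet_derivative (grad (\<lambda>v. augmented_lagrangian (mechanical_lagrangian M V) linear_constraints t q v l)) (at v))"
    using assms by (simp add: regular_A_def)
qed

end

theorem corollary5:
  fixes a :: "'s::finite \<Rightarrow> 's \<Rightarrow> real" and b :: "'s \<Rightarrow> real"
  assumes "symplectic_rk a b"
  shows
    "(\<forall>(M :: real^'n::finite^'n) V (g :: 'k::finite \<Rightarrow> real^'n \<Rightarrow> real^'n).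
        problem_A M V g \<longrightarrow>
          (regular_A M g \<longrightarrow>
            yields_convergent_preserving_symplectic (\<lambda>t. hamiltonian_A M V g) a b) \<and>
          exact_at_stages (\<lambda>t. hamiltonian_A M V g) a b
            (\<lambda>t. legendre_A M g) (\<lambda>i q v. g i q \<bullet> v) \<and>
          exact_at_endpoints (\<lambda>t. hamiltonian_A M V g) a b
            (\<lambda>t. legendre_A M g) (\<lambda>i q v. g i q \<bullet> v)) \<and>
     (\<forall>(L :: real \<Rightarrow> real^'n \<Rightarrow> real^'n \<Rightarrow> real) (g :: 'k \<Rightarrow> real^'n \<Rightarrow> real^'n \<Rightarrow> real).
        problem_B L g \<longrightarrow>
          (regular_B L g \<longrightarrow>
            yields_convergent_preserving_symplectic (hamiltonian_B L g) a b) \<and>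
          exact_at_stages (hamiltonian_B L g) a b (legendre_B L g) g \<and>
          exact_at_endpoints (hamiltonian_B L g) a b (legendre_B L g) g)"
proof -
  have B: "(regular_B L g \<longrightarrow> yields_convergent_preserving_symplectic (hamiltonian_B L g) a b) \<and>
      exact_at_stages (hamiltonian_B L g) a b (legendre_B L g) g \<and>
      exact_at_endpoints (hamiltonian_B L g) a b (legendre_B L g) g"
    if "problem_B L g"
    for L :: "real \<Rightarrow> real^'n \<Rightarrow> real^'n \<Rightarrow> real" and g :: "'k \<Rightarrow> real^'n \<Rightarrow> real^'n \<Rightarrow> real"
  proof -
    interpret velocity_constrained L g by standard (rule that)
    show ?thesis
      using yields_B[OF _ assms] exact_at_stages_B exact_at_endpoints_B by blast
  qed
  show ?thesis
  proof (intro conjI allI impI)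
    fix M :: "real^'n^'n" and V and g :: "'k \<Rightarrow> real^'n \<Rightarrow> real^'n"
    assume A: "problem_A M V g"
    note B' = B[OF problem_A_imp_B[OF A]]
    show "yields_convergent_preserving_symplectic (\<lambda>t. hamiltonian_A M V g) a b" if "regular_A M g"
      unfolding hamiltonian_A_eq[OF A] using B' regular_A_imp_B[OF A that] by blast
    show "exact_at_stages (\<lambda>t. hamiltonian_A M V g) a b (\<lambda>t. legendre_A M g) (\<lambda>i q v. g i q \<bullet> v)"
      unfolding hamiltonian_A_eq[OF A] legendre_A_eq[OF A] using B' by blast
    show "exact_at_endpoints (\<lambda>t. hamiltonian_A M V g) a b (\<lambda>t. legendre_A M g) (\<lambda>i q v. g i q \<bullet> v)"
      unfolding hamiltonian_A_eq[OF A] legendre_A_eq[OF A] using B' by blast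
  qed (use B in blast)+
qed

end
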